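(* Let $\Omega\subset\mathbb{R}^n$ be an $\dot H^1$-admissible domain, let $D_1$ and $D_2$ be two-sided $\dot H^1$-admissible domains such that $D_1\subset D_2\subset\subset\Omega$, and let $k\in(0,1)\cup(1,+\infty)$. Suppose that $g\in\dot{\mathcal{B}}'(\partial\Omega)$ is nonzero and that, for $p=1,2$, $u_p\in\dot H^1(\Omega)$ is the unique weak solution in the $\dot H^1$-sense of $$\nabla\cdot\big((1+(k-1)\mathbf{1}_{D_p})\nabla u_p\big)=0\ \text{ on }\Omega,\qquad \frac{\partial_iu_p}{\partial\nu}\Big|_{\partial\Omega}=g.$$ Then $\dot{\operatorname{Tr}}_{\partial\Omega,i}u_1=\dot{\operatorname{Tr}}_{\partial\Omega,i}u_2$ implies $D_1=D_2$.
   Context: All spaces are real. For nonempty open $U\subset\mathbb{R}^n$, $\dot H^1(U)$ is the Hilbert space of all $u\in L^2_{\mathrm{loc}}(U)$ with $\nabla u\in L^2(U,\mathbb{R}^n)$, modulo locally constant functions, with $\langle u,v\rangle_{\dot H^1(U)}=\int_U\nabla u\cdot\nabla v\,dx$. A nonempty connected open $U$ is an $\dot H^1$-extension domain if there is a bounded linear extension operator $\dot H^1(U)\to\dot H^1(\mathbb{R}^n)$. Capacity, quasi continuity and quasi everywhere (q.e.) refer to $H^1(\mathbb{R}^n)$: $\operatorname{Cap}(U)=\inf\{\|u\|^2_{H^1(\mathbb{R}^n)}:u\in H^1(\mathbb{R}^n),\,u\ge1\text{ a.e. on }U\}$ for open $U$, and $\operatorname{Cap}(A)=\inf\{\operatorname{Cap}(U):A\subset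 U,\ U\text{ open}\}$ in general. $\Omega$ is $\dot H^1$-admissible if it is an $\dot H^1$-extension domain and $\partial\Omega$ is compact and of positive capacity. A domain $D$ is two-sided $\dot H^1$-admissible if $D$ and $\mathbb{R}^n\setminus\overline D$ are both $\dot H^1$-extension domains, $D$ is bounded, $\partial D=\partial(\mathbb{R}^n\setminus\overline D)$, and $\partial D$ has Lebesgue measure zero. $D\subset\subset\Omega$ means that $\overline D$ is compact and contained in $\Omega$. Every $w\in\dot H^1(\mathbb{R}^n)$ has a quasi continuous representative $\widetilde w$, unique q.e. up to an additive constant. $\dot{\mathcal{B}}(\partial\Omega)$ is the vector space of q.e. classes modulo constants of restrictions $\widetilde w|_{\partial\Omega}$, $w\in\dot H^1(\mathbb{R}^n)$. The interior trace $\dot{\operatorname{Tr}}_{\partial\Omega,i}:\dot H^1(\Omega)\to\dot{\mathcal{B}}(\partial\Omega)$ sends $u$ to the class of $\widetilde w|_{\partial\Omega}$ for any $w\in\dot H^1(\mathbb{R}^n)$ extending $u$; it is a well-defined linear surjection. $\dot{\mathcal{B}}(\partial\Omega)$ carries the Hilbert norm $\|f\|=\min\{\|v\|_{\dot H^1(\Omega)}:\dot{\operatorname{Tr}}_{\partial\Omega,i}v=f\}$; $\dot{\mathcal{B}}'(\partial\Omega)$ is its dual, with pairing $\langle\cdot,\cdot\rangle_{\dot{\mathcal{B}}',\dot{\mathcal{B}}}$. Weak solution (for $D=D_1$ or $D_2$): let $\chi\in C_c^\infty(\Omega)$ with $0\le\chi\le1$ and $\chi\equiv1$ on a neighbourhood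 of $\overline D$. $u\in\dot H^1(\Omega)$ is a weak solution in the $\dot H^1$-sense of the Neumann problem in the claim if $\int_\Omega(1+(k-1)\mathbf{1}_D)\nabla u\cdot\nabla v\,dx=0$ for all $v\in C_c^\infty(\Omega)$ and $\langle u,(1-\chi)v\rangle_{\dot H^1(\Omega)}=\langle g,\dot{\operatorname{Tr}}_{\partial\Omega,i}v\rangle_{\dot{\mathcal{B}}',\dot{\mathcal{B}}}$ for all $v\in\dot H^1(\Omega)$ (this does not depend on $\chi$, nor on the representative of $v$); it exists and is unique. *)

theory Defs
  imports "HOL-Analysis.Analysis"
begin

(* Conventions. Elements of the function spaces are represented by functions on all of
   real ^ 'n, of which only the values on U (resp. on the boundary) matter; the quotients are
   expressed by explicit equivalence relations on representatives. Every Lebesgue class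
   contains a Borel function, so lborel is used throughout. *)

section \<open>Test functions\<close>

definition grad :: "(real ^ 'n \<Rightarrow> real) \<Rightarrow> real ^ 'n \<Rightarrow> real ^ 'n" where
  "grad f x = (\<chi> i. frechet_derivative f (at x) (axis i 1))"

primrec C_k :: "nat \<Rightarrow> (real ^ 'n \<Rightarrow> real) \<Rightarrow> bool" where
  "C_k 0 f \<longleftrightarrow> continuous_on UNIV f"
| "C_k (Suc k) f \<longleftrightarrow> (\<forall>x. f differentiable at x) \<and> (\<forall>i. C_k k (\<lambda>x. grad f x $ i))"

definition test_functions :: "(real ^ 'n) set \<Rightarrow> (real ^ 'n \<Rightarrow> real) set" where
  "test_functions U =
     {\<phi>. (\<forall>k. C_k k \<phi>) \<and> compact (closure {x. \<phi> x \<noteq> 0}) \<and> closure {x. \<phi> x \<noteq> 0} \<subseteq> U}"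

section \<open>Homogeneous Sobolev spaces\<close>

definition L2_loc :: "(real ^ 'n) set \<Rightarrow> (real ^ 'n \<Rightarrow> real) set" where
  "L2_loc U = {u. set_borel_measurable lborel U u \<and>
     (\<forall>K. compact K \<and> K \<subseteq> U \<longrightarrow> set_integrable lborel K (\<lambda>x. (u x)\<^sup>2))}"

definition L2_field :: "(real ^ 'n) set \<Rightarrow> (real ^ 'n \<Rightarrow> real ^ 'n) set" where
  "L2_field U = {G. set_borel_measurable lborel U G \<and>
     set_integrable lborel U (\<lambda>x. (norm (G x))\<^sup>2)}"

definition has_weak_gradient ::
  "(real ^ 'n) set \<Rightarrow> (real ^ 'n \<Rightarrow> real) \<Rightarrow> (real ^ 'n \<Rightarrow> real ^ 'n) \<Rightarrow> bool" where
  "has_weak_gradient U u G \<longleftrightarrow> (\<forall>\<phi>\<in>test_functions U.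
     (LINT x:U|lborel. u x *\<^sub>R grad \<phi> x) = - (LINT x:U|lborel. \<phi> x *\<^sub>R G x))"

definition Hdot1 :: "(real ^ 'n) set \<Rightarrow> (real ^ 'n \<Rightarrow> real) set" where
  "Hdot1 U = {u \<in> L2_loc U. \<exists>G\<in>L2_field U. has_weak_gradient U u G}"

(* Determined only up to a null set of U, and irrelevant outside U. *)
definition weak_grad :: "(real ^ 'n) set \<Rightarrow> (real ^ 'n \<Rightarrow> real) \<Rightarrow> real ^ 'n \<Rightarrow> real ^ 'n" where
  "weak_grad U u = (SOME G. G \<in> L2_field U \<and> has_weak_gradient U u G)"

definition Hdot1_inner ::
  "(real ^ 'n) set \<Rightarrow> (real ^ 'n \<Rightarrow> real) \<Rightarrow> (real ^ 'n \<Rightarrow> real) \<Rightarrow> real" where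
  "Hdot1_inner U u v = (LINT x:U|lborel. weak_grad U u x \<bullet> weak_grad U v x)"

definition Hdot1_norm :: "(real ^ 'n) set \<Rightarrow> (real ^ 'n \<Rightarrow> real) \<Rightarrow> real" where
  "Hdot1_norm U u = sqrt (Hdot1_inner U u u)"

(* Equality in Hdot1 U: modulo null sets and locally constant functions. *)
definition Hdot1_eq ::
  "(real ^ 'n) set \<Rightarrow> (real ^ 'n \<Rightarrow> real) \<Rightarrow> (real ^ 'n \<Rightarrow> real) \<Rightarrow> bool" where
  "Hdot1_eq U u v \<longleftrightarrow> (\<exists>c.
     (\<forall>x\<in>U. \<exists>V. open V \<and> x \<in> V \<and> c constant_on (V \<inter> U)) \<and>
     (AE x in lborel. x \<in> U \<longrightarrow> u x = v x + c x))"

(* The operator E acts on representatives; it is linear, and compatible with the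
   quotients, modulo Hdot1_eq. *)
definition extension_domain :: "(real ^ 'n) set \<Rightarrow> bool" where
  "extension_domain U \<longleftrightarrow> open U \<and> connected U \<and> U \<noteq> {} \<and>
     (\<exists>E :: (real ^ 'n \<Rightarrow> real) \<Rightarrow> real ^ 'n \<Rightarrow> real.
        (\<forall>u\<in>Hdot1 U. E u \<in> Hdot1 UNIV \<and> Hdot1_eq U (E u) u) \<and>
        (\<forall>u\<in>Hdot1 U. \<forall>v\<in>Hdot1 U. Hdot1_eq U u v \<longrightarrow> Hdot1_eq UNIV (E u) (E v)) \<and>
        (\<forall>u\<in>Hdot1 U. \<forall>v\<in>Hdot1 U.
           Hdot1_eq UNIV (E (\<lambda>x. u x + v x)) (\<lambda>x. E u x + E v x)) \<and>
        (\<forall>a. \<forall>u\<in>Hdot1 U. Hdot1_eq UNIV (E (\<lambda>x. a * u x)) (\<lambda>x. a * E u x)) \<and>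
        (\<exists>C. \<forall>u\<in>Hdot1 U. Hdot1_norm UNIV (E u) \<le> C * Hdot1_norm U u))"

section \<open>Capacity\<close>

definition H1 :: "(real ^ 'n \<Rightarrow> real) set" where
  "H1 = {u \<in> Hdot1 UNIV. integrable lborel (\<lambda>x. (u x)\<^sup>2)}"

definition H1_norm_sq :: "(real ^ 'n \<Rightarrow> real) \<Rightarrow> real" where
  "H1_norm_sq u = (LINT x|lborel. (u x)\<^sup>2) + Hdot1_inner UNIV u u"

definition cap_open :: "(real ^ 'n) set \<Rightarrow> ennreal" where
  "cap_open U = (INF u\<in>{u \<in> H1. AE x in lborel. x \<in> U \<longrightarrow> u x \<ge> 1}. ennreal (H1_norm_sq u))"

definition cap :: "(real ^ 'n) set \<Rightarrow> ennreal" where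
  "cap A = (INF U\<in>{U. open U \<and> A \<subseteq> U}. cap_open U)"

definition qe_on :: "(real ^ 'n) set \<Rightarrow> (real ^ 'n \<Rightarrow> bool) \<Rightarrow> bool" where
  "qe_on A P \<longleftrightarrow> (\<exists>N. cap N = 0 \<and> (\<forall>x\<in>A - N. P x))"

definition quasi_continuous :: "(real ^ 'n \<Rightarrow> real) \<Rightarrow> bool" where
  "quasi_continuous f \<longleftrightarrow>
     (\<forall>\<epsilon>>0. \<exists>G. open G \<and> cap G < ennreal \<epsilon> \<and> continuous_on (- G) f)"

definition qc_representative :: "(real ^ 'n \<Rightarrow> real) \<Rightarrow> (real ^ 'n \<Rightarrow> real) \<Rightarrow> bool" where
  "qc_representative w wt \<longleftrightarrow> quasi_continuous wt \<and> (AE x in lborel. wt x = w x)"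

section \<open>Admissible domains\<close>

definition admissible :: "(real ^ 'n) set \<Rightarrow> bool" where
  "admissible \<Omega> \<longleftrightarrow> extension_domain \<Omega> \<and> compact (frontier \<Omega>) \<and> cap (frontier \<Omega>) > 0"

definition two_sided_admissible :: "(real ^ 'n) set \<Rightarrow> bool" where
  "two_sided_admissible D \<longleftrightarrow> extension_domain D \<and> extension_domain (- closure D) \<and>
     bounded D \<and> frontier D = frontier (- closure D) \<and> frontier D \<in> null_sets lborel"

definition compactly_contained :: "(real ^ 'n) set \<Rightarrow> (real ^ 'n) set \<Rightarrow> bool" where
  "compactly_contained D \<Omega> \<longleftrightarrow> compact (closure D) \<and> closure D \<subseteq> \<Omega>"

section \<open>The trace space, the interior trace and the dual\<close>

(* Equality in the trace space: quasi everywhere on the boundary, modulo constants. *)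
definition Bdot_eq ::
  "(real ^ 'n) set \<Rightarrow> (real ^ 'n \<Rightarrow> real) \<Rightarrow> (real ^ 'n \<Rightarrow> real) \<Rightarrow> bool" where
  "Bdot_eq \<Omega> f h \<longleftrightarrow> (\<exists>c. qe_on (frontier \<Omega>) (\<lambda>x. f x = h x + c))"

(* All representatives of all classes. *)
definition Bdot :: "(real ^ 'n) set \<Rightarrow> (real ^ 'n \<Rightarrow> real) set" where
  "Bdot \<Omega> = {f. \<exists>w\<in>Hdot1 UNIV. \<exists>wt. qc_representative w wt \<and> Bdot_eq \<Omega> f wt}"

(* The class of the trace of u, as the set of its representatives. By well-definedness of
   the trace on admissible domains this is a single class of Bdot_eq, i.e. the union over the
   extensions w of u is the same as the class obtained from any one of them. *)
definition interior_trace ::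
  "(real ^ 'n) set \<Rightarrow> (real ^ 'n \<Rightarrow> real) \<Rightarrow> (real ^ 'n \<Rightarrow> real) set" where
  "interior_trace \<Omega> u = {f. \<exists>w\<in>Hdot1 UNIV. Hdot1_eq \<Omega> w u \<and>
     (\<exists>wt. qc_representative w wt \<and> Bdot_eq \<Omega> f wt)}"

definition Bdot_norm :: "(real ^ 'n) set \<Rightarrow> (real ^ 'n \<Rightarrow> real) \<Rightarrow> real" where
  "Bdot_norm \<Omega> f = (INF v\<in>{v \<in> Hdot1 \<Omega>. f \<in> interior_trace \<Omega> v}. Hdot1_norm \<Omega> v)"

(* Bounded linear functionals on Bdot modulo Bdot_eq, evaluated on representatives;
   the value of g outside Bdot is irrelevant. *)
definition Bdot_dual :: "(real ^ 'n) set \<Rightarrow> ((real ^ 'n \<Rightarrow> real) \<Rightarrow> real) set" where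
  "Bdot_dual \<Omega> = {g.
     (\<forall>f\<in>Bdot \<Omega>. \<forall>h\<in>Bdot \<Omega>. Bdot_eq \<Omega> f h \<longrightarrow> g f = g h) \<and>
     (\<forall>f\<in>Bdot \<Omega>. \<forall>h\<in>Bdot \<Omega>. g (\<lambda>x. f x + h x) = g f + g h) \<and>
     (\<forall>a. \<forall>f\<in>Bdot \<Omega>. g (\<lambda>x. a * f x) = a * g f) \<and>
     (\<exists>C. \<forall>f\<in>Bdot \<Omega>. \<bar>g f\<bar> \<le> C * Bdot_norm \<Omega> f)}"

section \<open>Weak solutions\<close>

definition cutoff :: "(real ^ 'n) set \<Rightarrow> (real ^ 'n) set \<Rightarrow> (real ^ 'n \<Rightarrow> real) \<Rightarrow> bool" where
  "cutoff \<Omega> D \<eta> \<longleftrightarrow> \<eta> \<in> test_functions \<Omega> \<and> (\<forall>x. 0 \<le> \<eta> x \<and> \<eta> x \<le> 1) \<and>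
     (\<exists>W. open W \<and> closure D \<subseteq> W \<and> (\<forall>x\<in>W. \<eta> x = 1))"

(* The boundary condition does not depend on the cut-off, so "for some" and "for every"
   cut-off are interchangeable; likewise the pairing of g with the trace of v is g f for any
   representative f of that trace. *)
definition weak_solution ::
  "(real ^ 'n) set \<Rightarrow> (real ^ 'n) set \<Rightarrow> real \<Rightarrow> ((real ^ 'n \<Rightarrow> real) \<Rightarrow> real)
    \<Rightarrow> (real ^ 'n \<Rightarrow> real) \<Rightarrow> bool" where
  "weak_solution \<Omega> D k g u \<longleftrightarrow> u \<in> Hdot1 \<Omega> \<and>
     (\<forall>v\<in>test_functions \<Omega>.
        (LINT x:\<Omega>|lborel. (1 + (k - 1) * indicator D x) * (weak_grad \<Omega> u x \<bullet> grad v x)) = 0) \<and>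
     (\<exists>\<eta>. cutoff \<Omega> D \<eta> \<and>
        (\<forall>v\<in>Hdot1 \<Omega>. \<forall>f\<in>interior_trace \<Omega> v.
           Hdot1_inner \<Omega> u (\<lambda>x. (1 - \<eta> x) * v x) = g f))"

end

(* If u_1 and u_2 have the same trace f, then testing the two Neumann problems with u_1 and u_2 shows
   that all the energies a_p(u_p, u_q) equal <g, f>. The monotonicity of the conductivities then forces
   grad u_1 = grad u_2, and this common gradient vanishes on D_2 - D_1. If D_1 and D_2 differ, then
   D_2 - closure D_1 is a nonempty open set on which u_1 is locally constant, and u_1 is harmonic in
   Omega - closure D_1, which is connected because Omega and the complement of closure D_1 are
   connected open sets covering the space. Unique continuation kills grad u_1 up to the boundary, so
   g = 0. For unique continuation, mollified solutions satisfy Bernstein's gradient estimates, so that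
   they are analytic along lines. The hypothesis on the traces is about sets of representatives, so it has
   content only because these are nonempty: a quasi continuous representative is a limit of
   mollifications that converges uniformly off sets of small capacity. *)

theory Submission
  imports Defs
begin

section \<open>Smooth functions\<close>

text \<open>Domains enter through extension: a function in \<open>Hdot1\<close> of an extension
  domain is replaced by a globally defined pair \<open>sob w G\<close>, so that convolutions make
  sense everywhere. The mixed energies require testing one equation with the other solution, whereas
  a weak solution may be tested only with smooth functions of compact support and, near the
  boundary, with (1 - \<eta>) v. The test function is therefore split by the cut-off, and its inner
  part \<eta> v is reached by mollification. In the unique continuation, bounds on the mollified
  functions deteriorate as the mollifier shrinks. This does no harm: the radius over which zeros
  spread depends only on the dimension and the room inside the domain, so all fine mollifications
  vanish on the same ball, and so does their limit. Every derivative is put on the kernel; each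
  iterated derivative is again a convolution of w, harmonic by the same computation. For the
  exceptional sets of a quasi continuous representative, the competitor in the capacity is an
  infinite sum of smoothed absolute values, rescaled by the thresholds.\<close>

lemma has_derivative_grad:
  assumes "f differentiable (at x)"
  shows "(f has_derivative (\<lambda>h. grad f x \<bullet> h)) (at x)"
proof -
  let ?F = "frechet_derivative f (at x)"
  have D: "(f has_derivative ?F) (at x)"
    using assms by (simp add: frechet_derivative_works)
  then interpret linear ?F by (rule has_derivative_linear)
  have "?F h = grad f x \<bullet> h" for h
  proof -
    have "?F h = ?F (\<Sum>i\<in>UNIV. (h $ i) *\<^sub>R axis i 1)"
      by (metis basis_expansion scalar_mult_eq_scaleR)
    also have "\<dots> = (\<Sum>i\<in>UNIV. (h $ i) * ?F (axis i 1))"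
      by (simp add: sum scaleR)
    finally show ?thesis
      by (simp add: grad_def inner_vec_def mult.commute)
  qed
  then have "?F = (\<lambda>h. grad f x \<bullet> h)" by blast
  with D show ?thesis by simp
qed

lemma grad_eqI:
  assumes "(f has_derivative (\<lambda>h. g \<bullet> h)) (at x)"
  shows "grad f x = g"
proof -
  have "frechet_derivative f (at x) = (\<lambda>h. g \<bullet> h)"
    using frechet_derivative_at[OF assms] by simp
  then show ?thesis by (simp add: grad_def vec_eq_iff inner_axis)
qed

lemma grad_cong_open:
  assumes "open S" "x \<in> S" "\<And>y. y \<in> S \<Longrightarrow> f y = g y"
  shows "grad f x = grad g x"
proof -
  have "(f has_derivative D) (at x) \<longleftrightarrow> (g has_derivative D) (at x)" for D
    using has_derivative_transform_within_open[of f D x UNIV S g]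
      has_derivative_transform_within_open[of g D x UNIV S f] assms by metis
  then show ?thesis by (simp add: grad_def frechet_derivative_def)
qed

lemma C_k_Suc_imp: "C_k (Suc k) f \<Longrightarrow> C_k k f"
proof (induction k arbitrary: f)
  case 0
  then show ?case
    by (auto intro!: differentiable_imp_continuous_on simp: differentiable_on_def)
next
  case (Suc k)
  then show ?case by (metis C_k.simps(2))
qed

definition smooth :: "(real ^ 'n \<Rightarrow> real) \<Rightarrow> bool" where
  "smooth f \<longleftrightarrow> (\<forall>k. C_k k f)"

text \<open>Backwards, level \<open>Suc k\<close> of \<open>f\<close> is level \<open>k\<close> of
  its partial derivatives, and level 0 follows from level 1.\<close>

lemma smooth_iff:
  "smooth f \<longleftrightarrow> (\<forall>x. f differentiable (at x)) \<and> (\<forall>i. smooth (\<lambda>x. grad f x $ i))"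
  unfolding smooth_def by (metis C_k.simps(2) C_k_Suc_imp)

lemma smooth_continuous: "smooth f \<Longrightarrow> continuous_on S f"
  unfolding smooth_def by (metis C_k.simps(1) continuous_on_subset subset_UNIV)

lemma smooth_has_derivative: "smooth f \<Longrightarrow> (f has_derivative (\<lambda>h. grad f x \<bullet> h)) (at x)"
  using smooth_iff[of f] by (blast intro: has_derivative_grad)

lemma smooth_partial: "smooth f \<Longrightarrow> smooth (\<lambda>x. grad f x $ i)"
  using smooth_iff[of f] by blast

lemma smooth_continuous_grad: "smooth f \<Longrightarrow> continuous_on S (grad f)"
proof -
  assume "smooth f"
  then have "continuous_on S (\<lambda>x. \<chi> i. grad f x $ i)"
    by (intro continuous_on_vec_lambda smooth_continuous smooth_partial)
  then show ?thesis by simp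
qed

lemma grad_const [simp]: "grad (\<lambda>x. c) x = 0"
  by (rule grad_eqI) simp

lemma C_k_const: "C_k k (\<lambda>x. c)"
  by (induction k arbitrary: c) auto

lemma grad_add:
  "f differentiable (at x) \<Longrightarrow> g differentiable (at x) \<Longrightarrow>
     grad (\<lambda>x. f x + g x) x = grad f x + grad g x"
  by (rule grad_eqI)
    (auto intro!: derivative_eq_intros has_derivative_grad simp: inner_add_left)

lemma grad_mult:
  "f differentiable (at x) \<Longrightarrow> g differentiable (at x) \<Longrightarrow>
     grad (\<lambda>x. f x * g x) x = f x *\<^sub>R grad g x + g x *\<^sub>R grad f x"
  by (rule grad_eqI)
    (auto intro!: derivative_eq_intros has_derivative_grad simp: inner_add_left algebra_simps)

lemma C_k_add: "C_k k f \<Longrightarrow> C_k k g \<Longrightarrow> C_k k (\<lambda>x. f x + g x)"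
proof (induction k arbitrary: f g)
  case 0
  then show ?case by (simp add: continuous_on_add)
next
  case (Suc k)
  have "C_k k (\<lambda>x. grad f x $ i + grad g x $ i)" for i
    using Suc.prems by (intro Suc.IH) auto
  with Suc.prems show ?case by (simp add: grad_add)
qed

lemma C_k_mult: "C_k k f \<Longrightarrow> C_k k g \<Longrightarrow> C_k k (\<lambda>x. f x * g x)"
proof (induction k arbitrary: f g)
  case 0
  then show ?case by (simp add: continuous_on_mult)
next
  case (Suc k)
  have "C_k k f" "C_k k g" using Suc.prems by (blast intro: C_k_Suc_imp)+
  with Suc.prems have "C_k k (\<lambda>x. f x * grad g x $ i + g x * grad f x $ i)" for i
    by (intro C_k_add Suc.IH) auto
  with Suc.prems show ?case by (simp add: grad_mult)
qed

lemma smooth_const: "smooth (\<lambda>x. c)"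
  by (simp add: smooth_def C_k_const)

lemma smooth_add: "smooth f \<Longrightarrow> smooth g \<Longrightarrow> smooth (\<lambda>x. f x + g x)"
  by (simp add: smooth_def C_k_add)

lemma smooth_mult: "smooth f \<Longrightarrow> smooth g \<Longrightarrow> smooth (\<lambda>x. f x * g x)"
  by (simp add: smooth_def C_k_mult)

lemma smooth_sum: "(\<And>i. i \<in> I \<Longrightarrow> smooth (f i)) \<Longrightarrow> smooth (\<lambda>x. \<Sum>i\<in>I. f i x)"
  by (induction I rule: infinite_finite_induct) (auto intro: smooth_const smooth_add)

lemma smooth_diff: "smooth f \<Longrightarrow> smooth g \<Longrightarrow> smooth (\<lambda>x. f x - g x)"
  using smooth_add[of f "\<lambda>x. (-1) * g x"] smooth_mult[OF smooth_const, of g "-1"] by simp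

lemma grad_diff:
  "f differentiable (at x) \<Longrightarrow> g differentiable (at x) \<Longrightarrow>
     grad (\<lambda>x. f x - g x) x = grad f x - grad g x"
  by (rule grad_eqI)
    (auto intro!: derivative_eq_intros has_derivative_grad simp: inner_diff_left)

lemma grad_component: "grad (\<lambda>x. x $ i) x = axis i 1"
  by (rule grad_eqI)
     (simp add: inner_axis' bounded_linear_imp_has_derivative bounded_linear_vec_nth)

lemma C_k_component: "C_k k (\<lambda>x. x $ i)"
  by (cases k) (auto simp: grad_component C_k_const intro!: continuous_intros
      intro: bounded_linear_imp_differentiable bounded_linear_vec_nth)

lemma grad_reflect:
  assumes "f differentiable (at (a - x))"
  shows "grad (\<lambda>x. f (a - x)) x = - grad f (a - x)"
proof (rule grad_eqI)
  have "((\<lambda>x. a - x) has_derivative (\<lambda>h. - h)) (at x)"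
    by (auto intro!: derivative_eq_intros)
  from diff_chain_at[OF this, of f, OF has_derivative_grad[OF assms]]
  show "((\<lambda>x. f (a - x)) has_derivative (\<lambda>h. (- grad f (a - x)) \<bullet> h)) (at x)"
    by (simp add: o_def inner_minus_left)
qed

lemma smooth_reflect:
  fixes f :: "real ^ 'n \<Rightarrow> real"
  assumes "smooth f"
  shows "smooth (\<lambda>x. f (a - x))"
proof -
  have "C_k k f \<Longrightarrow> C_k k (\<lambda>x. f (a - x))" for k and f :: "real ^ 'n \<Rightarrow> real"
  proof (induction k arbitrary: f)
    case 0
    then show ?case
      using continuous_on_compose2[of UNIV f UNIV "\<lambda>x. a - x"]
      by (simp add: continuous_on_diff)
  next
    case (Suc k)
    have "(\<lambda>x. f (a - x)) differentiable (at x)" for x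
      using differentiable_chain_at[of "\<lambda>x. a - x" x f] Suc.prems by (auto simp: o_def)
    moreover have "C_k k (\<lambda>x. (-1) * (grad f (a - x) $ i))" for i
      using Suc by (intro C_k_mult C_k_const Suc.IH) auto
    ultimately show ?case using Suc.prems by (auto simp: grad_reflect)
  qed
  with assms show ?thesis by (simp add: smooth_def)
qed

section \<open>The standard bump function\<close>

definition bump_profile :: "nat \<Rightarrow> real \<Rightarrow> real" where
  "bump_profile m t = (if t > 0 then exp (- 1 / t) / t ^ m else 0)"

lemma bump_profile_nonneg: "0 \<le> bump_profile m t"
  by (simp add: bump_profile_def)

text \<open>Of the exponential series of 1/t only the term of order m + 2 is kept: it cancels the
  power t^m and leaves t^2, enough for the difference quotient at 0 to tend to 0.\<close>

lemma bump_profile_bound: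
  assumes "0 < t"
  shows "bump_profile m t \<le> fact (m + 2) * t\<^sup>2"
proof -
  have "(1 / t) ^ (m + 2) / fact (m + 2) \<le> exp (1 / t)"
  proof -
    have "(\<Sum>n\<in>{m+2}. inverse (fact n) * (1 / t) ^ n) \<le> (\<Sum>n. inverse (fact n) * (1 / t) ^ n)"
      using assms by (intro sum_le_suminf summable_exp) auto
    then show ?thesis by (simp add: exp_def divide_inverse mult.commute)
  qed
  then have "1 / (t ^ (m + 2) * fact (m + 2)) \<le> exp (1 / t)"
    by (simp add: power_one_over)
  moreover have "0 < t ^ (m + 2) * fact (m + 2)" using assms by simp
  ultimately have "1 \<le> exp (1 / t) * (t ^ (m + 2) * fact (m + 2))"
    by (simp only: divide_le_eq if_True)
  then have "exp (- (1 / t)) * 1 \<le> exp (- (1 / t)) * (exp (1 / t) * (t ^ (m + 2) * fact (m + 2)))"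
    by (intro mult_left_mono) auto
  then have "exp (- (1 / t)) \<le> (fact (m + 2) * t\<^sup>2) * t ^ m"
    unfolding mult.assoc[symmetric] exp_add[symmetric]
    by (simp add: power_add power2_eq_square algebra_simps)
  then show ?thesis
    using assms unfolding bump_profile_def by (simp only: divide_le_eq if_True) simp
qed

text \<open>Differentiating exp(-1/t) raises the power of t in the denominator by 2, and
  differentiating 1/t^m raises it by 1. The exponent m is a parameter of the profile so that
  derivatives stay in one family.\<close>

lemma bump_profile_deriv:
  "(bump_profile m has_real_derivative
     bump_profile (m + 2) t - m * bump_profile (m + 1) t) (at t)"
proof -
  consider "t > 0" | "t < 0" | "t = 0" by linarith
  then show ?thesis
  proof cases
    case 1
    have "((\<lambda>t. exp (- 1 / t) / t ^ m) has_real_derivative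
        exp (- 1 / t) / t ^ (m + 2) - m * (exp (- 1 / t) / t ^ (m + 1))) (at t)"
    proof (cases m)
      case (Suc n)
      show ?thesis using 1 unfolding Suc
        by (auto intro!: derivative_eq_intros simp: divide_simps) (auto simp: algebra_simps power2_eq_square power_eq_if[of t n])
    qed (use 1 in \<open>auto intro!: derivative_eq_intros simp: power2_eq_square\<close>)
    then have "((\<lambda>t. exp (- 1 / t) / t ^ m) has_real_derivative
        bump_profile (m + 2) t - m * bump_profile (m + 1) t) (at t)"
      using 1 by (simp add: bump_profile_def)
    then show ?thesis
      by (rule has_field_derivative_transform_within_open[of _ _ _ "{0<..}"])
         (use 1 in \<open>auto simp: bump_profile_def\<close>)
  next
    case 2
    have "((\<lambda>t. 0) has_real_derivative bump_profile (m + 2) t - m * bump_profile (m + 1) t) (at t)"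
      using 2 by (simp add: bump_profile_def)
    then show ?thesis
      by (rule has_field_derivative_transform_within_open[of _ _ _ "{..<0}"])
         (use 2 in \<open>auto simp: bump_profile_def\<close>)
  next
    case 3
    \<comment> \<open>The profile is 0 at 0, so this is the difference quotient there. The quadratic
      bound makes it at most linear in |h|; for negative h it is 0.\<close>
    have "((\<lambda>h. bump_profile m h / h) \<longlongrightarrow> 0) (at 0)"
    proof (rule Lim_null_comparison)
      show "\<forall>\<^sub>F h in at 0. norm (bump_profile m h / h) \<le> fact (m + 2) * \<bar>h\<bar>"
      proof (rule always_eventually, rule allI)
        fix h :: real
        show "norm (bump_profile m h / h) \<le> fact (m + 2) * \<bar>h\<bar>"
        proof (cases "h > 0")
          case True
          with bump_profile_bound[OF True, of m] bump_profile_nonneg[of m h] show ?thesis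
            by (simp add: divide_le_eq power2_eq_square mult.assoc)
        next
          case False
          then have "bump_profile m h / h = 0" by (simp add: bump_profile_def)
          moreover have "0 \<le> fact (m + 2) * \<bar>h\<bar>" by (intro mult_nonneg_nonneg) auto
          ultimately show ?thesis by (simp only: norm_zero)
        qed
      qed
      show "((\<lambda>h. fact (m + 2) * \<bar>h\<bar>) \<longlongrightarrow> 0) (at (0::real))"
        by (auto intro!: tendsto_eq_intros)
    qed
    with 3 show ?thesis by (simp add: has_field_derivative_iff bump_profile_def)
  qed
qed

text \<open>The radius enters through the polynomial r - x . x, which is smooth at the origin too.
  The induction ranges over all m because each derivative changes it.\<close>

lemma C_k_bump_profile: "C_k k (\<lambda>x::real ^ 'n. bump_profile m (r - x \<bullet> x))"
proof (induction k arbitrary: m)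
  case 0
  have "continuous_on UNIV (bump_profile m)"
    using bump_profile_deriv by (meson DERIV_isCont continuous_at_imp_continuous_on)
  from continuous_on_compose2[OF this, of UNIV "\<lambda>x::real ^ 'n. r - x \<bullet> x"]
  show ?case by (simp add: continuous_on_diff continuous_on_inner)
next
  case (Suc k)
  let ?d = "\<lambda>x::real ^ 'n. bump_profile (m + 2) (r - x \<bullet> x) + (- real m) * bump_profile (m + 1) (r - x \<bullet> x)"
  have *: "((\<lambda>x. bump_profile m (r - x \<bullet> x)) has_derivative
      (\<lambda>h. ((-2 * ?d x) *\<^sub>R x) \<bullet> h)) (at x)" for x
  proof -
    have "((\<lambda>x. r - x \<bullet> x) has_derivative (\<lambda>h. - 2 * (x \<bullet> h))) (at x)"
      by (auto intro!: derivative_eq_intros simp: inner_commute)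
    from DERIV_compose_FDERIV[OF bump_profile_deriv this, of m] show ?thesis
      by (auto elim!: has_derivative_eq_rhs simp: algebra_simps)
  qed
  have "C_k k (\<lambda>x. (-2 * ?d x) * (x $ i))" for i
    by (intro C_k_mult C_k_add C_k_const Suc.IH C_k_component)
  moreover have "grad (\<lambda>x. bump_profile m (r - x \<bullet> x)) x $ i = (-2 * ?d x) * (x $ i)" for x i
    using grad_eqI[OF *, of x] by simp
  moreover have "(\<lambda>x. bump_profile m (r - x \<bullet> x)) differentiable (at x)" for x :: "real ^ 'n"
    unfolding differentiable_def by (intro exI) (rule *)
  ultimately show ?case by (simp del: add_2_eq_Suc' add_Suc_right)
qed

section \<open>Test functions and mollifiers\<close>

lemma test_functionsI:
  assumes "smooth \<phi>" "compact K" "K \<subseteq> U" "\<And>x. x \<notin> K \<Longrightarrow> \<phi> x = 0"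
  shows "\<phi> \<in> test_functions U"
proof -
  have "closure {x. \<phi> x \<noteq> 0} \<subseteq> K"
    using assms by (intro closure_minimal compact_imp_closed) auto
  moreover from this have "compact (closure {x. \<phi> x \<noteq> 0})"
    using assms(2) by (meson bounded_subset closed_closure compact_eq_bounded_closed)
  ultimately show ?thesis
    using assms by (auto simp: test_functions_def smooth_def)
qed

lemma test_functionsE:
  assumes "\<phi> \<in> test_functions U"
  obtains K where "smooth \<phi>" "compact K" "K \<subseteq> U" "\<And>x. x \<notin> K \<Longrightarrow> \<phi> x = 0"
    "\<And>x. x \<notin> K \<Longrightarrow> grad \<phi> x = 0"
proof -
  define K where "K = closure {x. \<phi> x \<noteq> 0}"
  have 1: "smooth \<phi>" "compact K" "K \<subseteq> U"
    using assms by (simp_all add: test_functions_def smooth_def K_def)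
  have 2: "\<phi> x = 0" if "x \<notin> K" for x
    using that closure_subset[of "{x. \<phi> x \<noteq> 0}"] unfolding K_def by blast
  have 3: "grad \<phi> x = 0" if "x \<notin> K" for x
  proof -
    have "grad \<phi> x = grad (\<lambda>x. 0) x"
      by (rule grad_cong_open[of "- K"]) (use that 1(2) 2 in \<open>auto intro: compact_imp_closed\<close>)
    then show ?thesis by (simp only: grad_const)
  qed
  show ?thesis by (rule that[OF 1 2 3])
qed

lemma test_functions_mono: "U \<subseteq> V \<Longrightarrow> \<phi> \<in> test_functions U \<Longrightarrow> \<phi> \<in> test_functions V"
  by (auto simp: test_functions_def)

lemma test_functions_smooth: "\<phi> \<in> test_functions U \<Longrightarrow> smooth \<phi>"
  by (auto simp: test_functions_def smooth_def)

lemma test_functions_outside: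
  assumes "\<phi> \<in> test_functions U" "x \<notin> U"
  shows "\<phi> x = 0" "grad \<phi> x = 0"
  using assms(1) by (rule test_functionsE; use assms(2) in blast)+

lemma test_functions_grad:
  assumes "\<phi> \<in> test_functions U"
  shows "(\<lambda>x. grad \<phi> x \<bullet> e) \<in> test_functions U"
  using assms
proof (rule test_functionsE)
  fix K assume K: "smooth \<phi>" "compact K" "K \<subseteq> U" "\<And>x. x \<notin> K \<Longrightarrow> grad \<phi> x = 0"
  have "smooth (\<lambda>x. \<Sum>i\<in>UNIV. e $ i * (grad \<phi> x $ i))"
    by (intro smooth_sum smooth_mult smooth_const smooth_partial K)
  then have "smooth (\<lambda>x. grad \<phi> x \<bullet> e)"
    by (simp add: inner_vec_def mult.commute)
  then show ?thesis
    by (rule test_functionsI[OF _ K(2,3)]) (simp add: K(4))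
qed

lemma test_functions_mult:
  assumes "\<phi> \<in> test_functions U" "smooth f"
  shows "(\<lambda>x. \<phi> x * f x) \<in> test_functions U"
  using assms(1)
  by (rule test_functionsE) (auto intro!: test_functionsI smooth_mult assms(2))

text \<open>The kernel of a convolution as a function of the integration variable: in this form weak
  equations are tested with mollifiers.\<close>

lemma test_functions_reflect:
  assumes "\<phi> \<in> test_functions (ball 0 r)" "ball x r \<subseteq> U"
  shows "(\<lambda>y. \<phi> (x - y)) \<in> test_functions U"
  using assms(1)
proof (rule test_functionsE)
  fix K assume K: "smooth \<phi>" "compact K" "K \<subseteq> ball 0 r" "\<And>x. x \<notin> K \<Longrightarrow> \<phi> x = 0"
  have "(\<lambda>y. x - y) ` K \<subseteq> ball x r"
    using K(3) by (auto simp: dist_norm)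
  with assms(2) show ?thesis
  proof (rule_tac test_functionsI[of _ "(\<lambda>y. x - y) ` K"])
    show "smooth (\<lambda>y. \<phi> (x - y))" using K(1) by (rule smooth_reflect)
    show "compact ((\<lambda>y. x - y) ` K)"
      using K(2) by (intro compact_continuous_image continuous_intros)
    show "\<phi> (x - y) = 0" if "y \<notin> (\<lambda>y. x - y) ` K" for y
    proof (rule K(4))
      show "x - y \<notin> K" using that by (metis diff_diff_eq2 add_diff_cancel_left' imageI)
    qed
  qed (use assms(2) in auto)
qed

lemma grad_reflect_test:
  assumes "\<phi> \<in> test_functions U"
  shows "grad (\<lambda>y. \<phi> (x - y)) y = - grad \<phi> (x - y)"
  using test_functions_smooth[OF assms] smooth_iff by (intro grad_reflect) blast

lemma test_functions_bounded:
  assumes "\<phi> \<in> test_functions U"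
  obtains B where "0 \<le> B" "\<And>x. \<bar>\<phi> x\<bar> \<le> B" "\<And>x. norm (grad \<phi> x) \<le> B"
  using assms
proof (rule test_functionsE)
  fix K assume K: "smooth \<phi>" "compact K" "\<And>x. x \<notin> K \<Longrightarrow> \<phi> x = 0" "\<And>x. x \<notin> K \<Longrightarrow> grad \<phi> x = 0"
  have "bounded (\<phi> ` K)" "bounded (grad \<phi> ` K)"
    using K by (auto intro!: compact_imp_bounded compact_continuous_image
        smooth_continuous smooth_continuous_grad)
  then obtain B C where B: "\<And>x. x \<in> K \<Longrightarrow> \<bar>\<phi> x\<bar> \<le> B" and C: "\<And>x. x \<in> K \<Longrightarrow> norm (grad \<phi> x) \<le> C"
    by (auto simp: bounded_iff)
  show ?thesis
  proof (rule that[of "max 0 (max B C)"])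
    show "\<bar>\<phi> x\<bar> \<le> max 0 (max B C)" for x
      using B[of x] K(3)[of x] by (cases "x \<in> K") auto
    show "norm (grad \<phi> x) \<le> max 0 (max B C)" for x
      using C[of x] K(4)[of x] by (cases "x \<in> K") auto
  qed auto
qed

lemma test_functions_supp:
  assumes "\<phi> \<in> test_functions U"
  obtains r where "0 < r" "\<And>x. r < norm x \<Longrightarrow> \<phi> x = 0 \<and> grad \<phi> x = 0"
  using assms
proof (rule test_functionsE)
  fix K assume K: "compact K" "\<And>x. x \<notin> K \<Longrightarrow> \<phi> x = 0" "\<And>x. x \<notin> K \<Longrightarrow> grad \<phi> x = 0"
  obtain b where "0 < b" "\<And>x. x \<in> K \<Longrightarrow> norm x \<le> b"
    using compact_imp_bounded[OF K(1)] by (auto simp: bounded_pos)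
  with K show ?thesis by (intro that[of b]) fastforce+
qed

lemma test_functions_borel:
  assumes "\<phi> \<in> test_functions U"
  shows "\<phi> \<in> borel_measurable borel" "grad \<phi> \<in> borel_measurable borel"
  using test_functions_smooth[OF assms]
  by (auto intro!: borel_measurable_continuous_onI smooth_continuous smooth_continuous_grad)

lemma test_functions_integrable:
  assumes "\<phi> \<in> test_functions U"
  shows "integrable lborel \<phi>" "integrable lborel (grad \<phi>)"
  using assms
proof (rule_tac [!] test_functionsE)
  fix K assume K: "smooth \<phi>" "compact K" "\<And>x. x \<notin> K \<Longrightarrow> \<phi> x = 0" "\<And>x. x \<notin> K \<Longrightarrow> grad \<phi> x = 0"
  have "integrable lborel (\<lambda>x. indicator K x *\<^sub>R \<phi> x)"
    by (intro borel_integrable_compact K smooth_continuous)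
  moreover have "integrable lborel (\<lambda>x. indicator K x *\<^sub>R grad \<phi> x)"
    by (intro borel_integrable_compact K smooth_continuous_grad)
  moreover have "(\<lambda>x. indicator K x *\<^sub>R \<phi> x) = \<phi>" "(\<lambda>x. indicator K x *\<^sub>R grad \<phi> x) = grad \<phi>"
    using K by (force simp: indicator_def)+
  ultimately show "integrable lborel \<phi>" "integrable lborel (grad \<phi>)" by auto
qed

text \<open>No scaled family of one kernel is fixed. Only the radius of the support, the sign and
  the mass enter the estimates, which hold for every kernel of small enough radius.\<close>

definition is_mollifier :: "real \<Rightarrow> (real ^ 'n \<Rightarrow> real) \<Rightarrow> bool" where
  "is_mollifier r \<rho> \<longleftrightarrow>
     \<rho> \<in> test_functions (ball 0 r) \<and> (\<forall>x. 0 \<le> \<rho> x) \<and> integral\<^sup>L lborel \<rho> = 1"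

lemma mollifier_exists:
  assumes "0 < r"
  shows "\<exists>\<rho> :: real ^ 'n \<Rightarrow> real. is_mollifier r \<rho>"
proof -
  \<comment> \<open>With radius r / 2 the closed ball that carries b still lies in the open ball of
    radius r.\<close>
  define b :: "real ^ 'n \<Rightarrow> real" where "b = (\<lambda>x. bump_profile 0 ((r / 2)\<^sup>2 - x \<bullet> x))"
  have b0: "b x = 0" if "x \<notin> cball 0 (r / 2)" for x
  proof -
    have "(r / 2)\<^sup>2 < (norm x)\<^sup>2"
      using that assms by (intro power_strict_mono) auto
    then show ?thesis by (simp add: b_def bump_profile_def power2_norm_eq_inner)
  qed
  have sm: "smooth b" by (simp add: smooth_def b_def C_k_bump_profile)
  have bt: "b \<in> test_functions (ball 0 r)"
    by (rule test_functionsI[OF sm, of "cball 0 (r / 2)"]) (use assms b0 in auto)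
  have bnn: "0 \<le> b x" for x by (simp add: b_def bump_profile_nonneg)
  let ?I = "integral\<^sup>L lborel b"
  have "?I \<noteq> 0"
  proof
    assume "?I = 0"
    then have "AE x in lborel. b x = 0"
      using bnn test_functions_integrable[OF bt] by (simp add: integral_nonneg_eq_0_iff_AE)
    moreover have "0 < b x" if "x \<in> ball 0 (r / 2)" for x
    proof -
      have "(norm x)\<^sup>2 < (r / 2)\<^sup>2"
        using that by (intro power_strict_mono) auto
      then show ?thesis by (simp add: b_def bump_profile_def power2_norm_eq_inner)
    qed
    ultimately have "AE x in lborel. x \<notin> ball (0 :: real ^ 'n) (r / 2)"
      by (auto elim!: eventually_mono) fastforce
    then have "emeasure lborel (ball (0 :: real ^ 'n) (r / 2)) = 0"
      using AE_iff_null_sets[of "ball (0 :: real ^ 'n) (r / 2)" lborel] by auto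
    then show False
      using emeasure_ball[of "r / 2" "0 :: real ^ 'n"] assms
      by (simp add: unit_ball_vol_pos less_imp_neq[symmetric])
  qed
  moreover have "0 \<le> ?I" using bnn by (intro Bochner_Integration.integral_nonneg)
  ultimately have I: "0 < ?I" by simp
  have "(\<lambda>x. b x * (1 / ?I)) \<in> test_functions (ball 0 r)"
    by (intro test_functions_mult bt smooth_const)
  then show ?thesis
    using I bnn by (intro exI[of _ "\<lambda>x. b x * (1 / ?I)"]) (simp add: is_mollifier_def)
qed

lemma is_mollifierD:
  assumes "is_mollifier r \<rho>"
  shows "\<rho> \<in> test_functions (ball 0 r)" "0 \<le> \<rho> x" "integral\<^sup>L lborel \<rho> = 1"
    "r \<le> norm x \<Longrightarrow> \<rho> x = 0" "\<rho> \<in> test_functions UNIV"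
  using assms test_functions_outside[of \<rho> "ball 0 r" x] test_functions_mono[of "ball 0 r" UNIV \<rho>]
  by (auto simp: is_mollifier_def)

section \<open>Continuity of translations\<close>

lemma distr_lborel_sub: "distr lborel borel (\<lambda>x::'a::euclidean_space. x - y) = lborel"
  using lborel_distr_plus[of "- y"] by (simp add: add.commute[of "- y"] cong: distr_cong)

lemma distr_lborel_reflect: "distr lborel borel (\<lambda>y::'a::euclidean_space. x - y) = lborel"
  using lborel_affine[of "-1" x] by (simp add: density_1)

lemma
  fixes f :: "'a::euclidean_space \<Rightarrow> 'b::{banach,second_countable_topology}"
  assumes [measurable]: "f \<in> borel_measurable borel"
  shows integrable_lborel_sub: "integrable lborel (\<lambda>x. f (x - y)) = integrable lborel f"
    and integral_lborel_sub: "(LBINT x. f (x - y)) = integral\<^sup>L lborel f"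
    and integrable_lborel_reflect: "integrable lborel (\<lambda>y. f (x - y)) = integrable lborel f"
    and integral_lborel_reflect: "(LBINT y. f (x - y)) = integral\<^sup>L lborel f"
proof -
  show "integrable lborel (\<lambda>x. f (x - y)) = integrable lborel f"
    using integrable_distr_eq[of "\<lambda>x. x - y" lborel borel f] by (simp add: distr_lborel_sub)
  show "(LBINT x. f (x - y)) = integral\<^sup>L lborel f"
    using integral_distr[of "\<lambda>x. x - y" lborel borel f] by (simp add: distr_lborel_sub)
  show "integrable lborel (\<lambda>y. f (x - y)) = integrable lborel f"
    using integrable_distr_eq[of "\<lambda>y. x - y" lborel borel f] by (simp add: distr_lborel_reflect)
  show "(LBINT y. f (x - y)) = integral\<^sup>L lborel f"
    using integral_distr[of "\<lambda>y. x - y" lborel borel f] by (simp add: distr_lborel_reflect)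
qed

lemma nn_integral_lborel_reflect:
  fixes f :: "'a::euclidean_space \<Rightarrow> ennreal"
  assumes [measurable]: "f \<in> borel_measurable borel"
  shows "(\<integral>\<^sup>+y. f (x - y) \<partial>lborel) = integral\<^sup>N lborel f"
  using nn_integral_distr[of "\<lambda>y. x - y" lborel borel f] by (simp add: distr_lborel_reflect)

text \<open>The error of replacing f by g occurs twice, once translated, and translation preserves
  the integral. An error of e / 4 thus costs e / 2, uniformly in y.\<close>

lemma L1_translation_approx:
  fixes f :: "'a::euclidean_space \<Rightarrow> 'b::{banach,second_countable_topology}"
  assumes f: "integrable lborel f"
    and approx: "\<And>e. 0 < e \<Longrightarrow> \<exists>g. integrable lborel g \<and> (LBINT x. norm (f x - g x)) \<le> e \<and>
      ((\<lambda>y. LBINT x. norm (g (x - y) - g x)) \<longlongrightarrow> 0) (at 0)"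
  shows "((\<lambda>y. LBINT x. norm (f (x - y) - f x)) \<longlongrightarrow> 0) (at 0)"
proof (rule tendstoI)
  fix e :: real assume "0 < e"
  then obtain g where g: "integrable lborel g" "(LBINT x. norm (f x - g x)) \<le> e / 4"
      "((\<lambda>y. LBINT x. norm (g (x - y) - g x)) \<longlongrightarrow> 0) (at 0)"
    using approx[of "e / 4"] by auto
  have [measurable]: "f \<in> borel_measurable borel" "g \<in> borel_measurable borel"
    using f g by (auto dest: borel_measurable_integrable)
  have fy: "integrable lborel (\<lambda>x. f (x - y))" "integrable lborel (\<lambda>x. g (x - y))" for y
    using f g by (auto simp: integrable_lborel_sub)
  have le: "(LBINT x. norm (f (x - y) - f x)) \<le> (LBINT x. norm (g (x - y) - g x)) + e / 2" for y
  proof -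
    have "(LBINT x. norm (f (x - y) - f x)) \<le>
        (LBINT x. norm (g (x - y) - g x) + (norm (f x - g x) + norm (f (x - y) - g (x - y))))"
    proof (intro integral_mono Bochner_Integration.integrable_add Bochner_Integration.integrable_norm
        Bochner_Integration.integrable_diff fy f g)
      fix x
      have "f (x - y) - f x = (g (x - y) - g x) - (f x - g x) + (f (x - y) - g (x - y))" by simp
      then show "norm (f (x - y) - f x) \<le> norm (g (x - y) - g x) + (norm (f x - g x) + norm (f (x - y) - g (x - y)))"
        using norm_triangle_ineq[of "(g (x - y) - g x) - (f x - g x)" "f (x - y) - g (x - y)"]
          norm_triangle_ineq4[of "g (x - y) - g x" "f x - g x"] by simp
    qed
    also have "\<dots> = (LBINT x. norm (g (x - y) - g x)) + ((LBINT x. norm (f x - g x)) +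
        (LBINT x. norm (f (x - y) - g (x - y))))"
      using fy f g by (subst Bochner_Integration.integral_add; simp)+
    also have "(LBINT x. norm (f (x - y) - g (x - y))) = (LBINT x. norm (f x - g x))"
      by (rule integral_lborel_sub[of "\<lambda>x. norm (f x - g x)"]) simp
    finally show ?thesis using g(2) by simp
  qed
  have "\<forall>\<^sub>F y in at 0. dist (LBINT x. norm (g (x - y) - g x)) 0 < e / 2"
    using g(3) \<open>0 < e\<close> by (intro tendstoD) auto
  then show "\<forall>\<^sub>F y in at 0. dist (LBINT x. norm (f (x - y) - f x)) 0 < e"
  proof eventually_elim
    case (elim y)
    have "0 \<le> (LBINT x. norm (f (x - y) - f x))" by simp
    with elim le[of y] show ?case by simp
  qed
qed

text \<open>The integral is |c| times the measure of the symmetric difference of U and its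
  translate, that is, twice the measure of U minus twice that of the overlap. A point of the open
  set U stays in U under small translations, so the overlap fills U in the limit.\<close>

lemma L1_translation_open:
  fixes U :: "'a::euclidean_space set" and c :: "'b::{banach,second_countable_topology}"
  assumes U: "open U" "emeasure lborel U < \<infinity>"
  shows "((\<lambda>y. LBINT x. norm (indicator U (x - y) *\<^sub>R c - indicator U x *\<^sub>R c)) \<longlongrightarrow> 0) (at 0)"
proof -
  have [measurable]: "U \<in> sets borel" using U by simp
  have i: "integrable lborel (indicator U :: 'a \<Rightarrow> real)"
    using U by (simp add: integrable_indicator_iff)
  have iy: "integrable lborel (\<lambda>x. indicator U (x - y) :: real)" for y
    using i by (simp add: integrable_lborel_sub)
  have ip: "integrable lborel (\<lambda>x. indicator U (x - y) * indicator U x :: real)" for y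
    by (rule Bochner_Integration.integrable_bound[OF i]) (auto simp: indicator_def)
  have eq: "(LBINT x. norm (indicator U (x - y) *\<^sub>R c - indicator U x *\<^sub>R c)) =
      norm c * (2 * measure lborel U - 2 * (LBINT x. indicator U (x - y) * indicator U x))" for y
  proof -
    have "norm (indicator U (x - y) *\<^sub>R c - indicator U x *\<^sub>R c) =
       norm c * ((indicator U (x - y) + indicator U x) - 2 * (indicator U (x - y) * indicator U x))" for x
      by (auto simp: indicator_def)
    then show ?thesis
      using i iy[of y] ip[of y] integral_lborel_sub[of "indicator U :: 'a \<Rightarrow> real" y] by simp
  qed
  have "((\<lambda>y. LBINT x. indicator U (x - y) * indicator U x) \<longlongrightarrow> measure lborel U) (at 0)"
    unfolding tendsto_at_iff_sequentially o_def
  proof (intro allI impI)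
    fix X :: "nat \<Rightarrow> 'a" assume X: "X \<longlonglongrightarrow> 0"
    have "(\<lambda>i. LBINT x. indicator U (x - X i) * indicator U x) \<longlonglongrightarrow> integral\<^sup>L lborel (indicator U :: 'a \<Rightarrow> real)"
    proof (rule integral_dominated_convergence[where w = "indicator U"])
      show "AE x in lborel. (\<lambda>i. indicator U (x - X i) * indicator U x :: real) \<longlonglongrightarrow> indicator U x"
      proof (rule AE_I2)
        fix x
        show "(\<lambda>i. indicator U (x - X i) * indicator U x :: real) \<longlonglongrightarrow> indicator U x"
        proof (cases "x \<in> U")
          case True
          have "(\<lambda>i. x - X i) \<longlonglongrightarrow> x - 0" using X by (intro tendsto_intros)
          then have "\<forall>\<^sub>F i in sequentially. x - X i \<in> U"
            using True U by (auto dest: topological_tendstoD)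
          then have "\<forall>\<^sub>F i in sequentially. indicator U (x - X i) * indicator U x = (indicator U x :: real)"
            by eventually_elim (use True in auto)
          then show ?thesis by (rule tendsto_eventually)
        qed simp
      qed
    qed (use i in \<open>auto simp: indicator_def\<close>)
    then show "(\<lambda>i. LBINT x. indicator U (x - X i) * indicator U x) \<longlonglongrightarrow> measure lborel U" by simp
  qed
  then show ?thesis unfolding eq by (auto intro!: tendsto_eq_intros)
qed

lemma L1_translation:
  fixes f :: "'a::euclidean_space \<Rightarrow> 'b::{banach,second_countable_topology}"
  assumes "integrable lborel f"
  shows "((\<lambda>y. LBINT x. norm (f (x - y) - f x)) \<longlongrightarrow> 0) (at 0)"
  using assms
proof (induction rule: integrable_induct)
  case (base A c)
  have A [measurable]: "A \<in> sets borel" and fin: "emeasure lborel A < \<infinity>" using base by auto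
  show ?case
  proof (rule L1_translation_approx)
    fix e :: real assume e: "0 < e"
    \<comment> \<open>Outer regularity reduces measurable sets to open ones; the 1 in the
      denominator covers c = 0.\<close>
    obtain U where U: "open U" "A \<subseteq> U" "U - A \<in> lmeasurable" "emeasure lebesgue (U - A) < ennreal (e / (norm c + 1))"
      using sets_lebesgue_outer_open[of A "e / (norm c + 1)"] e A
      by (auto simp: add_nonneg_pos)
    have [measurable]: "U \<in> sets borel" using U by simp
    have small: "emeasure lborel (U - A) < ennreal (e / (norm c + 1))"
      using U by simp
    have "emeasure lborel U \<le> emeasure lborel A + emeasure lborel (U - A)"
      using U(2) emeasure_subadditive[of A lborel "U - A"] by (simp add: Un_absorb1)
    also have "\<dots> < \<infinity>" using small fin by (auto simp: less_top[symmetric] top_unique)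
    finally have Ufin: "emeasure lborel U < \<infinity>" .
    have "norm (indicator A x *\<^sub>R c - indicator U x *\<^sub>R c) = indicator (U - A) x * norm c" for x
      using U(2) by (auto simp: indicator_def)
    then have "(LBINT x. norm (indicator A x *\<^sub>R c - indicator U x *\<^sub>R c)) = measure lborel (U - A) * norm c"
      by simp
    also have "\<dots> \<le> e / (norm c + 1) * norm c"
      using small e by (intro mult_right_mono) (auto simp: measure_def enn2real_leI less_imp_le add_nonneg_pos)
    also have "\<dots> \<le> e"
    proof -
      have "0 < norm c + 1" by (simp add: add_nonneg_pos)
      with e show ?thesis by (simp add: divide_le_eq)
    qed
    finally have "(LBINT x. norm (indicator A x *\<^sub>R c - indicator U x *\<^sub>R c)) \<le> e" .
    moreover have "integrable lborel (\<lambda>x. indicator U x *\<^sub>R c)"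
      using Ufin by (intro integrable_scaleR_left) (simp add: integrable_indicator_iff)
    ultimately show "\<exists>g. integrable lborel g \<and> (LBINT x. norm (indicator A x *\<^sub>R c - g x)) \<le> e \<and>
      ((\<lambda>y. LBINT x. norm (g (x - y) - g x)) \<longlongrightarrow> 0) (at 0)"
      using L1_translation_open[OF U(1) Ufin, of c] by (intro exI[of _ "\<lambda>x. indicator U x *\<^sub>R c"]) simp
  qed (use fin in \<open>auto simp: integrable_indicator_iff\<close>)
next
  case (add f g)
  have [measurable]: "f \<in> borel_measurable borel" "g \<in> borel_measurable borel"
    using add by (auto dest: borel_measurable_integrable)
  have I: "integrable lborel (\<lambda>x. f (x - y))" "integrable lborel (\<lambda>x. g (x - y))" for y
    using add by (auto simp: integrable_lborel_sub)
  show ?case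
  proof (rule tendsto_sandwich[of "\<lambda>_. 0"])
    show "((\<lambda>y. (LBINT x. norm (f (x - y) - f x)) + (LBINT x. norm (g (x - y) - g x))) \<longlongrightarrow> 0) (at 0)"
      using tendsto_add[OF add.IH] by simp
    show "\<forall>\<^sub>F y in at 0. (LBINT x. norm (f (x - y) + g (x - y) - (f x + g x)))
        \<le> (LBINT x. norm (f (x - y) - f x)) + (LBINT x. norm (g (x - y) - g x))"
    proof (rule always_eventually, rule allI)
      fix y
      have "(LBINT x. norm (f (x - y) + g (x - y) - (f x + g x)))
        \<le> (LBINT x. norm (f (x - y) - f x) + norm (g (x - y) - g x))"
        using add I by (intro integral_mono) (auto simp: norm_diff_triangle_ineq)
      also have "\<dots> = (LBINT x. norm (f (x - y) - f x)) + (LBINT x. norm (g (x - y) - g x))"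
        using add I by (intro Bochner_Integration.integral_add) auto
      finally show "(LBINT x. norm (f (x - y) + g (x - y) - (f x + g x)))
        \<le> (LBINT x. norm (f (x - y) - f x)) + (LBINT x. norm (g (x - y) - g x))" .
    qed
  qed (auto intro!: always_eventually)
next
  case (lim f s)
  show ?case
  proof (rule L1_translation_approx[OF lim.hyps(4)])
    fix e :: real assume e: "0 < e"
    have [measurable]: "f \<in> borel_measurable lborel" "\<And>i. s i \<in> borel_measurable lborel"
      using lim.hyps by (auto dest: borel_measurable_integrable)
    have "(\<lambda>i. LBINT x. norm (f x - s i x)) \<longlonglongrightarrow> (LBINT x. norm (f x - f x))"
    proof (rule integral_dominated_convergence[where w = "\<lambda>x. 3 * norm (f x)"])
      show "AE x in lborel. (\<lambda>i. norm (f x - s i x)) \<longlonglongrightarrow> norm (f x - f x)"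
        using lim.hyps(2) by (intro AE_I2 tendsto_norm tendsto_diff tendsto_const) auto
      show "AE x in lborel. norm (norm (f x - s i x)) \<le> 3 * norm (f x)" for i
      proof (rule AE_I2)
        fix x
        show "norm (norm (f x - s i x)) \<le> 3 * norm (f x)"
          using lim.hyps(3)[of x i] norm_triangle_ineq4[of "f x" "s i x"] by simp
      qed
    qed (use lim.hyps(4) in auto)
    then have "\<forall>\<^sub>F i in sequentially. (LBINT x. norm (f x - s i x)) < e"
      using e by (auto dest: order_tendstoD(2))
    then obtain i where "(LBINT x. norm (f x - s i x)) < e"
      by (auto simp: eventually_sequentially)
    then show "\<exists>g. integrable lborel g \<and> (LBINT x. norm (f x - g x)) \<le> e \<and>
      ((\<lambda>y. LBINT x. norm (g (x - y) - g x)) \<longlongrightarrow> 0) (at 0)"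
      using lim.hyps(1) lim.IH by (intro exI[of _ "s i"]) auto
  qed
qed

section \<open>Continuity of translations in L^2\<close>

lemma norm_sq_triangle:
  fixes a b :: "'a::real_normed_vector"
  shows "(norm (a + b))\<^sup>2 \<le> 2 * (norm a)\<^sup>2 + 2 * (norm b)\<^sup>2"
proof -
  have "(norm (a + b))\<^sup>2 \<le> (norm a + norm b)\<^sup>2"
    by (intro power_mono norm_triangle_ineq) auto
  also have "\<dots> \<le> 2 * (norm a)\<^sup>2 + 2 * (norm b)\<^sup>2"
    using sum_squares_bound[of "norm a" "norm b"] by (simp add: power2_sum)
  finally show ?thesis .
qed

lemma L2_add:
  fixes f g :: "'a \<Rightarrow> 'b::{banach,second_countable_topology}"
  assumes [measurable]: "f \<in> borel_measurable M" "g \<in> borel_measurable M"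
    and "integrable M (\<lambda>x. (norm (f x))\<^sup>2)" "integrable M (\<lambda>x. (norm (g x))\<^sup>2)"
  shows "integrable M (\<lambda>x. (norm (f x + g x))\<^sup>2)"
    and "(LINT x|M. (norm (f x + g x))\<^sup>2) \<le> 2 * (LINT x|M. (norm (f x))\<^sup>2) + 2 * (LINT x|M. (norm (g x))\<^sup>2)"
proof -
  have I: "integrable M (\<lambda>x. 2 * (norm (f x))\<^sup>2 + 2 * (norm (g x))\<^sup>2)"
    using assms by auto
  show J: "integrable M (\<lambda>x. (norm (f x + g x))\<^sup>2)"
    by (rule Bochner_Integration.integrable_bound[OF I]) (auto simp: norm_sq_triangle)
  have "(LINT x|M. (norm (f x + g x))\<^sup>2) \<le> (LINT x|M. 2 * (norm (f x))\<^sup>2 + 2 * (norm (g x))\<^sup>2)"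
    by (intro integral_mono I J norm_sq_triangle)
  then show "(LINT x|M. (norm (f x + g x))\<^sup>2) \<le> 2 * (LINT x|M. (norm (f x))\<^sup>2) + 2 * (LINT x|M. (norm (g x))\<^sup>2)"
    using assms by simp
qed

lemma L2_diff:
  fixes f g :: "'a \<Rightarrow> 'b::{banach,second_countable_topology}"
  assumes "f \<in> borel_measurable M" "g \<in> borel_measurable M"
    and "integrable M (\<lambda>x. (norm (f x))\<^sup>2)" "integrable M (\<lambda>x. (norm (g x))\<^sup>2)"
  shows "integrable M (\<lambda>x. (norm (f x - g x))\<^sup>2)"
    and "(LINT x|M. (norm (f x - g x))\<^sup>2) \<le> 2 * (LINT x|M. (norm (f x))\<^sup>2) + 2 * (LINT x|M. (norm (g x))\<^sup>2)"
  using L2_add[of f M "\<lambda>x. - g x"] assms by auto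

lemma L2_translation:
  fixes f :: "'a::euclidean_space \<Rightarrow> 'b::{banach,second_countable_topology}"
  assumes [measurable]: "f \<in> borel_measurable borel" and f: "integrable lborel (\<lambda>x. (norm (f x))\<^sup>2)"
  shows "((\<lambda>y. LBINT x. (norm (f (x - y) - f x))\<^sup>2) \<longlongrightarrow> 0) (at 0)"
proof (rule tendstoI)
  fix e :: real assume e: "0 < e"
  \<comment> \<open>Truncation in space and in value: the truncated function is integrable and
    bounded by M, so the square of its translation error is at most 2 M times the error itself, and
    continuity in L^1 applies.\<close>
  define S where "S M = {x. norm x \<le> real M \<and> norm (f x) \<le> real M}" for M
  have [measurable]: "S M \<in> sets borel" for M unfolding S_def by measurable
  define g where "g M x = indicator (S M) x *\<^sub>R f x" for M x
  have [measurable]: "g M \<in> borel_measurable borel" for M unfolding g_def by measurable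
  have "(\<lambda>M. LBINT x. (norm (f x - g M x))\<^sup>2) \<longlonglongrightarrow> (LBINT x. (norm (f x - f x))\<^sup>2)"
  proof (rule integral_dominated_convergence[where w = "\<lambda>x. (norm (f x))\<^sup>2"])
    show "AE x in lborel. (\<lambda>M. (norm (f x - g M x))\<^sup>2) \<longlonglongrightarrow> (norm (f x - f x))\<^sup>2"
    proof (rule AE_I2)
      fix x
      obtain N where N: "max (norm x) (norm (f x)) \<le> real N" using real_arch_simple by blast
      have "\<forall>\<^sub>F M in sequentially. (norm (f x - g M x))\<^sup>2 = (norm (f x - f x))\<^sup>2"
        unfolding eventually_sequentially
      proof (intro exI[of _ N] allI impI)
        fix M assume "N \<le> M"
        then have "real N \<le> real M" by simp
        with N show "(norm (f x - g M x))\<^sup>2 = (norm (f x - f x))\<^sup>2" by (simp add: g_def S_def)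
      qed
      then show "(\<lambda>M. (norm (f x - g M x))\<^sup>2) \<longlonglongrightarrow> (norm (f x - f x))\<^sup>2" by (rule tendsto_eventually)
    qed
  qed (use f in \<open>auto simp: g_def indicator_def\<close>)
  \<comment> \<open>The inequality |a + b|^2 <= 2 |a|^2 + 2 |b|^2 is used twice: the truncation
    error and its translate together give at most e / 3, which is then doubled, and the bounded part
    supplies the last e / 3.\<close>
  then have "\<forall>\<^sub>F M in sequentially. (LBINT x. (norm (f x - g M x))\<^sup>2) < e / 12"
    using e by (intro order_tendstoD(2)) auto
  then obtain M where M: "(LBINT x. (norm (f x - g M x))\<^sup>2) < e / 12"
    by (auto simp: eventually_sequentially)
  let ?g = "g M"
  have gM: "norm (?g x) \<le> real M" for x by (auto simp: g_def S_def indicator_def)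
  have gi: "integrable lborel ?g"
  proof (rule Bochner_Integration.integrable_bound)
    show "integrable lborel (\<lambda>x::'a. indicator (cball 0 (real M)) x * real M)"
      using emeasure_lborel_cball_finite[of "0::'a" "real M"]
      by (intro integrable_mult_left) (simp add: integrable_indicator_iff)
    show "AE x in lborel. norm (?g x) \<le> norm (indicator (cball 0 (real M)) x * real M)"
      by (auto simp: g_def S_def indicator_def)
  qed simp
  have g2: "integrable lborel (\<lambda>x. (norm (?g x))\<^sup>2)"
    by (rule Bochner_Integration.integrable_bound[OF f]) (auto simp: g_def indicator_def)
  have fg: "integrable lborel (\<lambda>x. (norm (f x - ?g x))\<^sup>2)"
    by (rule L2_diff) (use f g2 in auto)
  have ineq: "(LBINT x. (norm (f (x - y) - f x))\<^sup>2) \<le>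
      4 * real M * (LBINT x. norm (?g (x - y) - ?g x)) + e * 2 / 3" for y
  proof -
    have I1: "integrable lborel (\<lambda>x. norm (?g (x - y) - ?g x))"
      using gi by (intro Bochner_Integration.integrable_norm Bochner_Integration.integrable_diff)
         (auto simp: integrable_lborel_sub)
    have "integrable lborel (\<lambda>x. (norm (?g (x - y)))\<^sup>2)"
      using g2 integrable_lborel_sub[of "\<lambda>x. (norm (?g x))\<^sup>2" y] by simp
    then have I2: "integrable lborel (\<lambda>x. (norm (?g (x - y) - ?g x))\<^sup>2)"
      by (intro L2_diff) (use g2 in auto)
    have I3: "integrable lborel (\<lambda>x. (norm (f (x - y) - ?g (x - y)))\<^sup>2)"
      using fg integrable_lborel_sub[of "\<lambda>x. (norm (f x - ?g x))\<^sup>2" y] by simp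
    have E3: "(LBINT x. (norm (f (x - y) - ?g (x - y)))\<^sup>2) = (LBINT x. (norm (f x - ?g x))\<^sup>2)"
      using integral_lborel_sub[of "\<lambda>x. (norm (f x - ?g x))\<^sup>2" y] by simp
    let ?d = "\<lambda>x. (f (x - y) - ?g (x - y)) - (f x - ?g x)"
    have Id: "integrable lborel (\<lambda>x. (norm (?d x))\<^sup>2)"
      "(LBINT x. (norm (?d x))\<^sup>2) \<le> e / 3"
      using L2_diff[of "\<lambda>x. f (x - y) - ?g (x - y)" lborel "\<lambda>x. f x - ?g x"] I3 fg M E3 by auto
    have "(LBINT x. (norm (f (x - y) - f x))\<^sup>2) =
       (LBINT x. (norm ((?g (x - y) - ?g x) + ?d x))\<^sup>2)"
      by (simp add: algebra_simps)
    also have "\<dots> \<le> 2 * (LBINT x. (norm (?g (x - y) - ?g x))\<^sup>2) + 2 * (LBINT x. (norm (?d x))\<^sup>2)"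
      by (rule L2_add) (use I2 Id in auto)
    also have "(LBINT x. (norm (?g (x - y) - ?g x))\<^sup>2) \<le> (LBINT x. (2 * M) * norm (?g (x - y) - ?g x))"
    proof (intro integral_mono I2 integrable_mult_right I1)
      fix x
      have "norm (?g (x - y) - ?g x) \<le> 2 * M"
        using gM[of x] gM[of "x - y"] norm_triangle_ineq4[of "?g (x - y)" "?g x"] by simp
      then show "(norm (?g (x - y) - ?g x))\<^sup>2 \<le> (2 * M) * norm (?g (x - y) - ?g x)"
        by (simp add: power2_eq_square mult_right_mono)
    qed
    finally show ?thesis using Id(2) by simp
  qed
  have "((\<lambda>y. 4 * real M * (LBINT x. norm (?g (x - y) - ?g x))) \<longlongrightarrow> 4 * real M * 0) (at 0)"
    by (intro tendsto_mult tendsto_const L1_translation gi)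
  then have "((\<lambda>y. 4 * real M * (LBINT x. norm (?g (x - y) - ?g x))) \<longlongrightarrow> 0) (at 0)"
    by (simp only: mult_zero_right)
  then have "\<forall>\<^sub>F y in at 0. 4 * real M * (LBINT x. norm (?g (x - y) - ?g x)) < e / 3"
    by (rule order_tendstoD(2)) (use e in simp)
  then show "\<forall>\<^sub>F y in at 0. dist (LBINT x. (norm (f (x - y) - f x))\<^sup>2) 0 < e"
  proof eventually_elim
    case (elim y)
    have "0 \<le> (LBINT x. (norm (f (x - y) - f x))\<^sup>2)" by simp
    with elim ineq[of y] show ?case by simp
  qed
qed

section \<open>Mollification\<close>

lemma le_one_plus_square: "(a::real) \<le> 1 + a\<^sup>2"
proof -
  have "1 + a\<^sup>2 - a = (a - 1 / 2)\<^sup>2 + 3 / 4" by (simp add: power2_eq_square algebra_simps)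
  then show ?thesis using zero_le_power2[of "a - 1 / 2"] by linarith
qed

text \<open>The variance of |h| under the probability density \<rho> is nonnegative. Integrability
  of the product comes from t <= 1 + t^2.\<close>

lemma jensen_sq:
  fixes h :: "'a \<Rightarrow> 'b::{banach,second_countable_topology}"
  assumes \<rho>: "integrable M \<rho>" "integral\<^sup>L M \<rho> = 1" "\<And>x. 0 \<le> \<rho> x"
    and [measurable]: "h \<in> borel_measurable M"
    and h: "integrable M (\<lambda>x. \<rho> x * (norm (h x))\<^sup>2)"
  shows "integrable M (\<lambda>x. \<rho> x *\<^sub>R h x)"
    and "(norm (LINT x|M. \<rho> x *\<^sub>R h x))\<^sup>2 \<le> (LINT x|M. \<rho> x * (norm (h x))\<^sup>2)"
proof -
  have [measurable]: "\<rho> \<in> borel_measurable M" using \<rho> by auto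
  show I: "integrable M (\<lambda>x. \<rho> x *\<^sub>R h x)"
  proof (rule Bochner_Integration.integrable_bound)
    show "integrable M (\<lambda>x. \<rho> x + \<rho> x * (norm (h x))\<^sup>2)" using \<rho> h by simp
    show "AE x in M. norm (\<rho> x *\<^sub>R h x) \<le> norm (\<rho> x + \<rho> x * (norm (h x))\<^sup>2)"
    proof (rule AE_I2)
      fix x
      have "norm (h x) \<le> 1 + (norm (h x))\<^sup>2"
        by (rule le_one_plus_square)
      then have "\<rho> x * norm (h x) \<le> \<rho> x * (1 + (norm (h x))\<^sup>2)"
        by (intro mult_left_mono \<rho>)
      then show "norm (\<rho> x *\<^sub>R h x) \<le> norm (\<rho> x + \<rho> x * (norm (h x))\<^sup>2)"
        using \<rho>(3)[of x] by (simp add: distrib_left)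
    qed
  qed simp
  have J: "integrable M (\<lambda>x. \<rho> x * norm (h x))"
    using Bochner_Integration.integrable_norm[OF I] \<rho>(3) by simp
  define A where "A = (LINT x|M. \<rho> x * norm (h x))"
  have "0 \<le> (LINT x|M. \<rho> x * (norm (h x) - A)\<^sup>2)"
    using \<rho>(3) by simp
  also have "\<dots> = (LINT x|M. \<rho> x * (norm (h x))\<^sup>2 - (2 * A) * (\<rho> x * norm (h x)) + A\<^sup>2 * \<rho> x)"
    by (simp add: power2_diff algebra_simps)
  also have "\<dots> = (LINT x|M. \<rho> x * (norm (h x))\<^sup>2) - (2 * A) * A + A\<^sup>2"
    using J h \<rho> by (simp add: A_def)
  finally have "A\<^sup>2 \<le> (LINT x|M. \<rho> x * (norm (h x))\<^sup>2)" by (simp add: power2_eq_square)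
  moreover have "norm (LINT x|M. \<rho> x *\<^sub>R h x) \<le> A"
    unfolding A_def using integral_norm_bound[of M "\<lambda>x. \<rho> x *\<^sub>R h x"] \<rho>(3) by simp
  then have "(norm (LINT x|M. \<rho> x *\<^sub>R h x))\<^sup>2 \<le> A\<^sup>2" by (intro power_mono) auto
  ultimately show "(norm (LINT x|M. \<rho> x *\<^sub>R h x))\<^sup>2 \<le> (LINT x|M. \<rho> x * (norm (h x))\<^sup>2)" by simp
qed

lemma ball_borel [measurable]:
  "ball (a::'a::euclidean_space) r \<in> sets borel" "cball a r \<in> sets borel"
  by auto

text \<open>The kernel is real and the function may be vector-valued, so that one operator mollifies
  functions and their gradients alike.\<close>

definition conv :: "(real ^ 'n \<Rightarrow> real) \<Rightarrow> (real ^ 'n \<Rightarrow> 'b) \<Rightarrow> real ^ 'n \<Rightarrow> 'b::{banach,second_countable_topology}" where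
  "conv \<kappa> f x = (LBINT y. \<kappa> (x - y) *\<^sub>R f y)"

lemma conv_borel [measurable]:
  assumes [measurable]: "\<kappa> \<in> borel_measurable borel" "f \<in> borel_measurable borel"
  shows "conv \<kappa> f \<in> borel_measurable borel"
  unfolding conv_def by measurable

text \<open>Balls about the origin suffice as test sets, since every compact set lies in one; vector
  values are allowed for the sake of gradients.\<close>

definition loc_sq :: "(real ^ 'n \<Rightarrow> 'b::real_normed_vector) \<Rightarrow> bool" where
  "loc_sq f \<longleftrightarrow> f \<in> borel_measurable borel \<and>
     (\<forall>r. integrable lborel (\<lambda>x. indicator (cball 0 r) x * (norm (f x))\<^sup>2))"

lemma loc_sqI:
  fixes f :: "real ^ 'n \<Rightarrow> 'b::{real_normed_vector,second_countable_topology}"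
  assumes [measurable]: "f \<in> borel_measurable borel" and f: "integrable lborel (\<lambda>x. (norm (f x))\<^sup>2)"
  shows "loc_sq f"
  unfolding loc_sq_def
  by (auto intro!: Bochner_Integration.integrable_bound[OF f] simp: indicator_def)

lemma integrable_cball: "integrable lborel (indicator (cball (a::'a::euclidean_space) r) :: 'a \<Rightarrow> real)"
  using emeasure_lborel_cball_finite[of a r] by (simp add: integrable_indicator_iff)

lemma loc_sq_integrable:
  fixes f :: "real ^ 'n \<Rightarrow> 'b::{banach,second_countable_topology}"
  assumes "loc_sq f"
  shows "integrable lborel (\<lambda>x. indicator (cball 0 r) x *\<^sub>R f x)"
proof (rule Bochner_Integration.integrable_bound)
  have [measurable]: "f \<in> borel_measurable borel" using assms by (simp add: loc_sq_def)
  show "integrable lborel (\<lambda>x. indicator (cball 0 r) x + indicator (cball 0 r) x * (norm (f x))\<^sup>2)"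
    using assms by (intro Bochner_Integration.integrable_add integrable_cball) (simp add: loc_sq_def)
  show "AE x in lborel. norm (indicator (cball 0 r) x *\<^sub>R f x)
     \<le> norm (indicator (cball 0 r) x + indicator (cball 0 r) x * (norm (f x))\<^sup>2)"
  proof (rule AE_I2)
    fix x
    have "norm (f x) \<le> 1 + (norm (f x))\<^sup>2"
      by (rule le_one_plus_square)
    then show "norm (indicator (cball 0 r) x *\<^sub>R f x)
     \<le> norm (indicator (cball 0 r) x + indicator (cball 0 r) x * (norm (f x))\<^sup>2)"
      by (auto simp: indicator_def)
  qed
  show "(\<lambda>x. indicator (cball 0 r) x *\<^sub>R f x) \<in> borel_measurable lborel"
    by (intro borel_measurable_scaleR borel_measurable_indicator) auto
qed

lemma loc_sq_integrable_mult:
  fixes f :: "real ^ 'n \<Rightarrow> 'b::{banach,second_countable_topology}"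
  assumes f: "loc_sq f" and [measurable]: "\<phi> \<in> borel_measurable borel"
    and B: "\<And>x. \<bar>\<phi> x\<bar> \<le> B" and 0: "\<And>x. r < norm x \<Longrightarrow> \<phi> x = 0"
  shows "integrable lborel (\<lambda>x. \<phi> x *\<^sub>R f x)"
proof (rule Bochner_Integration.integrable_bound)
  have [measurable]: "f \<in> borel_measurable borel" using f by (simp add: loc_sq_def)
  show "integrable lborel (\<lambda>x. B *\<^sub>R (indicator (cball 0 r) x *\<^sub>R f x))"
    by (intro integrable_scaleR_right loc_sq_integrable f)
  show "AE x in lborel. norm (\<phi> x *\<^sub>R f x) \<le> norm (B *\<^sub>R (indicator (cball 0 r) x *\<^sub>R f x))"
  proof (rule AE_I2)
    fix x
    have "0 \<le> B" using B[of x] by linarith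
    then show "norm (\<phi> x *\<^sub>R f x) \<le> norm (B *\<^sub>R (indicator (cball 0 r) x *\<^sub>R f x))"
      using B[of x] 0[of x] by (auto simp: indicator_def intro!: mult_right_mono)
  qed
  show "(\<lambda>x. \<phi> x *\<^sub>R f x) \<in> borel_measurable lborel" by measurable
qed

lemma loc_sq_test_integrable:
  fixes f :: "real ^ 'n \<Rightarrow> 'b::{banach,second_countable_topology}"
  assumes "loc_sq f" "\<phi> \<in> test_functions U"
  shows "integrable lborel (\<lambda>x. \<phi> x *\<^sub>R f x)"
proof -
  obtain B where "\<And>x. \<bar>\<phi> x\<bar> \<le> B" using test_functions_bounded[OF assms(2)] by metis
  moreover obtain r where "\<And>x. r < norm x \<Longrightarrow> \<phi> x = 0" using test_functions_supp[OF assms(2)] by metis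
  ultimately show ?thesis
    using assms test_functions_borel[OF assms(2)] by (intro loc_sq_integrable_mult) auto
qed

lemma loc_sq_grad_integrable:
  fixes f :: "real ^ 'n \<Rightarrow> real"
  assumes "loc_sq f" "\<phi> \<in> test_functions U"
  shows "integrable lborel (\<lambda>x. f x *\<^sub>R grad \<phi> x)"
proof -
  have [measurable]: "f \<in> borel_measurable borel" "grad \<phi> \<in> borel_measurable borel"
    using assms test_functions_borel by (auto simp: loc_sq_def)
  obtain B where "\<And>x. norm (grad \<phi> x) \<le> B" using test_functions_bounded[OF assms(2)] by metis
  moreover obtain r where "\<And>x. r < norm x \<Longrightarrow> grad \<phi> x = 0" using test_functions_supp[OF assms(2)] by metis
  ultimately have I: "integrable lborel (\<lambda>x. norm (grad \<phi> x) *\<^sub>R f x)"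
    using assms by (intro loc_sq_integrable_mult) auto
  show ?thesis
    by (rule Bochner_Integration.integrable_bound[OF I]) (auto simp: abs_mult mult.commute)
qed

lemma conv_integrable:
  fixes f :: "real ^ 'n \<Rightarrow> 'b::{banach,second_countable_topology}"
  assumes f: "loc_sq f" and \<kappa>: "\<kappa> \<in> test_functions U"
  shows "integrable lborel (\<lambda>y. \<kappa> (x - y) *\<^sub>R f y)"
proof -
  obtain r where r: "\<And>x. r < norm x \<Longrightarrow> \<kappa> x = 0" using test_functions_supp[OF \<kappa>] by metis
  obtain B where B: "\<And>x. \<bar>\<kappa> x\<bar> \<le> B" using test_functions_bounded[OF \<kappa>] by metis
  have [measurable]: "\<kappa> \<in> borel_measurable borel" by (rule test_functions_borel[OF \<kappa>])
  show ?thesis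
  proof (rule loc_sq_integrable_mult[OF f])
    show "\<bar>\<kappa> (x - y)\<bar> \<le> B" for y by (rule B)
    show "\<kappa> (x - y) = 0" if "norm x + r < norm y" for y
      using that norm_triangle_ineq2[of y x] by (intro r) (simp add: norm_minus_commute)
  qed simp
qed

section \<open>Differentiation of convolutions\<close>

lemma uniform_differentiability:
  assumes "\<kappa> \<in> test_functions U" "0 < e"
  obtains d where "0 < d"
    "\<And>z h. norm h < d \<Longrightarrow> \<bar>\<kappa> (z + h) - \<kappa> z - grad \<kappa> z \<bullet> h\<bar> \<le> e * norm h"
proof -
  obtain r where r: "0 < r" "\<And>x. r < norm x \<Longrightarrow> \<kappa> x = 0 \<and> grad \<kappa> x = 0"
    using test_functions_supp[OF assms(1)] by metis
  have sm: "smooth \<kappa>" using assms(1) by (rule test_functions_smooth)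
  have "uniformly_continuous_on (cball 0 (r + 2)) (grad \<kappa>)"
    by (intro compact_uniformly_continuous smooth_continuous_grad sm compact_cball)
  then obtain d where d: "0 < d" "\<And>x y. x \<in> cball 0 (r + 2) \<Longrightarrow> y \<in> cball 0 (r + 2) \<Longrightarrow> dist y x < d \<Longrightarrow>
      dist (grad \<kappa> y) (grad \<kappa> x) < e"
    using \<open>0 < e\<close> unfolding uniformly_continuous_on_def by metis
  \<comment> \<open>Increments shorter than 1 keep both points in the compact ball of radius r + 2,
    or else both outside the support, where the gradient is 0; so the modulus of continuity is
    global.\<close>
  have close: "norm (grad \<kappa> y - grad \<kappa> x) \<le> e" if "norm (y - x) < min d 1" for x y
  proof (cases "norm x \<le> r + 1")
    case True
    then have "x \<in> cball 0 (r + 2)" "y \<in> cball 0 (r + 2)"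
      using that norm_triangle_ineq2[of y x] by auto
    with d(2)[of x y] that show ?thesis by (auto simp: dist_norm)
  next
    case False
    then have "r < norm x" "r < norm y"
      using that norm_triangle_ineq2[of x y] by (auto simp: norm_minus_commute)
    then show ?thesis using r assms(2) by simp
  qed
  show ?thesis
  proof (rule that[of "min d 1"])
    show "0 < min d 1" using d by simp
    fix z h :: "real ^ 'a" assume h: "norm h < min d 1"
    let ?\<psi> = "\<lambda>y. \<kappa> y - grad \<kappa> z \<bullet> y"
    have "norm (?\<psi> (z + h) - ?\<psi> z) \<le> e * norm ((z + h) - z)"
    proof (rule differentiable_bound[OF convex_ball, of z "min d 1"])
      fix x assume x: "x \<in> ball z (min d 1)"
      show "(?\<psi> has_derivative (\<lambda>v. (grad \<kappa> x - grad \<kappa> z) \<bullet> v)) (at x within ball z (min d 1))"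
        by (auto intro!: derivative_eq_intros has_derivative_at_withinI[OF smooth_has_derivative] sm
            simp: inner_diff_left)
      show "onorm (\<lambda>v. (grad \<kappa> x - grad \<kappa> z) \<bullet> v) \<le> e"
      proof (rule onorm_bound)
        show "0 \<le> e" using assms(2) by simp
        fix v :: "real ^ 'a"
        have "norm (grad \<kappa> x - grad \<kappa> z) * norm v \<le> e * norm v"
          using close[of x z] x by (intro mult_right_mono) (auto simp: dist_norm norm_minus_commute)
        then show "norm ((grad \<kappa> x - grad \<kappa> z) \<bullet> v) \<le> e * norm v"
          using Cauchy_Schwarz_ineq2[of "grad \<kappa> x - grad \<kappa> z" v] by simp
      qed
    qed (use h d in \<open>auto simp: dist_norm\<close>)
    then show "\<bar>\<kappa> (z + h) - \<kappa> z - grad \<kappa> z \<bullet> h\<bar> \<le> e * norm h"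
      by (simp add: inner_add_right algebra_simps)
  qed
qed

text \<open>All differentiation falls on the kernel. The derivative is again a convolution with a
  test function, so smoothness to all orders follows by iteration.\<close>

lemma conv_has_derivative:
  fixes f :: "real ^ 'n \<Rightarrow> real"
  assumes f: "loc_sq f" and \<kappa>: "\<kappa> \<in> test_functions U"
  shows "(conv \<kappa> f has_derivative (\<lambda>h. conv (\<lambda>z. grad \<kappa> z \<bullet> h) f x)) (at x)"
    and "conv (\<lambda>z. grad \<kappa> z \<bullet> h) f x = (LBINT y. f y *\<^sub>R grad \<kappa> (x - y)) \<bullet> h"
proof -
  have [measurable]: "f \<in> borel_measurable borel" "\<kappa> \<in> borel_measurable borel" "grad \<kappa> \<in> borel_measurable borel"
    using f test_functions_borel[OF \<kappa>] by (auto simp: loc_sq_def)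
  obtain r where r: "0 < r" "\<And>x. r < norm x \<Longrightarrow> \<kappa> x = 0 \<and> grad \<kappa> x = 0"
    using test_functions_supp[OF \<kappa>] by metis
  have Ig: "integrable lborel (\<lambda>y. f y *\<^sub>R grad \<kappa> (x - y))"
  proof (rule Bochner_Integration.integrable_bound)
    obtain B where B: "\<And>x. norm (grad \<kappa> x) \<le> B" using test_functions_bounded[OF \<kappa>] by metis
    show "integrable lborel (\<lambda>y. norm (grad \<kappa> (x - y)) *\<^sub>R f y)"
    proof (rule loc_sq_integrable_mult[OF f])
      show "\<bar>norm (grad \<kappa> (x - y))\<bar> \<le> B" for y using B by simp
      show "norm (grad \<kappa> (x - y)) = 0" if "norm x + r < norm y" for y
        using that norm_triangle_ineq2[of y x] r(2)[of "x - y"] by (simp add: norm_minus_commute)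
    qed simp
  qed (auto simp: abs_mult mult.commute)
  show eq: "conv (\<lambda>z. grad \<kappa> z \<bullet> h) f x = (LBINT y. f y *\<^sub>R grad \<kappa> (x - y)) \<bullet> h" for h
  proof -
    have "(LBINT y. (f y *\<^sub>R grad \<kappa> (x - y)) \<bullet> h) = (LBINT y. f y *\<^sub>R grad \<kappa> (x - y)) \<bullet> h"
      by (rule integral_inner_left) (use Ig in simp)
    then show ?thesis by (simp add: conv_def mult.commute)
  qed
  \<comment> \<open>For increments shorter than 1 the remainder vanishes beyond this ball, so only
    the mass of f inside it multiplies the uniform differentiability error. Dividing by C + 1 covers
    C = 0.\<close>
  define C where "C = (LBINT y. indicator (cball 0 (norm x + r + 1)) y * \<bar>f y\<bar>)"
  have IC: "integrable lborel (\<lambda>y. indicator (cball 0 (norm x + r + 1)) y * \<bar>f y\<bar>)"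
    using Bochner_Integration.integrable_norm[OF loc_sq_integrable[OF f]] by (simp add: abs_mult)
  have C: "0 \<le> C" unfolding C_def by simp
  show "(conv \<kappa> f has_derivative (\<lambda>h. conv (\<lambda>z. grad \<kappa> z \<bullet> h) f x)) (at x)"
    unfolding has_derivative_at_alt
  proof (intro conjI allI impI)
    show "bounded_linear (\<lambda>h. conv (\<lambda>z. grad \<kappa> z \<bullet> h) f x)"
      unfolding eq by (rule bounded_linear_inner_right)
    fix e :: real assume e: "0 < e"
    then have "0 < e / (C + 1)" using C by simp
    then obtain d where d: "0 < d" "\<And>z h. norm h < d \<Longrightarrow> \<bar>\<kappa> (z + h) - \<kappa> z - grad \<kappa> z \<bullet> h\<bar> \<le> e / (C + 1) * norm h"
      using uniform_differentiability[OF \<kappa>] by metis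
    show "\<exists>d>0. \<forall>y. norm (y - x) < d \<longrightarrow>
        norm (conv \<kappa> f y - conv \<kappa> f x - conv (\<lambda>z. grad \<kappa> z \<bullet> (y - x)) f x) \<le> e * norm (y - x)"
    proof (intro exI[of _ "min d 1"] conjI allI impI)
      fix x' assume x': "norm (x' - x) < min d 1"
      define h where "h = x' - x"
      let ?R = "\<lambda>y. \<kappa> (x' - y) - \<kappa> (x - y) - grad \<kappa> (x - y) \<bullet> h"
      have bd: "\<bar>?R y * f y\<bar> \<le> e / (C + 1) * norm h * (indicator (cball 0 (norm x + r + 1)) y * \<bar>f y\<bar>)" for y
      proof (cases "norm y \<le> norm x + r + 1")
        case True
        have "\<bar>?R y\<bar> \<le> e / (C + 1) * norm h"
          using d(2)[of h "x - y"] x' by (simp add: h_def algebra_simps)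
        then have "\<bar>?R y\<bar> * \<bar>f y\<bar> \<le> e / (C + 1) * norm h * \<bar>f y\<bar>" by (intro mult_right_mono) auto
        then show ?thesis using True by (simp add: abs_mult)
      next
        case False
        then have "r < norm (x - y)" "r < norm (x' - y)"
          using norm_triangle_ineq2[of y x] norm_triangle_ineq2[of y x'] norm_triangle_ineq2[of x' x] x'
          by (auto simp: norm_minus_commute)
        then have "?R y = 0" using r(2) by simp
        then show ?thesis using e C by simp
      qed
      have I: "integrable lborel (\<lambda>y. \<kappa> (x - y) * f y)" "integrable lborel (\<lambda>y. \<kappa> (x' - y) * f y)"
        using conv_integrable[OF f \<kappa>] by auto
      have I2: "integrable lborel (\<lambda>y. (grad \<kappa> (x - y) \<bullet> h) * f y)"
      proof -
        have "integrable lborel (\<lambda>y. (f y *\<^sub>R grad \<kappa> (x - y)) \<bullet> h)"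
          by (rule integrable_inner_left) (rule Ig)
        then show ?thesis by (simp add: mult.commute)
      qed
      have "conv \<kappa> f x' - conv \<kappa> f x - conv (\<lambda>z. grad \<kappa> z \<bullet> h) f x = (LBINT y. ?R y * f y)"
        unfolding conv_def using I I2 by (simp add: left_diff_distrib)
      also have "norm \<dots> \<le> (LBINT y. e / (C + 1) * norm h * (indicator (cball 0 (norm x + r + 1)) y * \<bar>f y\<bar>))"
        using bd IC by (intro Bochner_Integration.integral_norm_bound_integral)
          (auto simp: left_diff_distrib intro!: Bochner_Integration.integrable_diff I I2)
      also have "\<dots> = e / (C + 1) * norm h * C" by (simp add: C_def)
      also have "\<dots> = e * norm h * (C / (C + 1))" by simp
      also have "\<dots> \<le> e * norm h" using C e by (intro mult_left_le) auto
      finally show "norm (conv \<kappa> f x' - conv \<kappa> f x - conv (\<lambda>z. grad \<kappa> z \<bullet> (x' - x)) f x) \<le> e * norm (x' - x)"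
        by (simp add: h_def)
    qed (use d in auto)
  qed
qed

lemma conv_grad:
  fixes f :: "real ^ 'n \<Rightarrow> real"
  assumes f: "loc_sq f" and \<kappa>: "\<kappa> \<in> test_functions U"
  shows "grad (conv \<kappa> f) x = (LBINT y. f y *\<^sub>R grad \<kappa> (x - y))"
    and "grad (conv \<kappa> f) x \<bullet> e = conv (\<lambda>z. grad \<kappa> z \<bullet> e) f x"
proof -
  show "grad (conv \<kappa> f) x = (LBINT y. f y *\<^sub>R grad \<kappa> (x - y))"
    by (rule grad_eqI) (use conv_has_derivative[OF assms] in simp)
  then show "grad (conv \<kappa> f) x \<bullet> e = conv (\<lambda>z. grad \<kappa> z \<bullet> e) f x"
    using conv_has_derivative(2)[OF assms] by simp
qed

lemma conv_smooth:
  fixes f :: "real ^ 'n \<Rightarrow> real"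
  assumes f: "loc_sq f" and \<kappa>: "\<kappa> \<in> test_functions U"
  shows "smooth (conv \<kappa> f)"
proof -
  have dif: "conv \<kappa> f differentiable (at x)" if "\<kappa> \<in> test_functions U" for x \<kappa>
    using conv_has_derivative(1)[OF f that] unfolding differentiable_def by blast
  have "C_k k (conv \<kappa> f)" for k
    using \<kappa>
  proof (induction k arbitrary: \<kappa>)
    case 0
    then show ?case
      using dif by (auto intro!: differentiable_imp_continuous_on simp: differentiable_on_def)
  next
    case (Suc k)
    have "(\<lambda>x. grad (conv \<kappa> f) x $ i) = conv (\<lambda>z. grad \<kappa> z \<bullet> axis i 1) f" for i
      using conv_grad(2)[OF f Suc.prems, of _ "axis i 1"] by (simp add: inner_axis)
    moreover have "C_k k (conv (\<lambda>z. grad \<kappa> z \<bullet> axis i 1) f)" for i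
      by (intro Suc.IH test_functions_grad Suc.prems)
    ultimately show ?case using dif[OF Suc.prems] by simp
  qed
  then show ?thesis by (simp add: smooth_def)
qed

lemma conv_eq_0:
  assumes "\<And>x. r \<le> norm x \<Longrightarrow> \<kappa> x = 0" and "AE y in lborel. y \<in> ball x r \<longrightarrow> f y = 0"
  shows "conv \<kappa> f x = 0"
proof -
  have "AE y in lborel. \<kappa> (x - y) *\<^sub>R f y = 0"
    using assms(2)
  proof eventually_elim
    case (elim y)
    then show ?case using assms(1)[of "x - y"] by (cases "y \<in> ball x r") (auto simp: dist_norm)
  qed
  then show ?thesis unfolding conv_def by (rule integral_eq_zero_AE)
qed

section \<open>Mean square convergence of mollifications\<close>

lemma mollify_L2_bound:
  fixes f :: "real ^ 'n \<Rightarrow> 'b::{banach,second_countable_topology}"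
  assumes [measurable]: "f \<in> borel_measurable borel" and f: "integrable lborel (\<lambda>x. (norm (f x))\<^sup>2)"
    and \<rho>: "is_mollifier r \<rho>" and "0 \<le> e"
    and e: "\<And>y. norm y < r \<Longrightarrow> (LBINT x. (norm (f (x - y) - f x))\<^sup>2) \<le> e"
  shows "integrable lborel (\<lambda>x. (norm (conv \<rho> f x - f x))\<^sup>2)"
    and "(LBINT x. (norm (conv \<rho> f x - f x))\<^sup>2) \<le> e"
proof -
  note \<rho>D = is_mollifierD[OF \<rho>]
  have [measurable]: "\<rho> \<in> borel_measurable borel" by (rule test_functions_borel[OF \<rho>D(1)])
  obtain B where B: "0 \<le> B" "\<And>x. \<bar>\<rho> x\<bar> \<le> B" using test_functions_bounded[OF \<rho>D(1)] by metis
  \<comment> \<open>The mollification error at x averages f(y) - f(x) with weight \<rho>(x - y).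
    Jensen's inequality moves the square inside, and reflecting y turns the result into an average
    over translations.\<close>
  have pt: "ennreal ((norm (conv \<rho> f x - f x))\<^sup>2) \<le> (\<integral>\<^sup>+y. ennreal (\<rho> y * (norm (f (x - y) - f x))\<^sup>2) \<partial>lborel)" for x
  proof -
    have I\<rho>: "integrable lborel (\<lambda>y. \<rho> (x - y))" "(LBINT y. \<rho> (x - y)) = 1"
      using test_functions_integrable(1)[OF \<rho>D(1)] \<rho>D(3)
      by (simp_all add: integrable_lborel_reflect integral_lborel_reflect)
    have I1: "integrable lborel (\<lambda>y. \<rho> (x - y) *\<^sub>R f y)"
      by (rule conv_integrable[OF loc_sqI[OF _ f] \<rho>D(1)]) simp
    have I2: "integrable lborel (\<lambda>y. \<rho> (x - y) * (norm (f y - f x))\<^sup>2)"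
    proof (rule Bochner_Integration.integrable_bound)
      show "integrable lborel (\<lambda>y. (2 * B) * (norm (f y))\<^sup>2 + (2 * (norm (f x))\<^sup>2) * \<rho> (x - y))"
        using f I\<rho> by simp
      show "AE y in lborel. norm (\<rho> (x - y) * (norm (f y - f x))\<^sup>2)
          \<le> norm ((2 * B) * (norm (f y))\<^sup>2 + (2 * (norm (f x))\<^sup>2) * \<rho> (x - y))"
      proof (rule AE_I2)
        fix y
        have p: "0 \<le> \<rho> (x - y)" "\<rho> (x - y) \<le> B" using \<rho>D(2) B(2)[of "x - y"] by auto
        have "\<rho> (x - y) * (norm (f y - f x))\<^sup>2 \<le> \<rho> (x - y) * (2 * (norm (f y))\<^sup>2 + 2 * (norm (f x))\<^sup>2)"
          using norm_sq_triangle[of "f y" "- f x"] p by (intro mult_left_mono) auto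
        also have "\<dots> \<le> B * (2 * (norm (f y))\<^sup>2) + (2 * (norm (f x))\<^sup>2) * \<rho> (x - y)"
          using mult_right_mono[OF p(2), of "2 * (norm (f y))\<^sup>2"] by (simp add: algebra_simps)
        finally show "norm (\<rho> (x - y) * (norm (f y - f x))\<^sup>2)
          \<le> norm ((2 * B) * (norm (f y))\<^sup>2 + (2 * (norm (f x))\<^sup>2) * \<rho> (x - y))"
          using p by (simp add: abs_mult)
      qed
    qed simp
    have "conv \<rho> f x - f x = (LBINT y. \<rho> (x - y) *\<^sub>R (f y - f x))"
      using I1 I\<rho> by (simp add: conv_def scaleR_diff_right)
    then have "(norm (conv \<rho> f x - f x))\<^sup>2 \<le> (LBINT y. \<rho> (x - y) * (norm (f y - f x))\<^sup>2)"
      using jensen_sq(2)[OF I\<rho> _ _ I2] \<rho>D(2) by simp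
    then have "ennreal ((norm (conv \<rho> f x - f x))\<^sup>2) \<le> ennreal (LBINT y. \<rho> (x - y) * (norm (f y - f x))\<^sup>2)"
      by (rule ennreal_leI)
    also have "\<dots> = (\<integral>\<^sup>+y. ennreal (\<rho> (x - y) * (norm (f y - f x))\<^sup>2) \<partial>lborel)"
      using \<rho>D(2) by (intro nn_integral_eq_integral[symmetric] I2) auto
    also have "\<dots> = (\<integral>\<^sup>+y. (\<lambda>y. ennreal (\<rho> y * (norm (f (x - y) - f x))\<^sup>2)) (x - y) \<partial>lborel)"
      by simp
    also have "\<dots> = (\<integral>\<^sup>+y. ennreal (\<rho> y * (norm (f (x - y) - f x))\<^sup>2) \<partial>lborel)"
      by (rule nn_integral_lborel_reflect) simp
    finally show ?thesis .
  qed
  \<comment> \<open>By Tonelli the mean square error is at most a \<rho>-average of translation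
    errors, each at most e wherever \<rho> is nonzero. Working with nonnegative integrals yields
    integrability along the way.\<close>
  have "(\<integral>\<^sup>+x. ennreal ((norm (conv \<rho> f x - f x))\<^sup>2) \<partial>lborel) \<le>
      (\<integral>\<^sup>+x. (\<integral>\<^sup>+y. ennreal (\<rho> y * (norm (f (x - y) - f x))\<^sup>2) \<partial>lborel) \<partial>lborel)"
    by (intro nn_integral_mono pt)
  also have "\<dots> = (\<integral>\<^sup>+y. (\<integral>\<^sup>+x. ennreal (\<rho> y * (norm (f (x - y) - f x))\<^sup>2) \<partial>lborel) \<partial>lborel)"
    by (rule lborel_pair.Fubini') simp
  also have "\<dots> \<le> (\<integral>\<^sup>+y. ennreal (\<rho> y) * ennreal e \<partial>lborel)"
  proof (rule nn_integral_mono)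
    fix y
    show "(\<integral>\<^sup>+x. ennreal (\<rho> y * (norm (f (x - y) - f x))\<^sup>2) \<partial>lborel) \<le> ennreal (\<rho> y) * ennreal e"
    proof (cases "norm y < r")
      case True
      have I: "integrable lborel (\<lambda>x. (norm (f (x - y) - f x))\<^sup>2)"
        using f integrable_lborel_sub[of "\<lambda>x. (norm (f x))\<^sup>2" y] by (intro L2_diff(1)) auto
      have "(\<integral>\<^sup>+x. ennreal (\<rho> y * (norm (f (x - y) - f x))\<^sup>2) \<partial>lborel) =
          (\<integral>\<^sup>+x. ennreal (\<rho> y) * ennreal ((norm (f (x - y) - f x))\<^sup>2) \<partial>lborel)"
        using \<rho>D(2) by (simp add: ennreal_mult')
      also have "\<dots> = ennreal (\<rho> y) * (\<integral>\<^sup>+x. ennreal ((norm (f (x - y) - f x))\<^sup>2) \<partial>lborel)"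
        by (rule nn_integral_cmult) simp
      also have "(\<integral>\<^sup>+x. ennreal ((norm (f (x - y) - f x))\<^sup>2) \<partial>lborel) =
          ennreal (LBINT x. (norm (f (x - y) - f x))\<^sup>2)"
        by (intro nn_integral_eq_integral I) auto
      also have "\<dots> \<le> ennreal e" by (intro ennreal_leI e True)
      finally show ?thesis by (simp add: mult_left_mono)
    next
      case False
      then have "\<rho> y = 0" using \<rho>D(4)[of y] by simp
      then show ?thesis by simp
    qed
  qed
  also have "\<dots> = (\<integral>\<^sup>+y. ennreal (\<rho> y) \<partial>lborel) * ennreal e"
    by (rule nn_integral_multc) simp
  also have "(\<integral>\<^sup>+y. ennreal (\<rho> y) \<partial>lborel) = 1"
    using nn_integral_eq_integral[OF test_functions_integrable(1)[OF \<rho>D(1)]] \<rho>D(2,3) by simp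
  finally have nn: "(\<integral>\<^sup>+x. ennreal ((norm (conv \<rho> f x - f x))\<^sup>2) \<partial>lborel) \<le> ennreal e" by simp
  then show I: "integrable lborel (\<lambda>x. (norm (conv \<rho> f x - f x))\<^sup>2)"
    by (intro integrableI_nonneg) (auto intro: le_less_trans ennreal_less_top)
  show "(LBINT x. (norm (conv \<rho> f x - f x))\<^sup>2) \<le> e"
    using nn nn_integral_eq_integral[OF I] \<open>0 \<le> e\<close> by simp
qed

lemma mollify_L2:
  fixes f :: "real ^ 'n \<Rightarrow> 'b::{banach,second_countable_topology}"
  assumes f: "f \<in> borel_measurable borel" "integrable lborel (\<lambda>x. (norm (f x))\<^sup>2)" and "0 < e"
  obtains d where "0 < d"
    "\<And>r \<rho>. r \<le> d \<Longrightarrow> is_mollifier r \<rho> \<Longrightarrow> integrable lborel (\<lambda>x. (norm (conv \<rho> f x - f x))\<^sup>2)"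
    "\<And>r \<rho>. r \<le> d \<Longrightarrow> is_mollifier r \<rho> \<Longrightarrow> (LBINT x. (norm (conv \<rho> f x - f x))\<^sup>2) \<le> e"
proof -
  have "\<forall>\<^sub>F y in at 0. (LBINT x. (norm (f (x - y) - f x))\<^sup>2) < e"
    using L2_translation[OF f] \<open>0 < e\<close> by (rule order_tendstoD(2))
  then obtain d where d: "0 < d" "\<And>y. y \<noteq> 0 \<Longrightarrow> dist y 0 < d \<Longrightarrow> (LBINT x. (norm (f (x - y) - f x))\<^sup>2) < e"
    unfolding eventually_at by auto
  have le: "(LBINT x. (norm (f (x - y) - f x))\<^sup>2) \<le> e" if "norm y < d" for y
    using d(2)[of y] that \<open>0 < e\<close> by (cases "y = 0") auto
  show ?thesis
  proof (rule that[OF d(1)])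
    fix r \<rho> assume "r \<le> d" and \<rho>: "is_mollifier r (\<rho> :: real ^ 'n \<Rightarrow> real)"
    then have *: "(LBINT x. (norm (f (x - y) - f x))\<^sup>2) \<le> e" if "norm y < r" for y
      using le[of y] that by simp
    show "integrable lborel (\<lambda>x. (norm (conv \<rho> f x - f x))\<^sup>2)"
      "(LBINT x. (norm (conv \<rho> f x - f x))\<^sup>2) \<le> e"
      using mollify_L2_bound[OF f \<rho> _ *] \<open>0 < e\<close> by auto
  qed
qed

lemma mollify_loc:
  fixes f :: "real ^ 'n \<Rightarrow> 'b::{banach,second_countable_topology}"
  assumes f: "loc_sq f" and "0 < e"
  obtains d where "0 < d"
    "\<And>r \<rho>. r \<le> d \<Longrightarrow> is_mollifier r \<rho> \<Longrightarrow> integrable lborel (\<lambda>x. indicator (cball 0 R) x * (norm (conv \<rho> f x - f x))\<^sup>2)"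
    "\<And>r \<rho>. r \<le> d \<Longrightarrow> is_mollifier r \<rho> \<Longrightarrow> (LBINT x. indicator (cball 0 R) x * (norm (conv \<rho> f x - f x))\<^sup>2) \<le> e"
proof -
  have [measurable]: "f \<in> borel_measurable borel" using f by (simp add: loc_sq_def)
  \<comment> \<open>From points of norm at most R, kernels of radius at most 1 see only this ball,
    so the global statement may be applied to the cut-off function.\<close>
  define h where "h x = indicator (cball 0 (R + 1)) x *\<^sub>R f x" for x
  have [measurable]: "h \<in> borel_measurable borel"
    unfolding h_def by (intro borel_measurable_scaleR borel_measurable_indicator) auto
  have "(\<lambda>x. (norm (h x))\<^sup>2) = (\<lambda>x. indicator (cball 0 (R + 1)) x * (norm (f x))\<^sup>2)"
    by (auto simp: h_def indicator_def)
  then have h2: "integrable lborel (\<lambda>x. (norm (h x))\<^sup>2)" using f by (simp add: loc_sq_def)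
  obtain d where d: "0 < d"
    "\<And>r \<rho>. r \<le> d \<Longrightarrow> is_mollifier r \<rho> \<Longrightarrow> integrable lborel (\<lambda>x. (norm (conv \<rho> h x - h x))\<^sup>2)"
    "\<And>r \<rho>. r \<le> d \<Longrightarrow> is_mollifier r \<rho> \<Longrightarrow> (LBINT x. (norm (conv \<rho> h x - h x))\<^sup>2) \<le> e"
    by (rule mollify_L2[OF \<open>h \<in> borel_measurable borel\<close> h2 \<open>0 < e\<close>]) blast
  show ?thesis
  proof (rule that[of "min d 1"])
    fix r \<rho> assume r: "r \<le> min d 1" and \<rho>: "is_mollifier r (\<rho> :: real ^ 'n \<Rightarrow> real)"
    note \<rho>D = is_mollifierD[OF \<rho>]
    have [measurable]: "\<rho> \<in> borel_measurable borel" by (rule test_functions_borel[OF \<rho>D(1)])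
    have eq: "conv \<rho> f x - f x = conv \<rho> h x - h x" if "x \<in> cball 0 R" for x
    proof -
      have c: "\<rho> (x - y) *\<^sub>R f y = \<rho> (x - y) *\<^sub>R h y" for y
      proof (cases "norm (x - y) < r")
        case True
        then have "norm y \<le> R + 1"
          using that r norm_triangle_ineq2[of y x] by (simp add: norm_minus_commute)
        then show ?thesis by (simp add: h_def)
      qed (use \<rho>D(4) in simp)
      have "conv \<rho> f x = conv \<rho> h x" unfolding conv_def by (simp only: c)
      moreover have "f x = h x" using that by (simp add: h_def)
      ultimately show ?thesis by simp
    qed
    have le: "indicator (cball 0 R) x * (norm (conv \<rho> f x - f x))\<^sup>2 \<le> (norm (conv \<rho> h x - h x))\<^sup>2" for x
      using eq[of x] by (auto simp: indicator_def)
    have Ih: "integrable lborel (\<lambda>x. (norm (conv \<rho> h x - h x))\<^sup>2)"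
      using d(2)[OF _ \<rho>] r by simp
    show I: "integrable lborel (\<lambda>x. indicator (cball 0 R) x * (norm (conv \<rho> f x - f x))\<^sup>2)"
      by (rule Bochner_Integration.integrable_bound[OF Ih]) (use le in auto)
    have "(LBINT x. indicator (cball 0 R) x * (norm (conv \<rho> f x - f x))\<^sup>2) \<le> (LBINT x. (norm (conv \<rho> h x - h x))\<^sup>2)"
      by (intro integral_mono I Ih le)
    also have "\<dots> \<le> e" using d(3)[OF _ \<rho>] r by simp
    finally show "(LBINT x. indicator (cball 0 R) x * (norm (conv \<rho> f x - f x))\<^sup>2) \<le> e" .
  qed (use d in simp)
qed

section \<open>Unique continuation for harmonic functions\<close>

text \<open>A positive second derivative would make \<open>h'\<close> positive just to the right of
  0, and the mean value theorem would give values above the maximum.\<close>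

lemma second_derivative_at_max:
  fixes h h' :: "real \<Rightarrow> real"
  assumes d: "0 < d" and h: "\<And>t. \<bar>t\<bar> < d \<Longrightarrow> (h has_real_derivative h' t) (at t)"
    and h2: "(h' has_real_derivative h2) (at 0)"
    and mx: "\<And>t. \<bar>t\<bar> < d \<Longrightarrow> h t \<le> h 0"
  shows "h2 \<le> 0"
proof (rule ccontr)
  assume "\<not> h2 \<le> 0"
  then obtain d' where d': "0 < d'" "\<And>t. 0 < t \<Longrightarrow> t < d' \<Longrightarrow> h' 0 < h' (0 + t)"
    using DERIV_pos_inc_right[OF h2] by auto
  have "h' 0 = 0"
    using DERIV_local_max[OF h[of 0], of d] d mx by simp
  define t where "t = min d d' / 2"
  have t: "0 < t" "t < d" "t < d'" using d d'(1) by (auto simp: t_def)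
  have "\<exists>z>0. z < t \<and> h t - h 0 = (t - 0) * h' z"
    by (rule MVT2[OF t(1)]) (use t in \<open>auto intro!: h\<close>)
  then obtain z where z: "0 < z" "z < t" "h t - h 0 = t * h' z" by auto
  have "0 < h' z" using d'(2)[of z] z t \<open>h' 0 = 0\<close> by simp
  then have "0 < h t - h 0" using z t by simp
  moreover have "h t \<le> h 0" using mx[of t] t by simp
  ultimately show False by simp
qed

lemma smooth_line_derivative:
  assumes "smooth f"
  shows "((\<lambda>t. f (x + t *\<^sub>R e)) has_real_derivative (grad f (x + t *\<^sub>R e) \<bullet> e)) (at t)"
proof -
  have "((\<lambda>t. x + t *\<^sub>R e) has_derivative (\<lambda>s. s *\<^sub>R e)) (at t)"
    by (auto intro!: derivative_eq_intros)
  from diff_chain_at[OF this smooth_has_derivative[OF assms]]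
  have "((\<lambda>t. f (x + t *\<^sub>R e)) has_derivative (\<lambda>s. grad f (x + t *\<^sub>R e) \<bullet> (s *\<^sub>R e))) (at t)"
    by (simp only: o_def)
  then show ?thesis
    unfolding has_field_derivative_def
    by (rule has_derivative_eq_rhs) (auto simp: mult.commute)
qed

definition laplacian :: "(real ^ 'n \<Rightarrow> real) \<Rightarrow> real ^ 'n \<Rightarrow> real" where
  "laplacian f x = (\<Sum>i\<in>UNIV. grad (\<lambda>y. grad f y $ i) x $ i)"

lemma smooth_directional: "smooth f \<Longrightarrow> smooth (\<lambda>x. grad f x \<bullet> e)"
  unfolding inner_vec_def by (auto intro!: smooth_sum smooth_mult smooth_partial smooth_const)

text \<open>Bernstein's method: the auxiliary function below is subharmonic on the ball, so its value at the
  centre is controlled by its values on the sphere, where the cut-off factor vanishes.\<close>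

lemma harmonic_gradient_estimate:
  fixes f :: "real ^ 'n \<Rightarrow> real"
  assumes f: "smooth f" and e: "norm e \<le> 1" and d: "0 < d"
    and lf: "\<And>x. x \<in> ball a d \<Longrightarrow> laplacian f x = 0"
    and lp: "\<And>x. x \<in> ball a d \<Longrightarrow> laplacian (\<lambda>x. grad f x \<bullet> e) x = 0"
    and N: "\<And>x. x \<in> cball a d \<Longrightarrow> \<bar>f x\<bar> \<le> N"
  shows "\<bar>grad f a \<bullet> e\<bar> \<le> (real CARD('n) + 4) * N / d"
proof -
  define n where "n = real CARD('n)"
  have n: "0 < n" by (simp add: n_def)
  define p where "p = (\<lambda>x. grad f x \<bullet> e)"
  have p: "smooth p" unfolding p_def using f by (rule smooth_directional)
  \<comment> \<open>Chosen so that 2 A = 24 d^2 + 4 n d^2, which exactly absorbs the two negative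
    terms left after summing over the coordinates.\<close>
  define A where "A = (12 + 2 * n) * d\<^sup>2"
  have N0: "0 \<le> N" using N[of a] d by simp
  have key: "d ^ 4 * (p a)\<^sup>2 \<le> A * N\<^sup>2 + \<epsilon> * d\<^sup>2" if \<epsilon>: "0 < \<epsilon>" for \<epsilon>
  proof -
    \<comment> \<open>The term with \<epsilon> makes v strictly subharmonic, which rules out an
      interior maximum; letting \<epsilon> tend to 0 removes it at the end.\<close>
    define v where "v = (\<lambda>x. (d\<^sup>2 - (x - a) \<bullet> (x - a))\<^sup>2 * (p x)\<^sup>2 + A * (f x)\<^sup>2 + \<epsilon> * ((x - a) \<bullet> (x - a)))"
    have "continuous_on (cball a d) v"
      unfolding v_def by (intro continuous_intros smooth_continuous f p)
    then obtain m where m: "m \<in> cball a d" "\<And>x. x \<in> cball a d \<Longrightarrow> v x \<le> v m"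
      using continuous_attains_sup[OF compact_cball, of a d v] d by auto
    have "dist a m = d"
    proof (rule ccontr)
      assume "dist a m \<noteq> d"
      with m(1) have mb: "m \<in> ball a d" by simp
      define b where "b = m - a"
      define c where "c = d\<^sup>2 - b \<bullet> b"
      have bd: "b \<bullet> b < d\<^sup>2"
      proof -
        have "(norm b)\<^sup>2 < d\<^sup>2"
          using mb by (intro power_strict_mono) (auto simp: b_def dist_norm norm_minus_commute)
        then show ?thesis by (simp add: power2_norm_eq_inner)
      qed
      define fi where "fi i = grad f m $ i" for i
      define pi where "pi i = grad p m $ i" for i
      define fii where "fii i = grad (\<lambda>y. grad f y $ i) m $ i" for i
      define pii where "pii i = grad (\<lambda>y. grad p y $ i) m $ i" for i
      have second: "8 * (b $ i)\<^sup>2 * (p m)\<^sup>2 - 4 * c * (p m)\<^sup>2 - 16 * c * (b $ i) * p m * pi i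
          + 2 * c\<^sup>2 * ((pi i)\<^sup>2 + p m * pii i) + 2 * A * ((fi i)\<^sup>2 + f m * fii i) + 2 * \<epsilon> \<le> 0" for i
      proof -
        let ?l = "\<lambda>t. m + t *\<^sub>R axis i (1::real)"
        let ?c = "\<lambda>t. d\<^sup>2 - (?l t - a) \<bullet> (?l t - a)"
        let ?h = "\<lambda>t. v (?l t)"
        let ?h' = "\<lambda>t. 2 * ?c t * (-2 * (b $ i + t)) * (p (?l t))\<^sup>2 + (?c t)\<^sup>2 * (2 * p (?l t) * (grad p (?l t) $ i))
            + A * (2 * f (?l t) * (grad f (?l t) $ i)) + \<epsilon> * (2 * (b $ i + t))"
        have line: "((\<lambda>t. g (?l t)) has_real_derivative (grad g (?l t) $ i)) (at t)" if "smooth g" for g t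
          using smooth_line_derivative[OF that, of m "axis i 1" t] by (simp add: inner_axis)
        have sq: "((\<lambda>t. (?l t - a) \<bullet> (?l t - a)) has_real_derivative 2 * (b $ i + t)) (at t)" for t
        proof -
          have "(\<lambda>t. (?l t - a) \<bullet> (?l t - a)) = (\<lambda>t. b \<bullet> b + 2 * t * (b $ i) + t\<^sup>2)"
            by (auto simp: b_def inner_simps inner_axis inner_axis' inner_axis_axis power2_eq_square algebra_simps
                inner_commute[of a m])
          then show ?thesis by (auto intro!: derivative_eq_intros)
        qed
        have "(?h has_real_derivative ?h' t) (at t)" for t
          unfolding v_def
          by (rule derivative_eq_intros line sq p f refl | simp)+
        moreover have "(?h' has_real_derivative
          (8 * (b $ i)\<^sup>2 * (p m)\<^sup>2 - 4 * c * (p m)\<^sup>2 - 16 * c * (b $ i) * p m * pi i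
          + 2 * c\<^sup>2 * ((pi i)\<^sup>2 + p m * pii i) + 2 * A * ((fi i)\<^sup>2 + f m * fii i) + 2 * \<epsilon>)) (at 0)"
          by (rule derivative_eq_intros line sq p f smooth_partial refl | simp)+
             (simp add: fi_def pi_def fii_def pii_def c_def b_def[symmetric] power2_eq_square algebra_simps)
        moreover have "?h t \<le> ?h 0" if "\<bar>t\<bar> < d - dist a m" for t
        proof -
          have "dist a (?l t) \<le> dist a m + dist m (?l t)" by (rule dist_triangle)
          also have "dist m (?l t) = \<bar>t\<bar>" by (simp add: dist_norm)
          finally show ?thesis using m(2)[of "?l t"] that by simp
        qed
        moreover have "0 < d - dist a m" using mb by simp
        ultimately show ?thesis by (rule_tac second_derivative_at_max[of "d - dist a m" ?h ?h'])
      qed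
      \<comment> \<open>Completing the square absorbs the cross term into the term with the square
        of \<open>pi i\<close>, at the cost of 32 times the square of \<open>(b $ i) * p m\<close>;
        hence the coefficient 8 - 32 = -24.\<close>
      have lower: "- 24 * (b $ i)\<^sup>2 * (p m)\<^sup>2 - 4 * d\<^sup>2 * (p m)\<^sup>2 + 2 * A * (fi i)\<^sup>2 + 2 * \<epsilon>
          + (2 * c\<^sup>2 * p m) * pii i + (2 * A * f m) * fii i \<le> 0" for i
      proof -
        have "0 \<le> 2 * (c * pi i - 4 * (b $ i) * p m)\<^sup>2" by simp
        then have "- 32 * (b $ i)\<^sup>2 * (p m)\<^sup>2 \<le> 2 * c\<^sup>2 * (pi i)\<^sup>2 - 16 * c * (b $ i) * p m * pi i"
          by (simp add: power2_eq_square algebra_simps)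
        moreover have "c * (p m)\<^sup>2 \<le> d\<^sup>2 * (p m)\<^sup>2"
          by (intro mult_right_mono) (auto simp: c_def)
        ultimately show ?thesis using second[of i] by (simp add: algebra_simps)
      qed
      have "(\<Sum>i\<in>UNIV. - 24 * (b $ i)\<^sup>2 * (p m)\<^sup>2 - 4 * d\<^sup>2 * (p m)\<^sup>2 + 2 * A * (fi i)\<^sup>2 + 2 * \<epsilon>
          + (2 * c\<^sup>2 * p m) * pii i + (2 * A * f m) * fii i) \<le> 0"
        by (intro sum_nonpos lower)
      moreover have "(\<Sum>i\<in>UNIV. - 24 * (b $ i)\<^sup>2 * (p m)\<^sup>2 - 4 * d\<^sup>2 * (p m)\<^sup>2 + 2 * A * (fi i)\<^sup>2 + 2 * \<epsilon>
          + (2 * c\<^sup>2 * p m) * pii i + (2 * A * f m) * fii i) =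
          - 24 * (\<Sum>i\<in>UNIV. (b $ i)\<^sup>2) * (p m)\<^sup>2 - 4 * n * d\<^sup>2 * (p m)\<^sup>2 + 2 * A * (\<Sum>i\<in>UNIV. (fi i)\<^sup>2) + 2 * n * \<epsilon>
          + (2 * c\<^sup>2 * p m) * (\<Sum>i\<in>UNIV. pii i) + (2 * A * f m) * (\<Sum>i\<in>UNIV. fii i)"
        by (simp add: sum.distrib sum_subtractf sum_distrib_left sum_distrib_right sum_negf n_def mult.assoc)
      moreover have "(\<Sum>i\<in>UNIV. pii i) = 0" "(\<Sum>i\<in>UNIV. fii i) = 0"
        using lf[OF mb] lp[OF mb] by (simp_all add: laplacian_def pii_def fii_def p_def)
      moreover have "(\<Sum>i\<in>UNIV. (b $ i)\<^sup>2) = b \<bullet> b"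
        by (simp add: inner_vec_def power2_eq_square)
      moreover have "(p m)\<^sup>2 \<le> (\<Sum>i\<in>UNIV. (fi i)\<^sup>2)"
      proof -
        have "\<bar>p m\<bar> \<le> norm (grad f m) * norm e" unfolding p_def by (rule Cauchy_Schwarz_ineq2)
        also have "\<dots> \<le> norm (grad f m)" using e by (intro mult_left_le) auto
        finally have "(p m)\<^sup>2 \<le> (norm (grad f m))\<^sup>2" by (metis abs_le_square_iff abs_norm_cancel)
        also have "\<dots> = (\<Sum>i\<in>UNIV. (fi i)\<^sup>2)"
          unfolding power2_norm_eq_inner inner_vec_def fi_def by (simp add: power2_eq_square)
        finally show ?thesis .
      qed
      then have "A * (p m)\<^sup>2 \<le> A * (\<Sum>i\<in>UNIV. (fi i)\<^sup>2)"
        using n by (intro mult_left_mono) (auto simp: A_def)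
      moreover have "(b \<bullet> b) * (p m)\<^sup>2 \<le> d\<^sup>2 * (p m)\<^sup>2"
        using bd by (intro mult_right_mono) auto
      moreover have "0 < n * \<epsilon>" using n \<epsilon> by simp
      ultimately show False by (simp add: A_def algebra_simps)
    qed
    then have cm: "(m - a) \<bullet> (m - a) = d\<^sup>2"
      by (simp add: dist_norm norm_minus_commute flip: power2_norm_eq_inner)
    have "d ^ 4 * (p a)\<^sup>2 \<le> v a"
      using n by (simp add: v_def A_def flip: power_mult)
    also have "\<dots> \<le> v m" using m(2)[of a] d by simp
    also have "\<dots> = A * (f m)\<^sup>2 + \<epsilon> * d\<^sup>2" by (simp add: v_def cm)
    also have "\<dots> \<le> A * N\<^sup>2 + \<epsilon> * d\<^sup>2"
      using N[OF m(1)] n N0 by (intro add_right_mono mult_left_mono) (auto simp: A_def abs_le_square_iff[symmetric])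
    finally show ?thesis .
  qed
  have "d ^ 4 * (p a)\<^sup>2 \<le> A * N\<^sup>2"
  proof (rule field_le_epsilon)
    fix \<epsilon> :: real assume "0 < \<epsilon>"
    with key[of "\<epsilon> / d\<^sup>2"] d show "d ^ 4 * (p a)\<^sup>2 \<le> A * N\<^sup>2 + \<epsilon>" by simp
  qed
  then have "d\<^sup>2 * (d\<^sup>2 * (p a)\<^sup>2) \<le> d\<^sup>2 * ((12 + 2 * n) * N\<^sup>2)"
    by (simp add: A_def power4_eq_xxxx power2_eq_square algebra_simps)
  then have "d\<^sup>2 * (p a)\<^sup>2 \<le> (12 + 2 * n) * N\<^sup>2"
    using d by (simp only: mult_le_cancel_left_pos[OF zero_less_power])
  \<comment> \<open>A perfect square above 12 + 2 n, so that the final constant is linear in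
    n.\<close>
  also have "\<dots> \<le> (n + 4)\<^sup>2 * N\<^sup>2"
    using n by (intro mult_right_mono) (auto simp: power2_eq_square algebra_simps)
  finally have "(d * p a)\<^sup>2 \<le> ((n + 4) * N)\<^sup>2" by (simp add: power_mult_distrib)
  then have "\<bar>d * p a\<bar> \<le> (n + 4) * N" using n N0 by (simp add: abs_le_square_iff[symmetric])
  then show ?thesis using d by (simp add: p_def n_def abs_mult field_simps)
qed

text \<open>Iterating the gradient estimate over k concentric balls bounds the k-th derivative along
  the line by (2 C k / R)^k M. The Taylor polynomial at z vanishes, and k^k / k! <= e^k turns the
  remainder into M q^k with q < 1. The reach depends only on R and the dimension, neither on s nor
  on the bound M. Harmonicity is assumed for every \<open>F k\<close>, which suits functions given
  as convolutions of one function with different kernels.\<close>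

lemma harmonic_vanishing_line:
  fixes F :: "nat \<Rightarrow> real ^ 'n \<Rightarrow> real"
  assumes sm: "\<And>k. smooth (F k)" and Suc: "\<And>k x. F (Suc k) x = grad (F k) x \<bullet> e"
    and e: "norm e = 1" and R: "0 < R" and s: "0 < s"
    and lap: "\<And>k x. x \<in> ball z R \<Longrightarrow> laplacian (F k) x = 0"
    and van: "\<And>x. x \<in> ball z s \<Longrightarrow> F 0 x = 0"
    and t: "0 \<le> t" "t < R / (2 * (real CARD('n) + 4) * exp 1)"
  shows "F 0 (z + t *\<^sub>R e) = 0"
proof -
  define C where "C = real CARD('n) + 4"
  have C: "4 < C" by (simp add: C_def)
  obtain M where M: "\<And>x. x \<in> cball z R \<Longrightarrow> \<bar>F 0 x\<bar> \<le> M"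
  proof -
    have "bounded (F 0 ` cball z R)"
      by (intro compact_imp_bounded compact_continuous_image smooth_continuous sm compact_cball)
    then obtain M where "\<forall>y\<in>F 0 ` cball z R. norm y \<le> M" unfolding bounded_iff by blast
    then show ?thesis using that[of M] by simp
  qed
  have M0: "0 \<le> M" using M[of z] R by simp
  have Fz: "F k x = 0" if "x \<in> ball z s" for k x
    using that
  proof (induction k arbitrary: x)
    case (Suc k)
    then have "grad (F k) x = grad (\<lambda>x. 0) x" by (intro grad_cong_open[of "ball z s"]) auto
    then show ?case by (simp add: assms(2))
  qed (rule van)
  define q where "q = 2 * C * exp 1 * t / R"
  have tR: "t * (2 * C * exp 1) < R"
    using t(2) pos_less_divide_eq[of "2 * C * exp 1" t R] C by (simp add: C_def)
  then have q: "0 \<le> q" "q < 1"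
    using t(1) R C by (auto simp: q_def mult_ac)
  have bound: "\<bar>F 0 (z + t *\<^sub>R e)\<bar> \<le> M * q ^ k" if k: "0 < k" for k
  proof -
    \<comment> \<open>k steps of this width use up R / 2, so the k-th bound still holds on the ball
      of radius R / 2, which contains the intermediate point of Taylor's formula.\<close>
    define \<delta> where "\<delta> = R / (2 * real k)"
    have \<delta>: "0 < \<delta>" using R k by (simp add: \<delta>_def)
    have iter: "\<bar>F j x\<bar> \<le> (C / \<delta>) ^ j * M" if "x \<in> cball z (R - real j * \<delta>)" for j x
      using that
    proof (induction j arbitrary: x)
      case 0
      then show ?case using M by simp
    next
      case (Suc j)
      have sub: "cball x \<delta> \<subseteq> cball z (R - real j * \<delta>)"
      proof
        fix y assume "y \<in> cball x \<delta>"
        with Suc.prems dist_triangle[of z y x] show "y \<in> cball z (R - real j * \<delta>)"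
          by (simp add: algebra_simps)
      qed
      have sub': "ball x \<delta> \<subseteq> ball z R"
      proof
        fix y assume "y \<in> ball x \<delta>"
        moreover have "0 \<le> real j * \<delta>" using \<delta> by simp
        then have "dist z x \<le> R - \<delta>" using Suc.prems by (simp add: algebra_simps)
        ultimately show "y \<in> ball z R" using dist_triangle[of z y x] by simp
      qed
      have "\<bar>grad (F j) x \<bullet> e\<bar> \<le> (real CARD('n) + 4) * ((C / \<delta>) ^ j * M) / \<delta>"
      proof (rule harmonic_gradient_estimate[OF sm _ \<delta>])
        show "laplacian (F j) y = 0" if "y \<in> ball x \<delta>" for y
          using lap sub' that by blast
        show "laplacian (\<lambda>x. grad (F j) x \<bullet> e) y = 0" if "y \<in> ball x \<delta>" for y
          using lap[of y "Suc j"] sub' that by (auto simp: assms(2)[abs_def])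
        show "\<bar>F j y\<bar> \<le> (C / \<delta>) ^ j * M" if "y \<in> cball x \<delta>" for y
          using Suc.IH sub that by blast
      qed (use e in simp)
      then show ?case by (simp add: assms(2) C_def field_simps)
    qed
    have "\<exists>u. \<bar>u\<bar> \<le> \<bar>t\<bar> \<and> F 0 (z + t *\<^sub>R e) =
        (\<Sum>m<k. F m (z + 0 *\<^sub>R e) / fact m * t ^ m) + F k (z + u *\<^sub>R e) / fact k * t ^ k"
    proof (rule Maclaurin_all_le[where diff = "\<lambda>m t. F m (z + t *\<^sub>R e)"])
      show "\<forall>m x. ((\<lambda>t. F m (z + t *\<^sub>R e)) has_real_derivative F (Suc m) (z + x *\<^sub>R e)) (at x)"
        unfolding assms(2) using smooth_line_derivative[OF sm] by blast
    qed simp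
    then obtain u where u: "\<bar>u\<bar> \<le> \<bar>t\<bar>" "F 0 (z + t *\<^sub>R e) =
        (\<Sum>m<k. F m (z + 0 *\<^sub>R e) / fact m * t ^ m) + F k (z + u *\<^sub>R e) / fact k * t ^ k"
      by blast
    have "(\<Sum>m<k. F m (z + 0 *\<^sub>R e) / fact m * t ^ m) = 0"
      using Fz[of z] s by simp
    then have "\<bar>F 0 (z + t *\<^sub>R e)\<bar> = \<bar>F k (z + u *\<^sub>R e)\<bar> / fact k * t ^ k"
      using u(2) t by (simp add: abs_mult)
    also have "\<dots> \<le> (C / \<delta>) ^ k * M / fact k * t ^ k"
    proof (intro mult_right_mono divide_right_mono iter)
      have "t \<le> R / 2"
      proof -
        have "1 \<le> C * exp 1" using C mult_mono[of 1 C 1 "exp 1"] by simp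
        then have "R \<le> R * (C * exp 1)" using R by simp
        with tR have "t * (2 * C * exp 1) \<le> (R / 2) * (2 * C * exp 1)" by (simp add: algebra_simps)
        then show ?thesis using C by (simp add: mult_le_cancel_right)
      qed
      then show "z + u *\<^sub>R e \<in> cball z (R - real k * \<delta>)"
        using u(1) t(1) k e by (simp add: dist_norm \<delta>_def)
    qed (use t in auto)
    also have "\<dots> = M * ((2 * C * t / R) ^ k * (real k ^ k / fact k))"
      using R k by (simp add: \<delta>_def power_divide power_mult_distrib field_simps)
    also have "\<dots> \<le> M * ((2 * C * t / R) ^ k * exp 1 ^ k)"
    proof (intro mult_left_mono M0)
      \<comment> \<open>Only the k-th term of the exponential series at the point k is kept.\<close>
      have "(\<Sum>n\<in>{k}. inverse (fact n) * real k ^ n) \<le> (\<Sum>n. inverse (fact n) * real k ^ n)"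
        by (intro sum_le_suminf summable_exp) auto
      then have "real k ^ k / fact k \<le> exp (real k)"
        by (simp add: exp_def divide_inverse mult.commute)
      then show "real k ^ k / fact k \<le> exp 1 ^ k"
        using exp_of_nat_mult[of k "1::real"] by simp
      show "0 \<le> (2 * C * t / R) ^ k" using C t R by simp
    qed
    also have "\<dots> = M * q ^ k" by (simp add: q_def power_mult_distrib power_divide field_simps)
    finally show ?thesis .
  qed
  have "(\<lambda>k. M * q ^ k) \<longlonglongrightarrow> M * 0"
    by (intro tendsto_mult tendsto_const LIMSEQ_realpow_zero q)
  moreover have "\<forall>\<^sub>F k in sequentially. \<bar>F 0 (z + t *\<^sub>R e)\<bar> \<le> M * q ^ k"
    using bound by (auto simp: eventually_sequentially intro!: exI[of _ 1])
  ultimately have "\<bar>F 0 (z + t *\<^sub>R e)\<bar> \<le> M * 0"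
    by (intro tendsto_lowerbound[of _ _ sequentially]) auto
  then show ?thesis by simp
qed

section \<open>Intersections of connected open sets covering the space\<close>

text \<open>Two logarithms of the same value differ by an integer multiple of 2 pi i, so the
  difference is a continuous function whose distinct values are at least 2 pi apart.\<close>

lemma exp_ratio_constant:
  fixes g \<psi> :: "'a::topological_space \<Rightarrow> complex"
  assumes S: "connected S" and g: "continuous_on S g" "continuous_on S \<psi>"
    and eq: "\<And>x. x \<in> S \<Longrightarrow> exp (g x) = exp (\<psi> x)"
  shows "(\<lambda>x. g x - \<psi> x) constant_on S"
proof (rule continuous_discrete_range_constant[OF S])
  show "continuous_on S (\<lambda>x. g x - \<psi> x)" using g by (intro continuous_intros)
  fix x assume x: "x \<in> S"
  have "2 * pi \<le> norm ((g y - \<psi> y) - (g x - \<psi> x))" if y: "y \<in> S" "g y - \<psi> y \<noteq> g x - \<psi> x" for y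
  proof -
    obtain m where m: "g y = \<psi> y + 2 * of_int m * pi * \<i>"
      using eq[OF y(1)] by (auto simp: exp_eq)
    obtain l where l: "g x = \<psi> x + 2 * of_int l * pi * \<i>"
      using eq[OF x] by (auto simp: exp_eq)
    have "(g y - \<psi> y) - (g x - \<psi> x) = complex_of_real (2 * pi * of_int (m - l)) * \<i>"
      by (simp add: m l algebra_simps)
    then have "norm ((g y - \<psi> y) - (g x - \<psi> x)) = \<bar>2 * pi * of_int (m - l)\<bar>"
      by (simp only: norm_mult norm_ii mult_1_right norm_of_real)
    then have "norm ((g y - \<psi> y) - (g x - \<psi> x)) = 2 * pi * of_int \<bar>m - l\<bar>"
      by (simp add: abs_mult del: of_int_diff)
    moreover have "m \<noteq> l" using y(2) m l by auto
    then have "1 \<le> \<bar>m - l\<bar>" by linarith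
    then have "2 * pi * 1 \<le> 2 * pi * of_int \<bar>m - l\<bar>"
      by (intro mult_left_mono) (auto simp del: of_int_abs)
    ultimately show ?thesis by simp
  qed
  then show "\<exists>e>0. \<forall>y. y \<in> S \<and> g y - \<psi> y \<noteq> g x - \<psi> x \<longrightarrow> e \<le> norm ((g y - \<psi> y) - (g x - \<psi> x))"
    by (intro exI[of _ "2 * pi"]) auto
qed

text \<open>A separation of the intersection would give a map to the circle, with different
  logarithms on the two sets, that has no global logarithm.\<close>

lemma connected_Int_of_open_cover:
  fixes A B :: "'a::euclidean_space set"
  assumes op: "open A" "open B" and con: "connected A" "connected B" and un: "A \<union> B = UNIV"
  shows "connected (A \<inter> B)"
proof (rule ccontr)
  assume "\<not> connected (A \<inter> B)"
  then obtain E1 E2 where E: "open E1" "open E2" "A \<inter> B \<subseteq> E1 \<union> E2" "E1 \<inter> E2 \<inter> (A \<inter> B) = {}"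
      "E1 \<inter> (A \<inter> B) \<noteq> {}" "E2 \<inter> (A \<inter> B) \<noteq> {}"
    unfolding connected_def by auto
  define V where "V = E1 \<inter> (A \<inter> B)"
  define W where "W = E2 \<inter> (A \<inter> B)"
  have VW: "open V" "open W" "V \<union> W = A \<inter> B" "V \<inter> W = {}" "V \<noteq> {}" "W \<noteq> {}"
    using E op by (auto simp: V_def W_def)
  obtain \<phi> :: "'a \<Rightarrow> real" where \<phi>: "continuous_on UNIV \<phi>" "\<And>x. \<phi> x \<in> closed_segment 0 1"
      "\<And>x. x \<in> - B \<Longrightarrow> \<phi> x = 0" "\<And>x. x \<in> - A \<Longrightarrow> \<phi> x = 1"
    using Urysohn[of "- B" "- A" "0::real" 1] op un by (metis closed_Compl Compl_Un double_compl inf_commute Compl_UNIV_eq)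
  have \<phi>01: "0 \<le> \<phi> x" "\<phi> x \<le> 1" for x
    using \<phi>(2)[of x] by (auto simp: closed_segment_eq_real_ivl)
  have \<phi>c: "isCont \<phi> x" for x
    using \<phi>(1) by (simp add: continuous_on_eq_continuous_at)
  \<comment> \<open>Two real arguments of one circle-valued map. The branches of a meet where \<phi>
    = 0, in particular off B, and those of b where \<phi> = 1, in particular off A; so a is
    continuous on A and b on B. They agree on V and differ by 2 pi on W.\<close>
  define a where "a x = (if x \<in> W then - pi * \<phi> x else pi * \<phi> x)" for x
  define b where "b x = (if x \<in> W then 2 * pi - pi * \<phi> x else pi * \<phi> x)" for x
  have ca: "continuous_on A a"
    unfolding continuous_on_eq_continuous_at[OF op(1)]
  proof
    fix x assume "x \<in> A"
    then consider "x \<in> W" | "x \<in> V" | "x \<in> - B" using VW by blast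
    then show "isCont a x"
    proof cases
      case 1
      then have "\<forall>\<^sub>F y in nhds x. a y = - pi * \<phi> y"
        by (rule eventually_mono[OF eventually_nhds_in_open[OF VW(2)]]) (auto simp: a_def)
      then show ?thesis by (subst isCont_cong) (auto intro!: continuous_intros \<phi>c)
    next
      case 2
      then have "\<forall>\<^sub>F y in nhds x. a y = pi * \<phi> y"
        by (rule eventually_mono[OF eventually_nhds_in_open[OF VW(1)]]) (use VW(4) in \<open>auto simp: a_def\<close>)
      then show ?thesis by (subst isCont_cong) (auto intro!: continuous_intros \<phi>c)
    next
      case 3
      have "\<phi> \<midarrow>x\<rightarrow> 0" using \<phi>c[of x] \<phi>(3)[OF 3] by (simp add: isCont_def)
      then have "(\<lambda>y. pi * \<phi> y) \<midarrow>x\<rightarrow> 0" by (auto intro!: tendsto_eq_intros)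
      then have "a \<midarrow>x\<rightarrow> 0"
        by (rule Lim_null_comparison[rotated]) (auto simp: a_def \<phi>01 intro!: always_eventually)
      then show ?thesis using \<phi>(3)[OF 3] by (simp add: isCont_def a_def)
    qed
  qed
  have cb: "continuous_on B b"
    unfolding continuous_on_eq_continuous_at[OF op(2)]
  proof
    fix x assume "x \<in> B"
    then consider "x \<in> W" | "x \<in> V" | "x \<in> - A" using VW by blast
    then show "isCont b x"
    proof cases
      case 1
      then have "\<forall>\<^sub>F y in nhds x. b y = 2 * pi - pi * \<phi> y"
        by (rule eventually_mono[OF eventually_nhds_in_open[OF VW(2)]]) (auto simp: b_def)
      then show ?thesis by (subst isCont_cong) (auto intro!: continuous_intros \<phi>c)
    next
      case 2
      then have "\<forall>\<^sub>F y in nhds x. b y = pi * \<phi> y"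
        by (rule eventually_mono[OF eventually_nhds_in_open[OF VW(1)]]) (use VW(4) in \<open>auto simp: b_def\<close>)
      then show ?thesis by (subst isCont_cong) (auto intro!: continuous_intros \<phi>c)
    next
      case 3
      have "\<phi> \<midarrow>x\<rightarrow> 1" using \<phi>c[of x] \<phi>(4)[OF 3] by (simp add: isCont_def)
      then have "(\<lambda>y. pi * (1 - \<phi> y)) \<midarrow>x\<rightarrow> 0" by (auto intro!: tendsto_eq_intros)
      then have "(\<lambda>y. b y - pi) \<midarrow>x\<rightarrow> 0"
      proof (rule Lim_null_comparison[rotated], intro always_eventually allI)
        fix y
        have "b y - pi = pi * (1 - \<phi> y) \<or> b y - pi = - (pi * (1 - \<phi> y))"
          by (auto simp: b_def algebra_simps)
        moreover have "0 \<le> pi * (1 - \<phi> y)" using \<phi>01[of y] by simp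
        ultimately show "norm (b y - pi) \<le> pi * (1 - \<phi> y)" by auto
      qed
      then have "b \<midarrow>x\<rightarrow> pi" by (simp add: LIM_zero_iff)
      moreover have "b x = pi" using \<phi>(4)[OF 3] by (simp add: b_def)
      ultimately show ?thesis by (simp add: isCont_def)
    qed
  qed
  define h where "h x = exp (\<i> * of_real (a x))" for x
  have hb: "h x = exp (\<i> * of_real (b x))" for x
  proof (cases "x \<in> W")
    case True
    then have "\<i> * of_real (b x) = \<i> * of_real (a x) + 2 * of_real pi * \<i>"
      by (simp add: a_def b_def algebra_simps)
    then show ?thesis by (simp add: h_def exp_add)
  qed (simp add: h_def a_def b_def)
  have "continuous_on A h" unfolding h_def by (intro continuous_intros ca)
  moreover have "continuous_on B h" unfolding hb by (intro continuous_intros cb)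
  ultimately have "continuous_on UNIV h"
    using continuous_on_open_Un[OF op, of h] un by simp
  moreover have "h x \<noteq> 0" for x by (simp add: h_def)
  \<comment> \<open>The whole space is contractible, so the map has a global logarithm. Comparing it
    with a on A and with b on B, at a point of V and a point of W, yields 2 pi = 0.\<close>
  ultimately obtain g where g: "continuous_on UNIV g" "\<And>x. h x = exp (g x)"
    using continuous_logarithm_on_contractible[of UNIV h] contractible_UNIV by (metis UNIV_I)
  have "(\<lambda>x. g x - \<i> * of_real (a x)) constant_on A"
  proof (rule exp_ratio_constant[OF con(1)])
    show "continuous_on A g" using g(1) continuous_on_subset by blast
    show "continuous_on A (\<lambda>x. \<i> * complex_of_real (a x))" by (intro continuous_intros ca)
    show "exp (g x) = exp (\<i> * complex_of_real (a x))" for x using g(2)[of x] by (simp add: h_def)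
  qed
  moreover have "(\<lambda>x. g x - \<i> * of_real (b x)) constant_on B"
  proof (rule exp_ratio_constant[OF con(2)])
    show "continuous_on B g" using g(1) continuous_on_subset by blast
    show "continuous_on B (\<lambda>x. \<i> * complex_of_real (b x))" by (intro continuous_intros cb)
    show "exp (g x) = exp (\<i> * complex_of_real (b x))" for x using g(2)[of x] by (simp add: hb)
  qed
  moreover obtain p q where "p \<in> V" "q \<in> W" using VW by blast
  moreover from this have "p \<in> A" "p \<in> B" "q \<in> A" "q \<in> B" "p \<notin> W" using VW by blast+
  ultimately have "g p - \<i> * of_real (a p) = g q - \<i> * of_real (a q)"
     "g p - \<i> * of_real (b p) = g q - \<i> * of_real (b q)"
    unfolding constant_on_def by metis+
  moreover have "a p = b p" "b q = a q + 2 * pi"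
    using \<open>p \<notin> W\<close> \<open>q \<in> W\<close> by (auto simp: a_def b_def)
  ultimately show False by (simp add: algebra_simps)
qed

section \<open>Weak gradients\<close>

text \<open>Young's inequality with a free weight t: the pairing of a fixed F with a small D is made
  small by choosing t for F and only afterwards D.\<close>

lemma L2_inner:
  fixes F D :: "'a \<Rightarrow> 'b::euclidean_space"
  assumes [measurable]: "F \<in> borel_measurable M" "D \<in> borel_measurable M"
    and "integrable M (\<lambda>x. (norm (F x))\<^sup>2)" "integrable M (\<lambda>x. (norm (D x))\<^sup>2)"
  shows "integrable M (\<lambda>x. F x \<bullet> D x)"
    and "0 < t \<Longrightarrow> \<bar>LINT x|M. F x \<bullet> D x\<bar> \<le> t * (LINT x|M. (norm (F x))\<^sup>2) + (LINT x|M. (norm (D x))\<^sup>2) / t"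
proof -
  have young: "\<bar>F x \<bullet> D x\<bar> \<le> t * (norm (F x))\<^sup>2 + (norm (D x))\<^sup>2 / t" if "0 < t" for x and t :: real
  proof -
    have "\<bar>F x \<bullet> D x\<bar> \<le> norm (F x) * norm (D x)" by (rule Cauchy_Schwarz_ineq2)
    also have "\<dots> = (sqrt t * norm (F x)) * (norm (D x) / sqrt t)" using that by simp
    also have "\<dots> \<le> (sqrt t * norm (F x))\<^sup>2 + (norm (D x) / sqrt t)\<^sup>2"
    proof -
      have le: "X * Y \<le> X\<^sup>2 + Y\<^sup>2" if "0 \<le> X" "0 \<le> Y" for X Y :: real
        using sum_squares_bound[of X Y] mult_nonneg_nonneg[OF that] by linarith
      show ?thesis by (rule le) (use that in auto)
    qed
    also have "\<dots> = t * (norm (F x))\<^sup>2 + (norm (D x))\<^sup>2 / t"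
      using that by (simp add: power_mult_distrib power_divide)
    finally show ?thesis .
  qed
  have I: "integrable M (\<lambda>x. t * (norm (F x))\<^sup>2 + (norm (D x))\<^sup>2 / t)" for t
    using assms by auto
  show J: "integrable M (\<lambda>x. F x \<bullet> D x)"
    by (rule Bochner_Integration.integrable_bound[OF I[of 1]]) (use young[of 1] in auto)
  show "\<bar>LINT x|M. F x \<bullet> D x\<bar> \<le> t * (LINT x|M. (norm (F x))\<^sup>2) + (LINT x|M. (norm (D x))\<^sup>2) / t" if "0 < t"
  proof -
    have "\<bar>LINT x|M. F x \<bullet> D x\<bar> \<le> (LINT x|M. t * (norm (F x))\<^sup>2 + (norm (D x))\<^sup>2 / t)"
    proof -
      have "norm (LINT x|M. F x \<bullet> D x) \<le> (LINT x|M. t * (norm (F x))\<^sup>2 + (norm (D x))\<^sup>2 / t)"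
        by (rule order_trans[OF integral_norm_bound integral_mono[OF Bochner_Integration.integrable_norm[OF J] I]])
           (use young[OF that] in simp)
      then show ?thesis by simp
    qed
    then show ?thesis using assms by simp
  qed
qed

text \<open>By Lindelof's theorem countably many of the neighbourhoods already cover U, so the
  exceptional null sets may be united.\<close>

lemma AE_local:
  fixes U :: "'a::euclidean_space set"
  assumes "\<And>x. x \<in> U \<Longrightarrow> \<exists>V. open V \<and> x \<in> V \<and> (AE y in lborel. y \<in> V \<longrightarrow> P y)"
  shows "AE y in lborel. y \<in> U \<longrightarrow> P y"
proof -
  define \<F> where "\<F> = {V. open V \<and> (AE y in lborel. y \<in> V \<longrightarrow> P y)}"
  obtain \<F>' where \<F>': "\<F>' \<subseteq> \<F>" "countable \<F>'" "\<Union>\<F>' = \<Union>\<F>"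
    using Lindelof[of \<F>] by (auto simp: \<F>_def)
  have "AE y in lborel. \<forall>V\<in>\<F>'. y \<in> V \<longrightarrow> P y"
    using \<F>' by (subst AE_ball_countable) (auto simp: \<F>_def)
  then show ?thesis
  proof eventually_elim
    case (elim y)
    have "U \<subseteq> \<Union>\<F>" using assms unfolding \<F>_def by blast
    show ?case
    proof
      assume "y \<in> U"
      then have "y \<in> \<Union>\<F>'" using \<open>U \<subseteq> \<Union>\<F>\<close> \<F>'(3) by auto
      then show "P y" using elim by auto
    qed
  qed
qed

text \<open>Where a mollification vanishes, |F|^2 is the squared mollification error, whose integral
  is as small as desired.\<close>

lemma AE_zero_if_mollified_zero:
  fixes F :: "real ^ 'n \<Rightarrow> 'b::{banach,second_countable_topology}"
  assumes F: "F \<in> borel_measurable borel" "integrable lborel (\<lambda>x. (norm (F x))\<^sup>2)" and "0 < d"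
    and S [measurable]: "S \<in> sets borel"
    and zero: "\<And>r \<rho> y. r \<le> d \<Longrightarrow> is_mollifier r \<rho> \<Longrightarrow> y \<in> S \<Longrightarrow> conv \<rho> F y = 0"
  shows "AE y in lborel. y \<in> S \<longrightarrow> F y = 0"
proof -
  note [measurable] = F(1)
  have I: "integrable lborel (\<lambda>x. indicator S x * (norm (F x))\<^sup>2)"
    by (rule Bochner_Integration.integrable_bound[OF F(2)]) (auto simp: indicator_def)
  have le: "(LBINT x. indicator S x * (norm (F x))\<^sup>2) \<le> e" if e: "0 < e" for e
  proof -
    obtain d' where d': "0 < d'"
      "\<And>r \<rho>. r \<le> d' \<Longrightarrow> is_mollifier r \<rho> \<Longrightarrow> integrable lborel (\<lambda>x. (norm (conv \<rho> F x - F x))\<^sup>2)"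
      "\<And>r \<rho>. r \<le> d' \<Longrightarrow> is_mollifier r \<rho> \<Longrightarrow> (LBINT x. (norm (conv \<rho> F x - F x))\<^sup>2) \<le> e"
      by (rule mollify_L2[OF F e]) blast
    obtain \<rho> :: "real ^ 'n \<Rightarrow> real" where \<rho>: "is_mollifier (min d d') \<rho>"
      using mollifier_exists[of "min d d'"] \<open>0 < d\<close> d'(1) by auto
    have "indicator S x * (norm (F x))\<^sup>2 \<le> (norm (conv \<rho> F x - F x))\<^sup>2" for x
      using zero[OF _ \<rho>, of x] by (auto simp: indicator_def)
    then have "(LBINT x. indicator S x * (norm (F x))\<^sup>2) \<le> (LBINT x. (norm (conv \<rho> F x - F x))\<^sup>2)"
      using d'(2)[OF _ \<rho>] by (intro integral_mono I) auto
    also have "\<dots> \<le> e" using d'(3)[OF _ \<rho>] by simp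
    finally show ?thesis .
  qed
  have "(LBINT x. indicator S x * (norm (F x))\<^sup>2) \<le> 0"
    by (rule field_le_epsilon, unfold add_0, rule le)
  moreover have "0 \<le> (LBINT x. indicator S x * (norm (F x))\<^sup>2)" by simp
  ultimately have "(LBINT x. indicator S x * (norm (F x))\<^sup>2) = 0" by simp
  then have "AE x in lborel. indicator S x * (norm (F x))\<^sup>2 = 0"
    using I by (subst (asm) integral_nonneg_eq_0_iff_AE) auto
  then show ?thesis by eventually_elim (auto simp: indicator_def)
qed

text \<open>A mollification at y is the pairing with a reflected kernel, which is a test function on
  U once the ball that carries it lies in U.\<close>

lemma fundamental_lemma:
  fixes F :: "real ^ 'n \<Rightarrow> 'b::{banach,second_countable_topology}"
  assumes F: "F \<in> borel_measurable borel" "integrable lborel (\<lambda>x. (norm (F x))\<^sup>2)" and "open U"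
    and zero: "\<And>\<phi>. \<phi> \<in> test_functions U \<Longrightarrow> (LBINT x. \<phi> x *\<^sub>R F x) = 0"
  shows "AE x in lborel. x \<in> U \<longrightarrow> F x = 0"
proof (rule AE_local)
  fix x assume "x \<in> U"
  then obtain s where s: "0 < s" "ball x s \<subseteq> U" using \<open>open U\<close> openE by blast
  have "AE y in lborel. y \<in> ball x (s / 2) \<longrightarrow> F y = 0"
  proof (rule AE_zero_if_mollified_zero[OF F, of "s / 2"])
    fix r y and \<rho> :: "real ^ 'n \<Rightarrow> real" assume *: "r \<le> s / 2" "is_mollifier r \<rho>" "y \<in> ball x (s / 2)"
    have "ball y r \<subseteq> U"
    proof
      fix v assume "v \<in> ball y r"
      then have "dist x v < s" using *(1,3) dist_triangle[of x v y] by simp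
      then show "v \<in> U" using s by auto
    qed
    then show "conv \<rho> F y = 0"
      unfolding conv_def by (intro zero test_functions_reflect[OF is_mollifierD(1)[OF *(2)]])
  qed (use s in auto)
  then show "\<exists>V. open V \<and> x \<in> V \<and> (AE y in lborel. y \<in> V \<longrightarrow> F y = 0)"
    using s(1) by (intro exI[of _ "ball x (s / 2)"]) auto
qed

lemma loc_sq_const: "loc_sq (\<lambda>x::real ^ 'n. c::real)"
  unfolding loc_sq_def by (auto intro!: integrable_mult_left integrable_cball)

text \<open>The convolution of \<phi> with the constant 1 is constant, so its gradient, which is
  this integral up to a reflection, is 0.\<close>

lemma integral_grad_test:
  fixes \<phi> :: "real ^ 'n \<Rightarrow> real"
  assumes \<phi>: "\<phi> \<in> test_functions U"
  shows "(LBINT x. grad \<phi> x) = 0"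
proof -
  have "conv \<phi> (\<lambda>_. 1::real) = (\<lambda>x. integral\<^sup>L lborel \<phi>)"
    using integral_lborel_reflect[OF test_functions_borel(1)[OF \<phi>]] by (simp add: conv_def fun_eq_iff)
  then have "(LBINT y. 1 *\<^sub>R grad \<phi> (0 - y)) = 0"
    using conv_grad(1)[OF loc_sq_const[of 1] \<phi>, of 0] by simp
  moreover have "(LBINT y. grad \<phi> (0 - y)) = (LBINT y. grad \<phi> y)"
    by (rule integral_lborel_reflect[OF test_functions_borel(2)[OF \<phi>]])
  ultimately show ?thesis by simp
qed

text \<open>The gradient is an explicit argument, because the choice \<open>weak_grad\<close> is
  determined only up to null sets. Both functions are Borel on the whole space, so they can be
  convolved directly.\<close>

definition sob :: "(real ^ 'n \<Rightarrow> real) \<Rightarrow> (real ^ 'n \<Rightarrow> real ^ 'n) \<Rightarrow> bool" where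
  "sob w G \<longleftrightarrow> loc_sq w \<and> G \<in> borel_measurable borel \<and> integrable lborel (\<lambda>x. (norm (G x))\<^sup>2) \<and>
     (\<forall>\<phi>\<in>test_functions UNIV. (LBINT x. w x *\<^sub>R grad \<phi> x) = - (LBINT x. \<phi> x *\<^sub>R G x))"

definition weak_gradient_on :: "(real ^ 'n) set \<Rightarrow> (real ^ 'n \<Rightarrow> real) \<Rightarrow> (real ^ 'n \<Rightarrow> real ^ 'n) \<Rightarrow> bool" where
  "weak_gradient_on U u G \<longleftrightarrow> G \<in> L2_field U \<and> has_weak_gradient U u G"

lemma loc_sq_compact:
  assumes "loc_sq f" "compact K"
  shows "integrable lborel (\<lambda>x. indicator K x * (norm (f x))\<^sup>2)"
proof -
  have [measurable]: "f \<in> borel_measurable borel" "K \<in> sets borel"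
    using assms by (auto simp: loc_sq_def compact_imp_closed)
  obtain r where r: "K \<subseteq> cball 0 r"
  proof -
    obtain e where "\<forall>y\<in>K. dist 0 y \<le> e"
      using compact_imp_bounded[OF assms(2)] unfolding bounded_any_center[where a = 0] by blast
    then show ?thesis using that[of e] by (auto simp: subset_iff)
  qed
  have I: "integrable lborel (\<lambda>x. indicator (cball 0 r) x * (norm (f x))\<^sup>2)" using assms by (simp add: loc_sq_def)
  show ?thesis
    by (rule Bochner_Integration.integrable_bound[OF I]) (use r in \<open>auto simp: indicator_def subset_iff intro!: AE_I2\<close>)
qed

lemma L2_loc_UNIV_iff: "u \<in> L2_loc UNIV \<longleftrightarrow> loc_sq u"
proof
  assume "u \<in> L2_loc UNIV"
  then show "loc_sq u"
    by (auto simp: L2_loc_def loc_sq_def set_borel_measurable_def set_integrable_def)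
next
  assume u: "loc_sq u"
  then have "u \<in> borel_measurable borel" by (simp add: loc_sq_def)
  with loc_sq_compact[OF u] show "u \<in> L2_loc UNIV"
    by (auto simp: L2_loc_def set_borel_measurable_def set_integrable_def)
qed

lemma sob_iff: "sob w G \<longleftrightarrow> w \<in> L2_loc UNIV \<and> weak_gradient_on UNIV w G"
  unfolding sob_def weak_gradient_on_def L2_loc_UNIV_iff L2_field_def has_weak_gradient_def
  by (auto simp: set_borel_measurable_def set_integrable_def set_lebesgue_integral_def)

lemma sob_loc_sq: "sob w G \<Longrightarrow> loc_sq w"
  and sob_borel: "sob w G \<Longrightarrow> w \<in> borel_measurable borel" "sob w G \<Longrightarrow> G \<in> borel_measurable borel"
  and sob_L2: "sob w G \<Longrightarrow> integrable lborel (\<lambda>x. (norm (G x))\<^sup>2)"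
  by (auto simp: sob_def loc_sq_def)

text \<open>This identifies the arbitrary choice \<open>weak_grad\<close> with any gradient at hand,
  almost everywhere on U.\<close>

lemma weak_gradient_on_unique:
  assumes "open U" and G: "weak_gradient_on U u G" and H: "weak_gradient_on U u H"
  shows "AE x in lborel. x \<in> U \<longrightarrow> G x = H x"
proof -
  define F where "F x = indicator U x *\<^sub>R G x - indicator U x *\<^sub>R H x" for x
  have [measurable]: "(\<lambda>x. indicator U x *\<^sub>R G x) \<in> borel_measurable borel"
    "(\<lambda>x. indicator U x *\<^sub>R H x) \<in> borel_measurable borel" "U \<in> sets borel"
    using G H \<open>open U\<close> by (auto simp: weak_gradient_on_def L2_field_def set_borel_measurable_def)
  have [measurable]: "F \<in> borel_measurable borel" unfolding F_def by measurable
  have sq: "(\<lambda>x. (norm (indicator U x *\<^sub>R K x))\<^sup>2) = (\<lambda>x. indicator U x *\<^sub>R (norm (K x))\<^sup>2)" for K :: "real ^ 'a \<Rightarrow> real ^ 'a"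
    by (auto simp: indicator_def)
  have I: "integrable lborel (\<lambda>x. (norm (indicator U x *\<^sub>R G x))\<^sup>2)"
    "integrable lborel (\<lambda>x. (norm (indicator U x *\<^sub>R H x))\<^sup>2)"
    unfolding sq using G H by (auto simp: weak_gradient_on_def L2_field_def set_integrable_def)
  have L: "loc_sq (\<lambda>x. indicator U x *\<^sub>R G x)" "loc_sq (\<lambda>x. indicator U x *\<^sub>R H x)"
    using I by (auto intro!: loc_sqI)
  have "AE x in lborel. x \<in> U \<longrightarrow> F x = 0"
  proof (rule fundamental_lemma)
    show "integrable lborel (\<lambda>x. (norm (F x))\<^sup>2)" unfolding F_def by (intro L2_diff I) auto
    fix \<phi> assume \<phi>: "\<phi> \<in> test_functions U"
    have "(LBINT x. \<phi> x *\<^sub>R F x) =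
        (LBINT x. \<phi> x *\<^sub>R (indicator U x *\<^sub>R G x)) - (LBINT x. \<phi> x *\<^sub>R (indicator U x *\<^sub>R H x))"
      unfolding F_def scaleR_diff_right
      by (intro Bochner_Integration.integral_diff loc_sq_test_integrable[OF _ \<phi>] L)
    also have "\<dots> = 0"
      using G H \<phi> unfolding scaleR_left_commute[of "\<phi> _"]
      by (simp add: weak_gradient_on_def has_weak_gradient_def set_lebesgue_integral_def)
    finally show "(LBINT x. \<phi> x *\<^sub>R F x) = 0" .
  qed (use \<open>open U\<close> in auto)
  then show ?thesis by eventually_elim (auto simp: F_def)
qed

lemma weak_grad_spec:
  assumes "u \<in> Hdot1 U"
  shows "weak_gradient_on U u (weak_grad U u)"
proof -
  have "\<exists>G. G \<in> L2_field U \<and> has_weak_gradient U u G" using assms by (auto simp: Hdot1_def)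
  from someI_ex[OF this] show ?thesis by (simp add: weak_grad_def weak_gradient_on_def)
qed

lemma weak_grad_AE_eq:
  assumes "open U" "weak_gradient_on U u G"
  shows "AE x in lborel. x \<in> U \<longrightarrow> weak_grad U u x = G x"
proof -
  have "weak_gradient_on U u (weak_grad U u)"
    using someI[of "\<lambda>G. G \<in> L2_field U \<and> has_weak_gradient U u G" G] assms(2)
    by (simp add: weak_grad_def weak_gradient_on_def)
  then show ?thesis using weak_gradient_on_unique[OF assms(1) _ assms(2)] by blast
qed

lemma Hdot1_UNIV_sob: "w \<in> Hdot1 UNIV \<Longrightarrow> sob w (weak_grad UNIV w)"
  using weak_grad_spec[of w UNIV] by (simp add: sob_iff Hdot1_def)

lemma sob_Hdot1_UNIV: "sob w G \<Longrightarrow> w \<in> Hdot1 UNIV"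
  by (auto simp: sob_iff Hdot1_def weak_gradient_on_def)

text \<open>Test functions on U are test functions on the whole space, so the gradient of an
  extension of u serves on U. The values of u off U are arbitrary.\<close>

lemma sob_restrict:
  assumes w: "sob w G" and U: "open U" and u: "set_borel_measurable lborel U u"
    and eq: "AE x in lborel. x \<in> U \<longrightarrow> u x = w x"
  shows "weak_gradient_on U u G" "u \<in> Hdot1 U"
proof -
  note [measurable] = sob_borel[OF w]
  have U' [measurable]: "U \<in> sets borel" using U by simp
  have um [measurable]: "(\<lambda>x. indicator U x *\<^sub>R u x) \<in> borel_measurable borel"
    using u by (simp add: set_borel_measurable_def)
  have "G \<in> L2_field U"
    using Bochner_Integration.integrable_bound[OF sob_L2[OF w], of "\<lambda>x. indicator U x *\<^sub>R (norm (G x))\<^sup>2"]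
    by (auto simp: L2_field_def set_borel_measurable_def set_integrable_def indicator_def)
  moreover have "has_weak_gradient U u G"
    unfolding has_weak_gradient_def
  proof
    fix \<phi> assume \<phi>: "\<phi> \<in> test_functions U"
    note [measurable] = test_functions_borel[OF \<phi>]
    have "(LINT x:U|lborel. u x *\<^sub>R grad \<phi> x) = (LBINT x. (indicator U x *\<^sub>R u x) *\<^sub>R grad \<phi> x)"
      by (simp add: set_lebesgue_integral_def)
    also have "\<dots> = (LBINT x. w x *\<^sub>R grad \<phi> x)"
    proof (rule integral_cong_AE)
      show "AE x in lborel. (indicator U x *\<^sub>R u x) *\<^sub>R grad \<phi> x = w x *\<^sub>R grad \<phi> x"
        using eq by eventually_elim (use test_functions_outside[OF \<phi>] in \<open>auto simp: indicator_def\<close>)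
    qed measurable
    also have "\<dots> = - (LBINT x. \<phi> x *\<^sub>R G x)"
      using w test_functions_mono[OF subset_UNIV \<phi>] by (simp add: sob_def)
    also have "(LBINT x. \<phi> x *\<^sub>R G x) = (LINT x:U|lborel. \<phi> x *\<^sub>R G x)"
      unfolding set_lebesgue_integral_def
      by (rule Bochner_Integration.integral_cong) (use test_functions_outside[OF \<phi>] in \<open>auto simp: indicator_def\<close>)
    finally show "(LINT x:U|lborel. u x *\<^sub>R grad \<phi> x) = - (LINT x:U|lborel. \<phi> x *\<^sub>R G x)" .
  qed
  ultimately show 1: "weak_gradient_on U u G" by (simp add: weak_gradient_on_def)
  have "set_integrable lborel K (\<lambda>x. (u x)\<^sup>2)" if K: "compact K" "K \<subseteq> U" for K
    unfolding set_integrable_def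
  proof (rule Bochner_Integration.integrable_bound)
    have [measurable]: "K \<in> sets borel" using K by (simp add: compact_imp_closed)
    show "integrable lborel (\<lambda>x. indicator K x * (norm (w x))\<^sup>2)"
      by (rule loc_sq_compact[OF sob_loc_sq[OF w] K(1)])
    have eq': "(\<lambda>x. indicator K x *\<^sub>R (u x)\<^sup>2) = (\<lambda>x. indicator K x *\<^sub>R (indicator U x *\<^sub>R u x)\<^sup>2)"
      using K(2) by (intro ext) (auto split: split_indicator)
    show "(\<lambda>x. indicator K x *\<^sub>R (u x)\<^sup>2) \<in> borel_measurable lborel"
      unfolding eq' by measurable
    show "AE x in lborel. norm (indicator K x *\<^sub>R (u x)\<^sup>2) \<le> norm (indicator K x * (norm (w x))\<^sup>2)"
      using eq by eventually_elim (use K(2) in \<open>auto simp: indicator_def\<close>)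
  qed
  then have "u \<in> L2_loc U" using u by (simp add: L2_loc_def)
  with 1 show "u \<in> Hdot1 U" by (auto simp: Hdot1_def weak_gradient_on_def)
qed

lemma loc_sq_diff:
  fixes f g :: "real ^ 'n \<Rightarrow> real"
  assumes "loc_sq f" "loc_sq g"
  shows "loc_sq (\<lambda>x. f x - g x)"
  unfolding loc_sq_def
proof (intro conjI allI)
  have [measurable]: "f \<in> borel_measurable borel" "g \<in> borel_measurable borel"
    using assms by (auto simp: loc_sq_def)
  show "(\<lambda>x. f x - g x) \<in> borel_measurable borel" by measurable
  fix r
  have I: "integrable lborel (\<lambda>x. 2 * (indicator (cball 0 r) x * (norm (f x))\<^sup>2) + 2 * (indicator (cball 0 r) x * (norm (g x))\<^sup>2))"
    using assms by (auto simp: loc_sq_def)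
  show "integrable lborel (\<lambda>x. indicator (cball 0 r) x * (norm (f x - g x))\<^sup>2)"
    by (rule Bochner_Integration.integrable_bound[OF I])
       (use norm_sq_triangle[of "f _" "- g _"] in \<open>auto simp: indicator_def\<close>)
qed

lemma sob_shift:
  assumes "sob w G"
  shows "sob (\<lambda>x. w x - c) G"
  unfolding sob_def
proof (intro conjI ballI)
  show "loc_sq (\<lambda>x. w x - c)" by (intro loc_sq_diff loc_sq_const sob_loc_sq[OF assms])
  show "G \<in> borel_measurable borel" "integrable lborel (\<lambda>x. (norm (G x))\<^sup>2)"
    using assms by (auto simp: sob_def)
  fix \<phi> :: "real ^ 'a \<Rightarrow> real" assume \<phi>: "\<phi> \<in> test_functions UNIV"
  have "(LBINT x. (w x - c) *\<^sub>R grad \<phi> x) = (LBINT x. w x *\<^sub>R grad \<phi> x) - (LBINT x. c *\<^sub>R grad \<phi> x)"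
    unfolding scaleR_diff_left
    using test_functions_integrable(2)[OF \<phi>]
    by (intro Bochner_Integration.integral_diff loc_sq_grad_integrable[OF sob_loc_sq[OF assms] \<phi>]) simp
  then show "(LBINT x. (w x - c) *\<^sub>R grad \<phi> x) = - (LBINT x. \<phi> x *\<^sub>R G x)"
    using assms \<phi> integral_grad_test[OF \<phi>] by (simp add: sob_def)
qed

text \<open>w is only locally square integrable, so \<open>grad \<psi>\<close> has to vanish far
  away. The factor \<psi> itself may persist at infinity, which admits 1 - \<eta> besides a cut-off
  \<eta>.\<close>

lemma sob_mult:
  assumes w: "sob w G" and \<psi>: "smooth \<psi>" "\<And>x. \<bar>\<psi> x\<bar> \<le> B" "\<And>x. norm (grad \<psi> x) \<le> B"
      "\<And>x. r < norm x \<Longrightarrow> grad \<psi> x = 0"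
  shows "sob (\<lambda>x. \<psi> x * w x) (\<lambda>x. \<psi> x *\<^sub>R G x + w x *\<^sub>R grad \<psi> x)"
  unfolding sob_def
proof (intro conjI ballI)
  have [measurable]: "\<psi> \<in> borel_measurable borel" "grad \<psi> \<in> borel_measurable borel"
    using \<psi>(1) by (auto intro!: borel_measurable_continuous_onI smooth_continuous smooth_continuous_grad)
  note [measurable] = sob_borel[OF w]
  have B: "0 \<le> B" using \<psi>(2)[of 0] by linarith
  have sq: "(\<psi> x)\<^sup>2 \<le> B\<^sup>2" "(norm (grad \<psi> x))\<^sup>2 \<le> B\<^sup>2" for x
    using \<psi>(2,3)[of x] B by (auto simp: abs_le_square_iff[symmetric])
  show "loc_sq (\<lambda>x. \<psi> x * w x)"
    unfolding loc_sq_def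
  proof (intro conjI allI)
    fix R
    have I: "integrable lborel (\<lambda>x. B\<^sup>2 * (indicator (cball 0 R) x * (norm (w x))\<^sup>2))"
      using sob_loc_sq[OF w] by (simp add: loc_sq_def)
    show "integrable lborel (\<lambda>x. indicator (cball 0 R) x * (norm (\<psi> x * w x))\<^sup>2)"
      by (rule Bochner_Integration.integrable_bound[OF I])
         (use sq in \<open>auto simp: indicator_def power_mult_distrib intro!: mult_right_mono\<close>)
  qed measurable
  show "integrable lborel (\<lambda>x. (norm (\<psi> x *\<^sub>R G x + w x *\<^sub>R grad \<psi> x))\<^sup>2)"
  proof (rule L2_add)
    have I: "integrable lborel (\<lambda>x. B\<^sup>2 * (norm (G x))\<^sup>2)" using sob_L2[OF w] by simp
    show "integrable lborel (\<lambda>x. (norm (\<psi> x *\<^sub>R G x))\<^sup>2)"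
      by (rule Bochner_Integration.integrable_bound[OF I])
         (use sq in \<open>auto simp: power_mult_distrib intro!: mult_right_mono\<close>)
    have J: "integrable lborel (\<lambda>x. B\<^sup>2 * (indicator (cball 0 r) x * (norm (w x))\<^sup>2))"
      using sob_loc_sq[OF w] by (simp add: loc_sq_def)
    show "integrable lborel (\<lambda>x. (norm (w x *\<^sub>R grad \<psi> x))\<^sup>2)"
    proof (rule Bochner_Integration.integrable_bound[OF J])
      show "AE x in lborel. norm ((norm (w x *\<^sub>R grad \<psi> x))\<^sup>2) \<le> norm (B\<^sup>2 * (indicator (cball 0 r) x * (norm (w x))\<^sup>2))"
      proof (rule AE_I2)
        fix x
        show "norm ((norm (w x *\<^sub>R grad \<psi> x))\<^sup>2) \<le> norm (B\<^sup>2 * (indicator (cball 0 r) x * (norm (w x))\<^sup>2))"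
        proof (cases "norm x \<le> r")
          case True
          then show ?thesis using mult_right_mono[OF sq(2)[of x], of "(w x)\<^sup>2"]
            by (simp add: power_mult_distrib mult.commute)
        qed (use \<psi>(4)[of x] in simp)
      qed
    qed measurable
  qed measurable
  show "(\<lambda>x. \<psi> x *\<^sub>R G x + w x *\<^sub>R grad \<psi> x) \<in> borel_measurable borel" by measurable
  fix \<phi> :: "real ^ 'a \<Rightarrow> real" assume \<phi>: "\<phi> \<in> test_functions UNIV"
  have \<phi>\<psi>: "(\<lambda>x. \<phi> x * \<psi> x) \<in> test_functions UNIV" by (intro test_functions_mult \<phi> \<psi>(1))
  have dif: "\<phi> differentiable (at x)" "\<psi> differentiable (at x)" for x
    using test_functions_smooth[OF \<phi>] \<psi>(1) smooth_iff by blast+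
  \<comment> \<open>The product rule, solved for the term that occurs, so that the equation for w
    can be tested with the product of \<phi> and \<psi>.\<close>
  have gr: "\<psi> x *\<^sub>R grad \<phi> x = grad (\<lambda>x. \<phi> x * \<psi> x) x - \<phi> x *\<^sub>R grad \<psi> x" for x
    by (simp add: grad_mult[OF dif])
  have I1: "integrable lborel (\<lambda>x. w x *\<^sub>R grad (\<lambda>x. \<phi> x * \<psi> x) x)"
    by (rule loc_sq_grad_integrable[OF sob_loc_sq[OF w] \<phi>\<psi>])
  have I2: "integrable lborel (\<lambda>x. w x *\<^sub>R \<phi> x *\<^sub>R grad \<psi> x)"
  proof (rule Bochner_Integration.integrable_bound)
    note [measurable] = test_functions_borel[OF \<phi>]
    show "integrable lborel (\<lambda>x. B *\<^sub>R (\<phi> x *\<^sub>R w x))"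
      by (intro integrable_scaleR_right loc_sq_test_integrable[OF sob_loc_sq[OF w] \<phi>])
    show "(\<lambda>x. w x *\<^sub>R \<phi> x *\<^sub>R grad \<psi> x) \<in> borel_measurable lborel" by measurable
    show "AE x in lborel. norm (w x *\<^sub>R \<phi> x *\<^sub>R grad \<psi> x) \<le> norm (B *\<^sub>R (\<phi> x *\<^sub>R w x))"
    proof (rule AE_I2)
      fix x
      show "norm (w x *\<^sub>R \<phi> x *\<^sub>R grad \<psi> x) \<le> norm (B *\<^sub>R (\<phi> x *\<^sub>R w x))"
        using mult_left_mono[OF \<psi>(3)[of x], of "\<bar>w x\<bar> * \<bar>\<phi> x\<bar>"] B by (simp add: abs_mult mult_ac)
    qed
  qed
  have I3: "integrable lborel (\<lambda>x. (\<phi> x * \<psi> x) *\<^sub>R G x)"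
    by (intro loc_sq_test_integrable[OF loc_sqI[OF sob_borel(2)[OF w] sob_L2[OF w]] \<phi>\<psi>])
  have "(LBINT x. (\<psi> x * w x) *\<^sub>R grad \<phi> x) = (LBINT x. w x *\<^sub>R (\<psi> x *\<^sub>R grad \<phi> x))"
    by (simp add: mult.commute)
  also have "\<dots> = (LBINT x. w x *\<^sub>R grad (\<lambda>x. \<phi> x * \<psi> x) x) - (LBINT x. w x *\<^sub>R \<phi> x *\<^sub>R grad \<psi> x)"
    unfolding gr scaleR_diff_right by (rule Bochner_Integration.integral_diff[OF I1 I2])
  also have "(LBINT x. w x *\<^sub>R grad (\<lambda>x. \<phi> x * \<psi> x) x) = - (LBINT x. (\<phi> x * \<psi> x) *\<^sub>R G x)"
    using w \<phi>\<psi> by (simp add: sob_def)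
  also have "- (LBINT x. (\<phi> x * \<psi> x) *\<^sub>R G x) - (LBINT x. w x *\<^sub>R \<phi> x *\<^sub>R grad \<psi> x)
     = - (LBINT x. (\<phi> x * \<psi> x) *\<^sub>R G x + w x *\<^sub>R \<phi> x *\<^sub>R grad \<psi> x)"
    by (subst Bochner_Integration.integral_add[OF I3 I2]) simp
  finally show "(LBINT x. (\<psi> x * w x) *\<^sub>R grad \<phi> x) = - (LBINT x. \<phi> x *\<^sub>R (\<psi> x *\<^sub>R G x + w x *\<^sub>R grad \<psi> x))"
    by (simp add: scaleR_add_right mult.commute)
qed

section \<open>Mollified weak solutions\<close>

lemma conv_sob_grad:
  assumes w: "sob w G" and \<kappa>: "\<kappa> \<in> test_functions (ball 0 r)"
  shows "grad (conv \<kappa> w) x = conv \<kappa> G x"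
proof -
  have "(\<lambda>y. \<kappa> (x - y)) \<in> test_functions UNIV" by (rule test_functions_reflect[OF \<kappa>]) simp
  then have "(LBINT y. w y *\<^sub>R grad (\<lambda>y. \<kappa> (x - y)) y) = - (LBINT y. \<kappa> (x - y) *\<^sub>R G y)"
    using w by (simp add: sob_def)
  then show ?thesis
    by (simp add: conv_grad(1)[OF sob_loc_sq[OF w] \<kappa>] conv_def grad_reflect_test[OF \<kappa>])
qed

text \<open>One derivative is put on the kernel, the other turns w into G; summed over the
  coordinates, this is the weak equation tested with the reflected kernel. Since \<kappa> is any
  test function, derivatives of mollifiers are covered as well.\<close>

lemma conv_laplacian_zero:
  assumes w: "sob w G" and \<kappa>: "\<kappa> \<in> test_functions (ball 0 r)" and V: "ball x r \<subseteq> V"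
    and weak: "\<And>\<phi>. \<phi> \<in> test_functions V \<Longrightarrow> (LBINT x. G x \<bullet> grad \<phi> x) = 0"
  shows "laplacian (conv \<kappa> w) x = 0"
proof -
  let ?\<kappa> = "\<lambda>i z. grad \<kappa> z \<bullet> axis i 1"
  have \<kappa>i: "?\<kappa> i \<in> test_functions (ball 0 r)" for i by (rule test_functions_grad[OF \<kappa>])
  have 1: "(\<lambda>y. grad (conv \<kappa> w) y $ i) = conv (?\<kappa> i) w" for i
    using conv_grad(2)[OF sob_loc_sq[OF w] \<kappa>, of _ "axis i 1"] by (simp add: inner_axis)
  have LG: "loc_sq G" by (rule loc_sqI[OF sob_borel(2)[OF w] sob_L2[OF w]])
  have I: "integrable lborel (\<lambda>y. ?\<kappa> i (x - y) *\<^sub>R G y)" for i by (rule conv_integrable[OF LG \<kappa>i])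
  have Ii: "integrable lborel (\<lambda>y. (?\<kappa> i (x - y) *\<^sub>R G y) \<bullet> axis i 1)" for i
    by (rule integrable_inner_left) (rule I)
  have "laplacian (conv \<kappa> w) x = (\<Sum>i\<in>UNIV. conv (?\<kappa> i) G x \<bullet> axis i 1)"
    unfolding laplacian_def 1 conv_sob_grad[OF w \<kappa>i] by (simp add: inner_axis)
  also have "\<dots> = (\<Sum>i\<in>UNIV. (LBINT y. (?\<kappa> i (x - y) *\<^sub>R G y) \<bullet> axis i 1))"
    unfolding conv_def by (intro sum.cong refl integral_inner_left[symmetric]) (rule I)
  also have "\<dots> = (LBINT y. (\<Sum>i\<in>UNIV. (?\<kappa> i (x - y) *\<^sub>R G y) \<bullet> axis i 1))"
    by (rule Bochner_Integration.integral_sum[symmetric]) (rule Ii)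
  also have "\<dots> = (LBINT y. - (G y \<bullet> grad (\<lambda>y. \<kappa> (x - y)) y))"
    by (intro Bochner_Integration.integral_cong refl)
       (simp add: grad_reflect_test[OF \<kappa>] inner_axis inner_vec_def[of "G _" "grad \<kappa> _"] mult.commute)
  also have "\<dots> = 0"
    using weak[OF test_functions_reflect[OF \<kappa> V]] by simp
  finally show ?thesis .
qed

text \<open>The two integrands are built from \<theta> times the mollification error and from the
  gradient of this product: together, convergence in H^1. The cut-off is there because w is square
  integrable only locally.\<close>

lemma mollify_cutoff:
  fixes w :: "real ^ 'n \<Rightarrow> real"
  assumes w: "sob w G" and \<theta>: "\<theta> \<in> test_functions UNIV" and e: "0 < e"
  obtains d where "0 < d"
    "\<And>r \<rho>. r \<le> d \<Longrightarrow> is_mollifier r \<rho> \<Longrightarrow>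
       integrable lborel (\<lambda>x. (\<theta> x * (conv \<rho> w x - w x))\<^sup>2) \<and>
       (LBINT x. (\<theta> x * (conv \<rho> w x - w x))\<^sup>2) \<le> e \<and>
       integrable lborel (\<lambda>x. (norm (\<theta> x *\<^sub>R (conv \<rho> G x - G x) + (conv \<rho> w x - w x) *\<^sub>R grad \<theta> x))\<^sup>2) \<and>
       (LBINT x. (norm (\<theta> x *\<^sub>R (conv \<rho> G x - G x) + (conv \<rho> w x - w x) *\<^sub>R grad \<theta> x))\<^sup>2) \<le> e"
proof -
  obtain B where B: "0 \<le> B" "\<And>x. \<bar>\<theta> x\<bar> \<le> B" "\<And>x. norm (grad \<theta> x) \<le> B"
    using test_functions_bounded[OF \<theta>] by metis
  obtain R where R: "0 < R" "\<And>x. R < norm x \<Longrightarrow> \<theta> x = 0 \<and> grad \<theta> x = 0"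
    using test_functions_supp[OF \<theta>] by metis
  note [measurable] = sob_borel[OF w] test_functions_borel[OF \<theta>]
  have sq: "(\<theta> x)\<^sup>2 \<le> B\<^sup>2" "(norm (grad \<theta> x))\<^sup>2 \<le> B\<^sup>2" for x
    using B(2,3)[of x] B(1) by (auto simp: abs_le_square_iff[symmetric])
  \<comment> \<open>The gradient has two pieces, each contributing at most B^2 \<epsilon>, so their
    sum costs 4 B^2 \<epsilon>; the 1 covers B = 0.\<close>
  define \<epsilon> where "\<epsilon> = e / (4 * B\<^sup>2 + 1)"
  have den: "0 < 4 * B\<^sup>2 + 1" by (simp add: add_nonneg_pos)
  then have \<epsilon>: "0 < \<epsilon>" "(4 * B\<^sup>2 + 1) * \<epsilon> = e" using e by (simp_all add: \<epsilon>_def)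
  have B\<epsilon>: "B\<^sup>2 * \<epsilon> \<le> e" "4 * (B\<^sup>2 * \<epsilon>) \<le> e"
    using \<epsilon>(1) mult_nonneg_nonneg[of "B\<^sup>2" \<epsilon>] unfolding \<epsilon>(2)[symmetric] by (simp_all add: distrib_right)
  obtain d1 where d1: "0 < d1"
    "\<And>r \<rho>. r \<le> d1 \<Longrightarrow> is_mollifier r \<rho> \<Longrightarrow> integrable lborel (\<lambda>x. (norm (conv \<rho> G x - G x))\<^sup>2)"
    "\<And>r \<rho>. r \<le> d1 \<Longrightarrow> is_mollifier r \<rho> \<Longrightarrow> (LBINT x. (norm (conv \<rho> G x - G x))\<^sup>2) \<le> \<epsilon>"
    by (rule mollify_L2[OF sob_borel(2)[OF w] sob_L2[OF w] \<epsilon>(1)]) blast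
  obtain d2 where d2: "0 < d2"
    "\<And>r \<rho>. r \<le> d2 \<Longrightarrow> is_mollifier r \<rho> \<Longrightarrow> integrable lborel (\<lambda>x. indicator (cball 0 R) x * (norm (conv \<rho> w x - w x))\<^sup>2)"
    "\<And>r \<rho>. r \<le> d2 \<Longrightarrow> is_mollifier r \<rho> \<Longrightarrow> (LBINT x. indicator (cball 0 R) x * (norm (conv \<rho> w x - w x))\<^sup>2) \<le> \<epsilon>"
    by (rule mollify_loc[OF sob_loc_sq[OF w] \<epsilon>(1), of R]) blast
  show ?thesis
  proof (rule that[of "min d1 d2"])
    show "0 < min d1 d2" using d1 d2 by simp
    fix r and \<rho> :: "real ^ 'n \<Rightarrow> real" assume r: "r \<le> min d1 d2" and \<rho>: "is_mollifier r \<rho>"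
    have r12: "r \<le> d1" "r \<le> d2" using r by auto
    note [measurable] = test_functions_borel(1)[OF is_mollifierD(1)[OF \<rho>]]
    let ?D1 = "\<lambda>x. \<theta> x *\<^sub>R (conv \<rho> G x - G x)"
    let ?D2 = "\<lambda>x. (conv \<rho> w x - w x) *\<^sub>R grad \<theta> x"
    let ?D3 = "\<lambda>x. \<theta> x * (conv \<rho> w x - w x)"
    have le1: "(norm (?D1 x))\<^sup>2 \<le> B\<^sup>2 * (norm (conv \<rho> G x - G x))\<^sup>2" for x
      using sq(1)[of x] by (simp add: power_mult_distrib mult_right_mono)
    have le2: "(norm (?D2 x))\<^sup>2 \<le> B\<^sup>2 * (indicator (cball 0 R) x * (norm (conv \<rho> w x - w x))\<^sup>2)" for x
    proof (cases "norm x \<le> R")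
      case True
      then show ?thesis using mult_right_mono[OF sq(2)[of x], of "(conv \<rho> w x - w x)\<^sup>2"]
        by (simp add: power_mult_distrib mult.commute)
    qed (use R(2)[of x] in simp)
    have le3: "(?D3 x)\<^sup>2 \<le> B\<^sup>2 * (indicator (cball 0 R) x * (norm (conv \<rho> w x - w x))\<^sup>2)" for x
    proof (cases "norm x \<le> R")
      case True
      then show ?thesis using mult_right_mono[OF sq(1)[of x], of "(conv \<rho> w x - w x)\<^sup>2"]
        by (simp add: power_mult_distrib)
    qed (use R(2)[of x] in simp)
    have J1: "integrable lborel (\<lambda>x. B\<^sup>2 * (norm (conv \<rho> G x - G x))\<^sup>2)"
      using d1(2)[OF r12(1) \<rho>] by simp
    have J2: "integrable lborel (\<lambda>x. B\<^sup>2 * (indicator (cball 0 R) x * (norm (conv \<rho> w x - w x))\<^sup>2))"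
      using d2(2)[OF r12(2) \<rho>] by simp
    have I1: "integrable lborel (\<lambda>x. (norm (?D1 x))\<^sup>2)"
      by (rule Bochner_Integration.integrable_bound[OF J1]) (use le1 in auto)
    have I2: "integrable lborel (\<lambda>x. (norm (?D2 x))\<^sup>2)"
      by (rule Bochner_Integration.integrable_bound[OF J2]) (use le2 in auto)
    have I3: "integrable lborel (\<lambda>x. (?D3 x)\<^sup>2)"
      by (rule Bochner_Integration.integrable_bound[OF J2]) (use le3 in auto)
    have "(LBINT x. (norm (?D1 x))\<^sup>2) \<le> (LBINT x. B\<^sup>2 * (norm (conv \<rho> G x - G x))\<^sup>2)"
      by (intro integral_mono I1 J1 le1)
    also have "\<dots> \<le> B\<^sup>2 * \<epsilon>" using d1(3)[OF r12(1) \<rho>] by (simp add: mult_left_mono)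
    finally have b1: "(LBINT x. (norm (?D1 x))\<^sup>2) \<le> B\<^sup>2 * \<epsilon>" .
    have c: "(LBINT x. B\<^sup>2 * (indicator (cball 0 R) x * (norm (conv \<rho> w x - w x))\<^sup>2)) \<le> B\<^sup>2 * \<epsilon>"
      using d2(3)[OF r12(2) \<rho>] by (simp add: mult_left_mono)
    have b2: "(LBINT x. (norm (?D2 x))\<^sup>2) \<le> B\<^sup>2 * \<epsilon>"
      by (rule order_trans[OF integral_mono[OF I2 J2 le2] c])
    have b3: "(LBINT x. (?D3 x)\<^sup>2) \<le> B\<^sup>2 * \<epsilon>"
      by (rule order_trans[OF integral_mono[OF I3 J2 le3] c])
    have D: "integrable lborel (\<lambda>x. (norm (?D1 x + ?D2 x))\<^sup>2)"
      "(LBINT x. (norm (?D1 x + ?D2 x))\<^sup>2) \<le> 4 * (B\<^sup>2 * \<epsilon>)"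
      using L2_add[OF _ _ I1 I2] b1 b2 by auto
    show "integrable lborel (\<lambda>x. (?D3 x)\<^sup>2) \<and> (LBINT x. (?D3 x)\<^sup>2) \<le> e \<and>
       integrable lborel (\<lambda>x. (norm (?D1 x + ?D2 x))\<^sup>2) \<and> (LBINT x. (norm (?D1 x + ?D2 x))\<^sup>2) \<le> e"
      using I3 b3 D B\<epsilon> by auto
  qed
qed

text \<open>The product of \<eta> and w is a limit, in the norm of gradients, of the genuine test
  functions \<open>\<eta> x * conv \<rho> w x\<close>, and pairing with the square integrable F is
  continuous.\<close>

lemma test_extension:
  assumes w: "sob w G" and \<eta>: "\<eta> \<in> test_functions U"
    and F: "F \<in> borel_measurable borel" "integrable lborel (\<lambda>x. (norm (F x))\<^sup>2)"
    and weak: "\<And>\<phi>. \<phi> \<in> test_functions U \<Longrightarrow> (LBINT x. F x \<bullet> grad \<phi> x) = 0"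
  shows "(LBINT x. F x \<bullet> (\<eta> x *\<^sub>R G x + w x *\<^sub>R grad \<eta> x)) = 0"
proof -
  let ?H = "\<lambda>x. \<eta> x *\<^sub>R G x + w x *\<^sub>R grad \<eta> x"
  obtain B where B: "\<And>x. \<bar>\<eta> x\<bar> \<le> B" "\<And>x. norm (grad \<eta> x) \<le> B"
    using test_functions_bounded[OF \<eta>] by metis
  obtain R where R: "\<And>x. R < norm x \<Longrightarrow> \<eta> x = 0 \<and> grad \<eta> x = 0"
    using test_functions_supp[OF \<eta>] by metis
  note [measurable] = sob_borel[OF w] F(1) test_functions_borel[OF \<eta>]
  have H: "integrable lborel (\<lambda>x. (norm (?H x))\<^sup>2)"
    using sob_mult[OF w test_functions_smooth[OF \<eta>] B, of R] R by (simp add: sob_def)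
  define A where "A = (LBINT x. (norm (F x))\<^sup>2)"
  have A: "0 \<le> A" by (simp add: A_def)
  have le: "\<bar>LBINT x. F x \<bullet> ?H x\<bar> \<le> e" if e: "0 < e" for e
  proof -
    \<comment> \<open>This t makes the first term of the weighted Young inequality at most e / 2. A
      mollification error of t e / 2 then does the same for the second term.\<close>
    define t where "t = e / (2 * (A + 1))"
    have t: "0 < t" using e A by (simp add: t_def)
    then have te: "0 < t * e / 2" using e by simp
    obtain d where d: "0 < d" "\<And>r \<rho>. r \<le> d \<Longrightarrow> is_mollifier r \<rho> \<Longrightarrow>
       integrable lborel (\<lambda>x. (norm (\<eta> x *\<^sub>R (conv \<rho> G x - G x) + (conv \<rho> w x - w x) *\<^sub>R grad \<eta> x))\<^sup>2) \<and>
       (LBINT x. (norm (\<eta> x *\<^sub>R (conv \<rho> G x - G x) + (conv \<rho> w x - w x) *\<^sub>R grad \<eta> x))\<^sup>2) \<le> t * e / 2"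
      by (rule mollify_cutoff[OF w test_functions_mono[OF subset_UNIV \<eta>] te]) blast
    obtain \<rho> :: "real ^ 'a \<Rightarrow> real" where \<rho>: "is_mollifier d \<rho>"
      using mollifier_exists[OF d(1)] by blast
    note \<rho>t = is_mollifierD(1)[OF \<rho>]
    note [measurable] = test_functions_borel(1)[OF \<rho>t]
    define \<phi> where "\<phi> x = \<eta> x * conv \<rho> w x" for x
    have sm: "smooth (conv \<rho> w)" by (rule conv_smooth[OF sob_loc_sq[OF w] \<rho>t])
    have \<phi>: "\<phi> \<in> test_functions U" unfolding \<phi>_def by (rule test_functions_mult[OF \<eta> sm])
    have dif: "\<eta> differentiable (at x)" "conv \<rho> w differentiable (at x)" for x
      using test_functions_smooth[OF \<eta>] sm smooth_iff by blast+
    have g\<phi>: "grad \<phi> x = \<eta> x *\<^sub>R conv \<rho> G x + conv \<rho> w x *\<^sub>R grad \<eta> x" for x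
      unfolding \<phi>_def by (simp add: grad_mult[OF dif] conv_sob_grad[OF w \<rho>t])
    let ?D = "\<lambda>x. \<eta> x *\<^sub>R (conv \<rho> G x - G x) + (conv \<rho> w x - w x) *\<^sub>R grad \<eta> x"
    have D: "integrable lborel (\<lambda>x. (norm (?D x))\<^sup>2)" "(LBINT x. (norm (?D x))\<^sup>2) \<le> t * e / 2"
      using d(2)[OF order_refl \<rho>] by auto
    have DH: "grad \<phi> x - ?H x = ?D x" for x
      unfolding g\<phi> by (simp add: algebra_simps)
    have IF: "integrable lborel (\<lambda>x. F x \<bullet> ?H x)" by (rule L2_inner(1)[OF _ _ F(2) H]) auto
    have IFD: "integrable lborel (\<lambda>x. F x \<bullet> ?D x)" by (rule L2_inner(1)[OF _ _ F(2) D(1)]) auto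
    have "(LBINT x. F x \<bullet> grad \<phi> x) = (LBINT x. F x \<bullet> ?D x + F x \<bullet> ?H x)"
      by (simp only: inner_add_right[symmetric] DH[symmetric] diff_add_cancel)
    then have "(LBINT x. F x \<bullet> ?H x) = - (LBINT x. F x \<bullet> ?D x)"
      using weak[OF \<phi>] Bochner_Integration.integral_add[OF IFD IF] by simp
    then have "\<bar>LBINT x. F x \<bullet> ?H x\<bar> = \<bar>LBINT x. F x \<bullet> ?D x\<bar>" by simp
    also have "\<dots> \<le> t * A + (LBINT x. (norm (?D x))\<^sup>2) / t"
      unfolding A_def by (rule L2_inner(2)[OF _ _ F(2) D(1) t]) auto
    also have "\<dots> \<le> e / 2 + e / 2"
    proof (rule add_mono)
      show "t * A \<le> e / 2" using A e by (simp add: t_def divide_simps)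
      show "(LBINT x. (norm (?D x))\<^sup>2) / t \<le> e / 2"
        using D(2) t by (simp add: field_simps)
    qed
    finally show ?thesis by simp
  qed
  have "\<bar>LBINT x. F x \<bullet> ?H x\<bar> \<le> 0"
    by (rule field_le_epsilon, unfold add_0, rule le)
  then show ?thesis by simp
qed

section \<open>Unique continuation for weak solutions\<close>

lemma unique_continuation:
  fixes w :: "real ^ 'n \<Rightarrow> real"
  assumes w: "sob w G" and V: "open V" "connected V"
    and weak: "\<And>\<phi>. \<phi> \<in> test_functions V \<Longrightarrow> (LBINT x. G x \<bullet> grad \<phi> x) = 0"
    and O: "open O'" "O' \<noteq> {}" "O' \<subseteq> V" "AE x in lborel. x \<in> O' \<longrightarrow> G x = 0"
  shows "AE x in lborel. x \<in> V \<longrightarrow> G x = 0"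
proof -
  define c where "c = 1 / (2 * (real CARD('n) + 4) * exp 1)"
  have c: "0 < c" by (simp add: c_def)
  \<comment> \<open>Zeros spread from an arbitrarily small ball to one of radius c R, where c
    depends only on the dimension. A mollifier radius of at most s / 2 makes the mollified gradient
    vanish near z, and one of at most R lets the kernels fit into V.\<close>
  have step: "AE y in lborel. y \<in> ball z (c * R) \<longrightarrow> G y = 0"
    if R: "0 < R" "ball z (2 * R) \<subseteq> V" and s: "0 < s" "AE y in lborel. y \<in> ball z s \<longrightarrow> G y = 0" for z R s
  proof (rule AE_zero_if_mollified_zero[OF sob_borel(2)[OF w] sob_L2[OF w], of "min (s / 2) R"])
    fix r y and \<rho> :: "real ^ 'n \<Rightarrow> real" assume r: "r \<le> min (s / 2) R" and \<rho>: "is_mollifier r \<rho>" and y: "y \<in> ball z (c * R)"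
    note \<rho>t = is_mollifierD(1)[OF \<rho>]
    have near: "conv \<rho> G x = 0" if x: "x \<in> ball z (s / 2)" for x
    proof (rule conv_eq_0)
      show "\<rho> v = 0" if "r \<le> norm v" for v using is_mollifierD(4)[OF \<rho> that] .
      show "AE v in lborel. v \<in> ball x r \<longrightarrow> G v = 0"
        using s(2)
      proof eventually_elim
        case (elim v)
        have "v \<in> ball z s" if "v \<in> ball x r"
          using that x r dist_triangle[of z v x] by simp
        with elim show ?case by blast
      qed
    qed
    show "conv \<rho> G y = 0"
    proof (cases "y = z")
      case True
      then show ?thesis using near s(1) by simp
    next
      case False
      define e where "e = (1 / norm (y - z)) *\<^sub>R (y - z)"
      have ne: "norm e = 1" using False by (simp add: e_def)
      have "conv \<rho> G y $ i = 0" for i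
      proof -
        \<comment> \<open>Kernels for one component of the gradient and for its successive
          derivatives along e. Every function of the sequence is thus a convolution of w itself,
          hence harmonic on \<open>ball z R\<close>.\<close>
        define K where "K = rec_nat (\<lambda>v. grad \<rho> v \<bullet> axis i 1) (\<lambda>_ \<kappa> v. grad \<kappa> v \<bullet> e)"
        have K0: "K 0 = (\<lambda>v. grad \<rho> v \<bullet> axis i 1)" and KS: "K (Suc k) = (\<lambda>v. grad (K k) v \<bullet> e)" for k
          by (simp_all add: K_def)
        have Kt: "K k \<in> test_functions (ball 0 r)" for k
          by (induction k) (auto simp: K0 KS intro: test_functions_grad \<rho>t)
        define F where "F k = conv (K k) w" for k
        have F0: "F 0 x = conv \<rho> G x $ i" for x
          using conv_grad(2)[OF sob_loc_sq[OF w] \<rho>t, of x "axis i 1"] conv_sob_grad[OF w \<rho>t, of x]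
          by (simp add: F_def K0 inner_axis)
        have "F 0 (z + norm (y - z) *\<^sub>R e) = 0"
        proof (rule harmonic_vanishing_line[where R = R and s = "s / 2"])
          show "smooth (F k)" for k unfolding F_def by (rule conv_smooth[OF sob_loc_sq[OF w] Kt])
          show "F (Suc k) x = grad (F k) x \<bullet> e" for k x
            unfolding F_def KS by (rule conv_grad(2)[OF sob_loc_sq[OF w] Kt, symmetric])
          show "laplacian (F k) x = 0" if "x \<in> ball z R" for k x
            unfolding F_def
          proof (rule conv_laplacian_zero[OF w Kt _ weak])
            show "ball x r \<subseteq> V"
            proof
              fix v assume "v \<in> ball x r"
              then have "v \<in> ball z (2 * R)" using that r dist_triangle[of z v x] by simp
              then show "v \<in> V" using R(2) by blast
            qed
          qed
          show "F 0 x = 0" if "x \<in> ball z (s / 2)" for x using near[OF that] by (simp add: F0)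
          show "norm (y - z) < R / (2 * (real CARD('n) + 4) * exp 1)"
            using y by (simp add: c_def dist_norm norm_minus_commute)
        qed (use ne R s in auto)
        moreover have "z + norm (y - z) *\<^sub>R e = y" using False by (simp add: e_def)
        ultimately show ?thesis by (simp add: F0)
      qed
      then show ?thesis by (simp add: vec_eq_iff)
    qed
  qed (use s R in auto)
  define Z where "Z = {x. \<exists>r>0. AE y in lborel. y \<in> ball x r \<longrightarrow> G y = 0}"
  have open_in_Z: "W \<subseteq> Z" if "open W" "AE y in lborel. y \<in> W \<longrightarrow> G y = 0" for W
  proof
    fix x assume "x \<in> W"
    then obtain r where r: "0 < r" "ball x r \<subseteq> W" using \<open>open W\<close> openE by blast
    have "AE y in lborel. y \<in> ball x r \<longrightarrow> G y = 0"
      using that(2) by eventually_elim (use r in blast)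
    with r show "x \<in> Z" by (auto simp: Z_def)
  qed
  have "open Z"
    unfolding open_contains_ball
  proof
    fix x assume "x \<in> Z"
    then obtain r where "0 < r" "AE y in lborel. y \<in> ball x r \<longrightarrow> G y = 0" by (auto simp: Z_def)
    then show "\<exists>r>0. ball x r \<subseteq> Z" using open_in_Z[of "ball x r"] by auto
  qed
  \<comment> \<open>Zeros around a point of Z closer to x than c R would spread to x and put it into
    Z. So Z is closed relative to V, and connectedness gives all of V.\<close>
  moreover have "open (V - Z)"
    unfolding open_contains_ball
  proof
    fix x assume x: "x \<in> V - Z"
    then obtain r where r: "0 < r" "ball x r \<subseteq> V" using V(1) openE by blast
    \<comment> \<open>For z within R of x, the ball of radius 2 R about z stays inside the ball of
      radius 4 R = r about x.\<close>
    define R where "R = r / 4"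
    have "z \<notin> Z" if z: "z \<in> ball x (min (c * R) R)" for z
    proof
      assume "z \<in> Z"
      then obtain s where s: "0 < s" "AE y in lborel. y \<in> ball z s \<longrightarrow> G y = 0" by (auto simp: Z_def)
      have "ball z (2 * R) \<subseteq> V"
      proof
        fix v assume "v \<in> ball z (2 * R)"
        then have "v \<in> ball x r" using z r dist_triangle[of x v z] by (simp add: R_def)
        then show "v \<in> V" using r by blast
      qed
      then have "AE y in lborel. y \<in> ball z (c * R) \<longrightarrow> G y = 0"
        using r(1) by (intro step[OF _ _ s]) (auto simp: R_def)
      then have "ball z (c * R) \<subseteq> Z" by (intro open_in_Z) auto
      moreover have "x \<in> ball z (c * R)" using z by (simp add: dist_commute)
      ultimately show False using x by blast
    qed
    moreover have "z \<in> V" if "z \<in> ball x (min (c * R) R)" for z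
      using that r by (auto simp: R_def)
    ultimately show "\<exists>\<epsilon>>0. ball x \<epsilon> \<subseteq> V - Z"
      using c r(1) by (intro exI[of _ "min (c * R) R"]) (auto simp: R_def)
  qed
  moreover have "Z \<inter> V \<noteq> {}" using open_in_Z[OF O(1,4)] O(2,3) by blast
  ultimately have "V \<subseteq> Z" using connectedD[OF V(2), of Z "V - Z"] by blast
  show ?thesis
  proof (rule AE_local)
    fix x assume "x \<in> V"
    with \<open>V \<subseteq> Z\<close> obtain r where "0 < r" "AE y in lborel. y \<in> ball x r \<longrightarrow> G y = 0" by (auto simp: Z_def)
    then show "\<exists>W. open W \<and> x \<in> W \<and> (AE y in lborel. y \<in> W \<longrightarrow> G y = 0)"
      by (intro exI[of _ "ball x r"]) auto
  qed
qed

section \<open>Series in the Sobolev space and capacity\<close>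

text \<open>Obtained from the Leibniz rule with the constant 1 in place of w; 0 is a weak gradient
  of it because gradients of test functions have integral 0.\<close>

lemma test_functions_sob:
  assumes \<psi>: "\<psi> \<in> test_functions UNIV"
  shows "sob \<psi> (grad \<psi>)" "integrable lborel (\<lambda>x. (\<psi> x)\<^sup>2)"
proof -
  have one: "sob (\<lambda>x::real ^ 'a. 1) (\<lambda>_. 0)"
    unfolding sob_def
    by (auto simp: loc_sq_const integral_grad_test)
  obtain B where B: "0 \<le> B" "\<And>x. \<bar>\<psi> x\<bar> \<le> B" "\<And>x. norm (grad \<psi> x) \<le> B"
    using test_functions_bounded[OF \<psi>] by metis
  obtain r where r: "0 < r" "\<And>x. r < norm x \<Longrightarrow> \<psi> x = 0 \<and> grad \<psi> x = 0"
    using test_functions_supp[OF \<psi>] by metis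
  show "sob \<psi> (grad \<psi>)"
    using sob_mult[OF one test_functions_smooth[OF \<psi>] B(2,3), of r] r(2) by simp
  have "integrable lborel (\<lambda>x. \<psi> x * \<psi> x)"
    using test_functions_integrable(1)[OF test_functions_mult[OF \<psi> test_functions_smooth[OF \<psi>]]] .
  then show "integrable lborel (\<lambda>x. (\<psi> x)\<^sup>2)" by (simp add: power2_eq_square)
qed

section \<open>A smooth substitute for the absolute value\<close>

lemma smooth_powr:
  assumes h: "smooth h" and s: "0 < s"
  shows "smooth (\<lambda>x. (h x * h x + s) powr a)"
    and "grad (\<lambda>x. (h x * h x + s) powr a) x = (2 * a * (h x * h x + s) powr (a - 1) * h x) *\<^sub>R grad h x"
proof -
  have pos: "0 < h x * h x + s" for x using s by (simp add: add_nonneg_pos)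
  have D: "((\<lambda>x. (h x * h x + s) powr a) has_derivative
      (\<lambda>v. ((2 * a * (h x * h x + s) powr (a - 1) * h x) *\<^sub>R grad h x) \<bullet> v)) (at x)" for a x
  proof -
    have "((\<lambda>x. h x * h x + s) has_derivative (\<lambda>v. 2 * h x * (grad h x \<bullet> v))) (at x)"
      by (auto intro!: derivative_eq_intros smooth_has_derivative[OF h])
    from DERIV_compose_FDERIV[OF has_real_derivative_powr[OF pos] this, of a]
    show ?thesis by (rule has_derivative_eq_rhs) (auto simp: algebra_simps)
  qed
  note G = grad_eqI[OF D]
  show "grad (\<lambda>x. (h x * h x + s) powr a) x = (2 * a * (h x * h x + s) powr (a - 1) * h x) *\<^sub>R grad h x"
    by (rule G)
  have dif: "(\<lambda>x. (h x * h x + s) powr a) differentiable (at x)" for a x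
    unfolding differentiable_def by (intro exI) (rule D)
  \<comment> \<open>The exponent is general because each derivative lowers it by 1.\<close>
  have "C_k k (\<lambda>x. (h x * h x + s) powr a)" for k a
  proof (induction k arbitrary: a)
    case 0
    then show ?case
      using dif by (auto intro!: differentiable_imp_continuous_on simp: differentiable_on_def)
  next
    case (Suc k)
    have hk: "C_k k h" "\<And>i. C_k k (\<lambda>x. grad h x $ i)"
      using h smooth_partial[OF h] by (auto simp: smooth_def)
    have "C_k k (\<lambda>x. 2 * a * (h x * h x + s) powr (a - 1) * h x * grad h x $ i)" for i
      by (intro C_k_mult C_k_const Suc.IH hk)
    then show ?case using dif by (simp add: G)
  qed
  then show "smooth (\<lambda>x. (h x * h x + s) powr a)" by (simp add: smooth_def)
qed

text \<open>This is sqrt(h^2 + s^2) - s: subtracting s keeps the zeros of h, hence the compact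
  support. The root is written as a power to stay in the family whose smoothness is known.\<close>

definition smooth_abs :: "real \<Rightarrow> (real ^ 'n \<Rightarrow> real) \<Rightarrow> real ^ 'n \<Rightarrow> real" where
  "smooth_abs s h x = (h x * h x + s\<^sup>2) powr (1 / 2) - s"

lemma smooth_abs:
  assumes h: "h \<in> test_functions UNIV" and s: "0 < s"
  shows "smooth_abs s h \<in> test_functions UNIV"
    and "0 \<le> smooth_abs s h x" and "smooth_abs s h x \<le> \<bar>h x\<bar>"
    and "norm (grad (smooth_abs s h) x) \<le> norm (grad h x)"
    and "2 * s < \<bar>h x\<bar> \<Longrightarrow> s \<le> smooth_abs s h x"
proof -
  have s2: "0 < s\<^sup>2" using s by simp
  have eq: "smooth_abs s h x = sqrt ((h x)\<^sup>2 + s\<^sup>2) - s" for x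
    using s2 by (simp add: smooth_abs_def powr_half_sqrt power2_eq_square add_nonneg_pos)
  have sm: "smooth (\<lambda>x. (h x * h x + s\<^sup>2) powr (1 / 2))"
    by (rule smooth_powr(1)[OF test_functions_smooth[OF h] s2])
  obtain K where K: "compact K" "\<And>x. x \<notin> K \<Longrightarrow> h x = 0"
    using h by (rule test_functionsE) blast
  have "smooth (smooth_abs s h)"
    unfolding smooth_abs_def[abs_def] by (intro smooth_diff sm smooth_const)
  then show "smooth_abs s h \<in> test_functions UNIV"
    by (rule test_functionsI[OF _ K(1)]) (use K(2) s in \<open>auto simp: eq\<close>)
  have "sqrt (s\<^sup>2) \<le> sqrt ((h x)\<^sup>2 + s\<^sup>2)" by (rule real_sqrt_le_mono) simp
  then show "0 \<le> smooth_abs s h x" using s by (simp add: eq)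
  have "sqrt ((h x)\<^sup>2 + s\<^sup>2) \<le> \<bar>h x\<bar> + \<bar>s\<bar>" by (rule sqrt_sum_squares_le_sum_abs)
  then show "smooth_abs s h x \<le> \<bar>h x\<bar>" using s by (simp add: eq)
  have "grad (smooth_abs s h) x = grad (\<lambda>x. (h x * h x + s\<^sup>2) powr (1 / 2)) x"
  proof -
    have "(\<lambda>x. (h x * h x + s\<^sup>2) powr (1 / 2)) differentiable (at x)"
      using sm smooth_iff by blast
    then show ?thesis unfolding smooth_abs_def[abs_def] by (simp add: grad_diff)
  qed
  also have "\<dots> = ((h x * h x + s\<^sup>2) powr (- 1 / 2) * h x) *\<^sub>R grad h x"
    by (subst smooth_powr(2)[OF test_functions_smooth[OF h] s2]) simp
  finally have g: "grad (smooth_abs s h) x = ((h x * h x + s\<^sup>2) powr (- 1 / 2) * h x) *\<^sub>R grad h x" .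
  have "\<bar>(h x * h x + s\<^sup>2) powr (- 1 / 2) * h x\<bar> \<le> 1"
  proof -
    have p: "0 < h x * h x + s\<^sup>2" using s2 by (simp add: add_nonneg_pos)
    have "\<bar>h x\<bar> \<le> sqrt (h x * h x + s\<^sup>2)"
      by (rule real_le_rsqrt) (simp add: power2_eq_square)
    then have "(h x * h x + s\<^sup>2) powr (- 1 / 2) * \<bar>h x\<bar> \<le> (h x * h x + s\<^sup>2) powr (- 1 / 2) * (h x * h x + s\<^sup>2) powr (1 / 2)"
      using p by (intro mult_left_mono) (auto simp: powr_half_sqrt)
    also have "\<dots> = (h x * h x + s\<^sup>2) powr (- 1 / 2 + 1 / 2)" by (simp only: powr_add)
    also have "\<dots> = 1" using p by simp
    finally show ?thesis by (simp add: abs_mult)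
  qed
  then show "norm (grad (smooth_abs s h) x) \<le> norm (grad h x)"
    unfolding g using mult_right_mono[of _ 1 "norm (grad h x)"] by simp
  assume "2 * s < \<bar>h x\<bar>"
  then have "(2 * s)\<^sup>2 \<le> \<bar>h x\<bar>\<^sup>2" using s by (intro power_mono) auto
  then have "(2 * s)\<^sup>2 \<le> (h x)\<^sup>2" by simp
  then have "(2 * s)\<^sup>2 \<le> (h x)\<^sup>2 + s\<^sup>2" by (simp add: add_increasing2)
  then have "2 * s \<le> sqrt ((h x)\<^sup>2 + s\<^sup>2)" by (rule real_le_rsqrt)
  then show "s \<le> smooth_abs s h x" by (simp add: eq)
qed

section \<open>Series with geometric weights\<close>

lemma weighted_summable:
  fixes a :: "nat \<Rightarrow> real"
  assumes a: "\<And>i. 0 \<le> a i" and S: "summable (\<lambda>i. 2 ^ i * (a i)\<^sup>2)"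
  shows "summable a" and "(\<Sum>i. a i)\<^sup>2 \<le> 2 * (\<Sum>i. 2 ^ i * (a i)\<^sup>2)"
proof -
  have geo: "summable (\<lambda>i. (1 / 2 :: real) ^ i)" by (rule summable_geometric) simp
  have "a i \<le> (1 / 2) ^ i + 2 ^ i * (a i)\<^sup>2" for i
  proof -
    have "2 ^ i * a i \<le> 1 + (2 ^ i * a i)\<^sup>2" by (rule le_one_plus_square)
    then have "(1 / 2) ^ i * (2 ^ i * a i) \<le> (1 / 2) ^ i * (1 + (2 ^ i * a i)\<^sup>2)"
      by (intro mult_left_mono) auto
    then show ?thesis by (simp add: power2_eq_square distrib_left power_one_over field_simps)
  qed
  then show sa: "summable a"
    using a by (intro summable_comparison_test'[OF summable_add[OF geo S], of 0]) simp
  have "(\<Sum>i<n. a i)\<^sup>2 \<le> 2 * (\<Sum>i. 2 ^ i * (a i)\<^sup>2)" for n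
  proof -
    \<comment> \<open>Cauchy-Schwarz, with the i-th term split as 2^(-i/2) times 2^(i/2)
      \<open>a i\<close>; the weights 2^(-i) sum to at most 2.\<close>
    have "(\<Sum>i<n. a i) = (\<Sum>i<n. sqrt ((1 / 2) ^ i) * (sqrt (2 ^ i) * a i))"
      by (rule sum.cong) (auto simp flip: real_sqrt_mult power_mult_distrib mult.assoc)
    then have "(\<Sum>i<n. a i)\<^sup>2 \<le> (\<Sum>i<n. (sqrt ((1 / 2) ^ i))\<^sup>2) * (\<Sum>i<n. (sqrt (2 ^ i) * a i)\<^sup>2)"
      using Cauchy_Schwarz_ineq_sum[of "\<lambda>i. sqrt ((1 / 2) ^ i)" "\<lambda>i. sqrt (2 ^ i) * a i" "{..<n}"] by simp
    also have "\<dots> = (\<Sum>i<n. (1 / 2) ^ i) * (\<Sum>i<n. 2 ^ i * (a i)\<^sup>2)"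
      by (simp add: power_mult_distrib)
    also have "\<dots> \<le> 2 * (\<Sum>i. 2 ^ i * (a i)\<^sup>2)"
    proof (intro mult_mono sum_le_suminf S)
      have "(\<Sum>i<n. (1 / 2 :: real) ^ i) \<le> (\<Sum>i. (1 / 2) ^ i)" by (intro sum_le_suminf geo) auto
      then show "(\<Sum>i<n. (1 / 2 :: real) ^ i) \<le> 2" by (simp add: suminf_geometric)
    qed (auto intro: sum_nonneg)
    finally show ?thesis .
  qed
  moreover have "(\<lambda>n. (\<Sum>i<n. a i)\<^sup>2) \<longlonglongrightarrow> (\<Sum>i. a i)\<^sup>2"
    by (intro tendsto_power summable_LIMSEQ sa)
  ultimately show "(\<Sum>i. a i)\<^sup>2 \<le> 2 * (\<Sum>i. 2 ^ i * (a i)\<^sup>2)"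
    by (intro LIMSEQ_le_const2) auto
qed

lemma AE_summable:
  fixes g :: "nat \<Rightarrow> 'a \<Rightarrow> real"
  assumes g: "\<And>i. integrable M (g i)" "\<And>i x. 0 \<le> g i x" and S: "summable (\<lambda>i. integral\<^sup>L M (g i))"
  shows "AE x in M. summable (\<lambda>i. g i x)"
proof -
  have [measurable]: "g i \<in> borel_measurable M" for i using g by auto
  have "(\<integral>\<^sup>+x. (\<Sum>i. ennreal (g i x)) \<partial>M) = (\<Sum>i. (\<integral>\<^sup>+x. ennreal (g i x) \<partial>M))"
    by (rule nn_integral_suminf) simp
  also have "\<dots> = (\<Sum>i. ennreal (integral\<^sup>L M (g i)))"
    using g by (intro suminf_cong nn_integral_eq_integral) auto
  also have "\<dots> = ennreal (\<Sum>i. integral\<^sup>L M (g i))"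
    using g S by (intro suminf_ennreal2) auto
  finally have "(\<integral>\<^sup>+x. (\<Sum>i. ennreal (g i x)) \<partial>M) \<noteq> \<infinity>" by simp
  then have "AE x in M. (\<Sum>i. ennreal (g i x)) \<noteq> \<infinity>"
    by (intro nn_integral_PInf_AE) auto
  then show ?thesis
    by eventually_elim (use g in \<open>auto intro!: summable_suminf_not_top\<close>)
qed

text \<open>The pointwise weighted inequality, integrated term by term; this is the form in which
  norms of infinite sums are controlled in the capacity estimate.\<close>

lemma L2_series:
  fixes f :: "nat \<Rightarrow> 'a \<Rightarrow> 'b::{banach,second_countable_topology}"
  assumes [measurable]: "\<And>i. f i \<in> borel_measurable M"
    and f: "\<And>i. integrable M (\<lambda>x. (norm (f i x))\<^sup>2)"
    and S: "summable (\<lambda>i. 2 ^ i * (LINT x|M. (norm (f i x))\<^sup>2))"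
  shows "AE x in M. summable (\<lambda>i. norm (f i x))"
    and "integrable M (\<lambda>x. (norm (\<Sum>i. f i x))\<^sup>2)"
    and "(LINT x|M. (norm (\<Sum>i. f i x))\<^sup>2) \<le> 2 * (\<Sum>i. 2 ^ i * (LINT x|M. (norm (f i x))\<^sup>2))"
proof -
  let ?g = "\<lambda>i x. 2 ^ i * (norm (f i x))\<^sup>2"
  have g: "integrable M (?g i)" for i using f by simp
  have Sg: "summable (\<lambda>i. LINT x|M. ?g i x)" using S by simp
  have AEg: "AE x in M. summable (\<lambda>i. ?g i x)"
    by (rule AE_summable[OF g _ Sg]) simp
  then show AEf: "AE x in M. summable (\<lambda>i. norm (f i x))"
    by eventually_elim (rule weighted_summable(1); simp)
  have AEle: "AE x in M. (norm (\<Sum>i. f i x))\<^sup>2 \<le> 2 * (\<Sum>i. ?g i x)"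
    using AEg AEf
  proof eventually_elim
    case (elim x)
    have "(norm (\<Sum>i. f i x))\<^sup>2 \<le> (\<Sum>i. norm (f i x))\<^sup>2"
      by (intro power_mono summable_norm elim) auto
    also have "\<dots> \<le> 2 * (\<Sum>i. ?g i x)" by (intro weighted_summable(2) elim) auto
    finally show ?case .
  qed
  have Ig: "integrable M (\<lambda>x. 2 * (\<Sum>i. ?g i x))"
    using AEg Sg by (intro integrable_mult_right integrable_suminf g) auto
  show I: "integrable M (\<lambda>x. (norm (\<Sum>i. f i x))\<^sup>2)"
    by (rule Bochner_Integration.integrable_bound[OF Ig])
       (use AEle in \<open>auto elim!: eventually_mono\<close>)
  have "(LINT x|M. (norm (\<Sum>i. f i x))\<^sup>2) \<le> (LINT x|M. 2 * (\<Sum>i. ?g i x))"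
    by (intro integral_mono_AE I Ig AEle)
  also have "\<dots> = 2 * (\<Sum>i. (LINT x|M. ?g i x))"
    using AEg Sg by (subst integral_mult_right_zero, subst integral_suminf[OF g]) auto
  finally show "(LINT x|M. (norm (\<Sum>i. f i x))\<^sup>2) \<le> 2 * (\<Sum>i. 2 ^ i * (LINT x|M. (norm (f i x))\<^sup>2))" by simp
qed

text \<open>The bound a b <= 2^i a^2 + 2^(-i) b^2 has summable integrals, so sum and integral may be
  exchanged although b carries no decay in i.\<close>

lemma L2_series_pairing:
  fixes F :: "nat \<Rightarrow> 'a \<Rightarrow> 'b::{banach,second_countable_topology}" and a :: "nat \<Rightarrow> 'a \<Rightarrow> real"
  assumes [measurable]: "\<And>i. F i \<in> borel_measurable M" "\<And>i. a i \<in> borel_measurable M" "b \<in> borel_measurable M"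
    and a: "\<And>i x. 0 \<le> a i x" "\<And>i. integrable M (\<lambda>x. (a i x)\<^sup>2)"
    and S: "summable (\<lambda>i. 2 ^ i * (LINT x|M. (a i x)\<^sup>2))"
    and b: "\<And>x. 0 \<le> b x" "integrable M (\<lambda>x. (b x)\<^sup>2)"
    and F: "\<And>i x. norm (F i x) \<le> a i x * b x"
  shows "(\<lambda>i. integral\<^sup>L M (F i)) sums (LINT x|M. (\<Sum>i. F i x))"
proof -
  have geo: "summable (\<lambda>i. (1 / 2 :: real) ^ i)" by (rule summable_geometric) simp
  have bd: "norm (F i x) \<le> 2 ^ i * (a i x)\<^sup>2 + (1 / 2) ^ i * (b x)\<^sup>2" for i x
  proof -
    have le: "X * Y \<le> X\<^sup>2 + Y\<^sup>2" if "0 \<le> X" "0 \<le> Y" for X Y :: real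
      using sum_squares_bound[of X Y] mult_nonneg_nonneg[OF that] by linarith
    have "a i x * b x = (sqrt (2 ^ i) * a i x) * (sqrt ((1 / 2) ^ i) * b x)"
    proof -
      have "sqrt (2 ^ i) * sqrt ((1 / 2) ^ i) = (1::real)"
        by (simp flip: real_sqrt_mult power_mult_distrib)
      then show ?thesis by (simp add: mult_ac) 
    qed
    also have "\<dots> \<le> (sqrt (2 ^ i) * a i x)\<^sup>2 + (sqrt ((1 / 2) ^ i) * b x)\<^sup>2"
      using a b by (intro le) auto
    also have "\<dots> = 2 ^ i * (a i x)\<^sup>2 + (1 / 2) ^ i * (b x)\<^sup>2"
      by (simp add: power_mult_distrib)
    finally show ?thesis using F[of i x] by simp
  qed
  have Ib: "integrable M (\<lambda>x. 2 ^ i * (a i x)\<^sup>2 + (1 / 2) ^ i * (b x)\<^sup>2)" for i using a b by simp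
  have IF: "integrable M (F i)" for i
    by (rule Bochner_Integration.integrable_bound[OF Ib[of i]]) (use bd[of i] in \<open>auto intro!: AE_I2 order_trans[OF _ abs_ge_self]\<close>)
  have SF: "summable (\<lambda>i. LINT x|M. norm (F i x))"
  proof (rule summable_comparison_test'[of _ 0])
    show "summable (\<lambda>i. 2 ^ i * (LINT x|M. (a i x)\<^sup>2) + (1 / 2) ^ i * (LINT x|M. (b x)\<^sup>2))"
      by (intro summable_add S summable_mult2 geo)
    fix i
    have "(LINT x|M. norm (F i x)) \<le> (LINT x|M. 2 ^ i * (a i x)\<^sup>2 + (1 / 2) ^ i * (b x)\<^sup>2)"
      using IF by (intro integral_mono Ib bd) auto
    then show "norm (LINT x|M. norm (F i x)) \<le> 2 ^ i * (LINT x|M. (a i x)\<^sup>2) + (1 / 2) ^ i * (LINT x|M. (b x)\<^sup>2)"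
      using a b by simp
  qed
  have "AE x in M. summable (\<lambda>i. norm (F i x))"
    by (rule AE_summable[OF _ _ SF]) (use IF in auto)
  then show ?thesis by (rule sums_integral[OF IF _ SF])
qed

text \<open>Integration by parts holds for each term, and \<open>L2_series_pairing\<close> carries
  both of its sides over to the sum.\<close>

lemma sob_series:
  fixes u :: "nat \<Rightarrow> real ^ 'n \<Rightarrow> real"
  assumes u: "\<And>i. u i \<in> test_functions UNIV"
    and S: "summable (\<lambda>i. 2 ^ i * (LBINT x. (u i x)\<^sup>2))"
      "summable (\<lambda>i. 2 ^ i * (LBINT x. (norm (grad (u i) x))\<^sup>2))"
  shows "AE x in lborel. summable (\<lambda>i. u i x)"
    and "sob (\<lambda>x. \<Sum>i. u i x) (\<lambda>x. \<Sum>i. grad (u i) x)"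
    and "integrable lborel (\<lambda>x. (\<Sum>i. u i x)\<^sup>2)"
    and "(LBINT x. (\<Sum>i. u i x)\<^sup>2) \<le> 2 * (\<Sum>i. 2 ^ i * (LBINT x. (u i x)\<^sup>2))"
    and "(LBINT x. (norm (\<Sum>i. grad (u i) x))\<^sup>2) \<le> 2 * (\<Sum>i. 2 ^ i * (LBINT x. (norm (grad (u i) x))\<^sup>2))"
proof -
  note [measurable] = test_functions_borel[OF u]
  note us = test_functions_sob[OF u]
  have Iu: "integrable lborel (\<lambda>x. (norm (u i x))\<^sup>2)" for i using us(2) by simp
  have Ig: "integrable lborel (\<lambda>x. (norm (grad (u i) x))\<^sup>2)" for i using us(1) by (simp add: sob_def)
  have S1: "summable (\<lambda>i. 2 ^ i * (LBINT x. (norm (u i x))\<^sup>2))" using S(1) by simp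
  note Lu = L2_series[OF _ Iu S1, simplified]
  note Lg = L2_series[OF _ Ig S(2)]
  show AEu: "AE x in lborel. summable (\<lambda>i. u i x)"
    using L2_series(1)[OF _ Iu S1] by (auto elim!: eventually_mono intro: summable_norm_cancel)
  have AEg: "AE x in lborel. summable (\<lambda>i. grad (u i) x)"
    using Lg(1) by (auto elim!: eventually_mono intro: summable_norm_cancel)
  show Ih: "integrable lborel (\<lambda>x. (\<Sum>i. u i x)\<^sup>2)" using Lu(2) by simp
  show "(LBINT x. (\<Sum>i. u i x)\<^sup>2) \<le> 2 * (\<Sum>i. 2 ^ i * (LBINT x. (u i x)\<^sup>2))" using Lu(3) by simp
  show "(LBINT x. (norm (\<Sum>i. grad (u i) x))\<^sup>2) \<le> 2 * (\<Sum>i. 2 ^ i * (LBINT x. (norm (grad (u i) x))\<^sup>2))"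
    using Lg(3) by simp
  show "sob (\<lambda>x. \<Sum>i. u i x) (\<lambda>x. \<Sum>i. grad (u i) x)"
    unfolding sob_def
  proof (intro conjI ballI)
    show "loc_sq (\<lambda>x. \<Sum>i. u i x)" by (rule loc_sqI) (use Ih in auto)
    show "(\<lambda>x. \<Sum>i. grad (u i) x) \<in> borel_measurable borel" by measurable
    show "integrable lborel (\<lambda>x. (norm (\<Sum>i. grad (u i) x))\<^sup>2)" using Lg(2) by simp
    fix \<phi> :: "real ^ 'n \<Rightarrow> real" assume \<phi>: "\<phi> \<in> test_functions UNIV"
    note [measurable] = test_functions_borel[OF \<phi>]
    note \<phi>s = test_functions_sob[OF \<phi>]
    have 1: "(\<lambda>i. LBINT x. u i x *\<^sub>R grad \<phi> x) sums (LBINT x. (\<Sum>i. u i x *\<^sub>R grad \<phi> x))"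
      by (rule L2_series_pairing[where a = "\<lambda>i x. \<bar>u i x\<bar>" and b = "\<lambda>x. norm (grad \<phi> x)"])
         (use us(2) S(1) \<phi>s in \<open>auto simp: sob_def\<close>)
    have 2: "(\<lambda>i. LBINT x. \<phi> x *\<^sub>R grad (u i) x) sums (LBINT x. (\<Sum>i. \<phi> x *\<^sub>R grad (u i) x))"
      by (rule L2_series_pairing[where a = "\<lambda>i x. norm (grad (u i) x)" and b = "\<lambda>x. \<bar>\<phi> x\<bar>"])
         (use Ig S(2) \<phi>s in \<open>auto simp: mult.commute\<close>)
    have "(LBINT x. u i x *\<^sub>R grad \<phi> x) = - (LBINT x. \<phi> x *\<^sub>R grad (u i) x)" for i
      using us(1)[of i] \<phi> by (simp add: sob_def)
    then have "(LBINT x. (\<Sum>i. u i x *\<^sub>R grad \<phi> x)) = - (LBINT x. (\<Sum>i. \<phi> x *\<^sub>R grad (u i) x))"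
      using 1 sums_minus[OF 2] by (simp add: sums_unique2)
    moreover have "(LBINT x. (\<Sum>i. u i x *\<^sub>R grad \<phi> x)) = (LBINT x. (\<Sum>i. u i x) *\<^sub>R grad \<phi> x)"
    proof (rule integral_cong_AE)
      show "AE x in lborel. (\<Sum>i. u i x *\<^sub>R grad \<phi> x) = (\<Sum>i. u i x) *\<^sub>R grad \<phi> x"
        using AEu by eventually_elim (rule suminf_scaleR_left[symmetric])
    qed measurable
    moreover have "(LBINT x. (\<Sum>i. \<phi> x *\<^sub>R grad (u i) x)) = (LBINT x. \<phi> x *\<^sub>R (\<Sum>i. grad (u i) x))"
    proof (rule integral_cong_AE)
      show "AE x in lborel. (\<Sum>i. \<phi> x *\<^sub>R grad (u i) x) = \<phi> x *\<^sub>R (\<Sum>i. grad (u i) x)"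
        using AEg by eventually_elim (rule suminf_scaleR_right[symmetric])
    qed measurable
    ultimately show "(LBINT x. (\<Sum>i. u i x) *\<^sub>R grad \<phi> x) = - (LBINT x. \<phi> x *\<^sub>R (\<Sum>i. grad (u i) x))"
      by simp
  qed
qed

section \<open>Capacity of superlevel sets\<close>

lemma sob_inner:
  assumes "sob w G"
  shows "Hdot1_inner UNIV w w = (LBINT x. (norm (G x))\<^sup>2)"
proof -
  have G: "weak_gradient_on UNIV w G" using assms by (simp add: sob_iff)
  have "AE x in lborel. x \<in> UNIV \<longrightarrow> weak_grad UNIV w x = G x" by (rule weak_grad_AE_eq[OF _ G]) simp
  moreover have "weak_grad UNIV w \<in> borel_measurable borel"
    using Hdot1_UNIV_sob[OF sob_Hdot1_UNIV[OF assms]] by (rule sob_borel)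
  moreover have "G \<in> borel_measurable borel" using assms by (rule sob_borel)
  ultimately show ?thesis
    unfolding Hdot1_inner_def set_lebesgue_integral_def power2_norm_eq_inner
    by (intro integral_cong_AE) (auto elim!: eventually_mono)
qed

lemma cap_le:
  assumes "open U" and h: "sob h \<Gamma>" "integrable lborel (\<lambda>x. (h x)\<^sup>2)"
    and ge: "AE x in lborel. x \<in> U \<longrightarrow> 1 \<le> h x"
  shows "cap U \<le> ennreal ((LBINT x. (h x)\<^sup>2) + (LBINT x. (norm (\<Gamma> x))\<^sup>2))"
proof -
  have "cap U \<le> cap_open U" unfolding cap_def by (rule INF_lower) (use assms in auto)
  also have "\<dots> \<le> ennreal (H1_norm_sq h)"
    unfolding cap_open_def by (rule INF_lower) (use sob_Hdot1_UNIV[OF h(1)] h(2) ge in \<open>auto simp: H1_def\<close>)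
  finally show ?thesis by (simp add: H1_norm_sq_def sob_inner[OF h(1)])
qed

text \<open>Chebyshev's inequality and countable subadditivity in one competitor: the sum of all
  smoothed \<open>h i\<close>, each divided by \<open>s i\<close>. The terms are nonnegative, and on
  the i-th set the i-th term alone is at least 1. The factor 2 in the threshold pays for the
  subtraction of \<open>s i\<close> in \<open>smooth_abs\<close>.\<close>

lemma cap_Union_le:
  fixes h :: "nat \<Rightarrow> real ^ 'n \<Rightarrow> real"
  assumes h: "\<And>i. h i \<in> test_functions UNIV" and s: "\<And>i. 0 < s i"
    and S: "summable (\<lambda>i. 2 ^ i * ((LBINT x. (h i x)\<^sup>2) / (s i)\<^sup>2))"
      "summable (\<lambda>i. 2 ^ i * ((LBINT x. (norm (grad (h i) x))\<^sup>2) / (s i)\<^sup>2))"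
  shows "cap (\<Union>i. {x. 2 * s i < \<bar>h i x\<bar>}) \<le> ennreal (2 * (\<Sum>i. 2 ^ i * ((LBINT x. (h i x)\<^sup>2) / (s i)\<^sup>2))
      + 2 * (\<Sum>i. 2 ^ i * ((LBINT x. (norm (grad (h i) x))\<^sup>2) / (s i)\<^sup>2)))"
proof -
  define u where "u i x = smooth_abs (s i) (h i) x * (1 / s i)" for i x
  have ut: "u i \<in> test_functions UNIV" for i
    unfolding u_def by (intro test_functions_mult smooth_abs(1) h s smooth_const)
  have u0: "0 \<le> u i x" for i x using smooth_abs(2)[OF h s, of i i x] s[of i] by (simp add: u_def)
  have gu: "grad (u i) x = (1 / s i) *\<^sub>R grad (smooth_abs (s i) (h i)) x" for i x
  proof -
    have "smooth_abs (s i) (h i) differentiable (at x)"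
      using test_functions_smooth[OF smooth_abs(1)[OF h s]] smooth_iff by blast
    then show ?thesis unfolding u_def[abs_def] by (subst grad_mult) auto
  qed
  have u2: "(u i x)\<^sup>2 \<le> (h i x)\<^sup>2 / (s i)\<^sup>2" for i x
  proof -
    have "(smooth_abs (s i) (h i) x)\<^sup>2 \<le> (h i x)\<^sup>2"
      using smooth_abs(2,3)[OF h s, of i i x] by (simp add: abs_le_square_iff[symmetric])
    then show ?thesis using s[of i] by (simp add: u_def power_divide divide_right_mono)
  qed
  have g2: "(norm (grad (u i) x))\<^sup>2 \<le> (norm (grad (h i) x))\<^sup>2 / (s i)\<^sup>2" for i x
  proof -
    have "(norm (grad (smooth_abs (s i) (h i)) x))\<^sup>2 \<le> (norm (grad (h i) x))\<^sup>2"
      using smooth_abs(4)[OF h s, of i i x] by (intro power_mono) auto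
    then show ?thesis using s[of i] by (simp add: gu power_divide divide_right_mono)
  qed
  have Ih: "integrable lborel (\<lambda>x. (h i x)\<^sup>2)" "integrable lborel (\<lambda>x. (norm (grad (h i) x))\<^sup>2)"
    "integrable lborel (\<lambda>x. (u i x)\<^sup>2)" "integrable lborel (\<lambda>x. (norm (grad (u i) x))\<^sup>2)" for i
    using test_functions_sob[OF h] test_functions_sob[OF ut] by (auto simp: sob_def)
  have le1: "2 ^ i * (LBINT x. (u i x)\<^sup>2) \<le> 2 ^ i * ((LBINT x. (h i x)\<^sup>2) / (s i)\<^sup>2)" for i
  proof (rule mult_left_mono)
    have "(LBINT x. (u i x)\<^sup>2) \<le> (LBINT x. (h i x)\<^sup>2 / (s i)\<^sup>2)"
      using Ih by (intro integral_mono u2) auto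
    then show "(LBINT x. (u i x)\<^sup>2) \<le> (LBINT x. (h i x)\<^sup>2) / (s i)\<^sup>2" by simp
  qed simp
  have le2: "2 ^ i * (LBINT x. (norm (grad (u i) x))\<^sup>2) \<le> 2 ^ i * ((LBINT x. (norm (grad (h i) x))\<^sup>2) / (s i)\<^sup>2)" for i
  proof (rule mult_left_mono)
    have "(LBINT x. (norm (grad (u i) x))\<^sup>2) \<le> (LBINT x. (norm (grad (h i) x))\<^sup>2 / (s i)\<^sup>2)"
      using Ih by (intro integral_mono g2) auto
    then show "(LBINT x. (norm (grad (u i) x))\<^sup>2) \<le> (LBINT x. (norm (grad (h i) x))\<^sup>2) / (s i)\<^sup>2" by simp
  qed simp
  have Su: "summable (\<lambda>i. 2 ^ i * (LBINT x. (u i x)\<^sup>2))"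
    by (rule summable_comparison_test'[OF S(1), of 0]) (use le1 in simp)
  have Sg: "summable (\<lambda>i. 2 ^ i * (LBINT x. (norm (grad (u i) x))\<^sup>2))"
    by (rule summable_comparison_test'[OF S(2), of 0]) (use le2 in simp)
  note ser = sob_series[OF ut Su Sg]
  have "AE x in lborel. x \<in> (\<Union>i. {x. 2 * s i < \<bar>h i x\<bar>}) \<longrightarrow> 1 \<le> (\<Sum>i. u i x)"
    using ser(1)
  proof eventually_elim
    case (elim x)
    show ?case
    proof
      assume "x \<in> (\<Union>i. {x. 2 * s i < \<bar>h i x\<bar>})"
      then obtain i where "2 * s i < \<bar>h i x\<bar>" by auto
      then have "1 \<le> u i x" using smooth_abs(5)[OF h s, of i i x] s[of i] by (simp add: u_def field_simps)
      also have "u i x = (\<Sum>j\<in>{i}. u j x)" by simp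
      also have "\<dots> \<le> (\<Sum>i. u i x)" by (rule sum_le_suminf[OF elim]) (auto simp: u0)
      finally show "1 \<le> (\<Sum>i. u i x)" .
    qed
  qed
  moreover have "open (\<Union>i. {x. 2 * s i < \<bar>h i x\<bar>})"
    by (intro open_UN ballI open_Collect_less continuous_intros smooth_continuous test_functions_smooth[OF h])
  ultimately have "cap (\<Union>i. {x. 2 * s i < \<bar>h i x\<bar>}) \<le> ennreal ((LBINT x. (\<Sum>i. u i x)\<^sup>2) + (LBINT x. (norm (\<Sum>i. grad (u i) x))\<^sup>2))"
    by (intro cap_le ser)
  also have "\<dots> \<le> ennreal (2 * (\<Sum>i. 2 ^ i * ((LBINT x. (h i x)\<^sup>2) / (s i)\<^sup>2))
      + 2 * (\<Sum>i. 2 ^ i * ((LBINT x. (norm (grad (h i) x))\<^sup>2) / (s i)\<^sup>2)))"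
  proof (intro ennreal_leI add_mono)
    show "(LBINT x. (\<Sum>i. u i x)\<^sup>2) \<le> 2 * (\<Sum>i. 2 ^ i * ((LBINT x. (h i x)\<^sup>2) / (s i)\<^sup>2))"
      using ser(4) suminf_le[OF le1 Su S(1)] by simp
    show "(LBINT x. (norm (\<Sum>i. grad (u i) x))\<^sup>2) \<le> 2 * (\<Sum>i. 2 ^ i * ((LBINT x. (norm (grad (h i) x))\<^sup>2) / (s i)\<^sup>2))"
      using ser(5) suminf_le[OF le2 Sg S(2)] by simp
  qed
  finally show ?thesis .
qed


section \<open>Quasi continuous representatives\<close>

lemma cutoff_exists:
  "\<exists>\<theta>\<in>test_functions UNIV. \<forall>x::real ^ 'n. norm x \<le> r \<longrightarrow> \<theta> x = (1::real)"
proof -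
  obtain \<rho> :: "real ^ 'n \<Rightarrow> real" where \<rho>: "is_mollifier 1 \<rho>" using mollifier_exists[of 1] by auto
  note \<rho>D = is_mollifierD[OF \<rho>]
  \<comment> \<open>A kernel of radius 1 averages this indicator to 1 up to radius r and to 0 beyond
    r + 2.\<close>
  let ?i = "indicator (cball 0 (r + 1)) :: real ^ 'n \<Rightarrow> real"
  have L: "loc_sq ?i"
  proof (rule loc_sqI)
    have "(\<lambda>x. (norm (?i x))\<^sup>2) = ?i" by (auto simp: indicator_def)
    then show "integrable lborel (\<lambda>x. (norm (?i x))\<^sup>2)" using integrable_cball by simp
  qed simp
  show ?thesis
  proof (intro bexI[of _ "conv \<rho> ?i"] allI impI)
    fix x :: "real ^ 'n" assume x: "norm x \<le> r"
    have c: "\<rho> (x - y) *\<^sub>R ?i y = \<rho> (x - y)" for y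
    proof (cases "norm (x - y) < 1")
      case True
      then have "norm y \<le> r + 1" using x norm_triangle_ineq2[of y x] by (simp add: norm_minus_commute)
      then show ?thesis by simp
    qed (use \<rho>D(4) in simp)
    show "conv \<rho> ?i x = 1"
      unfolding conv_def c using integral_lborel_reflect[OF test_functions_borel(1)[OF \<rho>D(1)]] \<rho>D(3) by simp
  next
    show "conv \<rho> ?i \<in> test_functions UNIV"
    proof (rule test_functionsI[OF conv_smooth[OF L \<rho>D(1)], of "cball 0 (r + 2)"])
      fix x :: "real ^ 'n" assume x: "x \<notin> cball 0 (r + 2)"
      show "conv \<rho> ?i x = 0"
      proof (rule conv_eq_0)
        show "\<rho> v = 0" if "1 \<le> norm v" for v using \<rho>D(4)[OF that] .
        show "AE y in lborel. y \<in> ball x 1 \<longrightarrow> ?i y = 0"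
        proof (intro AE_I2 impI)
          fix y assume "y \<in> ball x 1"
          then have "\<not> norm y \<le> r + 1" using x norm_triangle_ineq2[of x y] by (simp add: dist_norm)
          then show "?i y = 0" by simp
        qed
      qed
    qed auto
  qed
qed

text \<open>The limit is the sum of a telescoping series that converges uniformly on A by the
  Weierstrass test; bounds are required only from index N on.\<close>

lemma continuous_on_uniform_sum:
  fixes f :: "nat \<Rightarrow> real ^ 'n \<Rightarrow> real"
  assumes f: "\<And>j. continuous_on A (f j)" and M: "summable M"
    and le: "\<And>j x. x \<in> A \<Longrightarrow> N \<le> j \<Longrightarrow> \<bar>f (Suc j) x - f j x\<bar> \<le> M j"
  shows "continuous_on A (\<lambda>x. lim (\<lambda>j. f j x))"
proof -
  let ?g = "\<lambda>j x. f (Suc (j + N)) x - f (j + N) x"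
  have MN: "summable (\<lambda>j. M (j + N))" using M by (simp add: summable_iff_shift)
  have "uniform_limit A (\<lambda>n x. \<Sum>j<n. ?g j x) (\<lambda>x. \<Sum>j. ?g j x) sequentially"
    by (rule Weierstrass_m_test[OF _ MN]) (use le in auto)
  moreover have sum: "(\<Sum>j<n. ?g j x) = f (n + N) x - f N x" for n x
    using sum_lessThan_telescope[of "\<lambda>j. f (j + N) x" n] by simp
  ultimately have ul: "uniform_limit A (\<lambda>n x. f (n + N) x - f N x) (\<lambda>x. \<Sum>j. ?g j x) sequentially"
    by simp
  have "continuous_on A (\<lambda>x. \<Sum>j. ?g j x)"
    by (rule uniform_limit_theorem[OF _ ul]) (auto intro!: always_eventually continuous_intros f)
  then have c: "continuous_on A (\<lambda>x. (\<Sum>j. ?g j x) + f N x)" by (intro continuous_intros f)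
  have "lim (\<lambda>j. f j x) = (\<Sum>j. ?g j x) + f N x" if "x \<in> A" for x
  proof (rule limI, rule LIMSEQ_offset[of _ N])
    have "(\<lambda>n. f (n + N) x - f N x) \<longlonglongrightarrow> (\<Sum>j. ?g j x)"
      by (rule tendsto_uniform_limitI[OF ul that])
    from tendsto_add[OF this tendsto_const[of "f N x"]]
    show "(\<lambda>n. f (n + N) x) \<longlonglongrightarrow> (\<Sum>j. ?g j x) + f N x" by simp
  qed
  with c show ?thesis by (simp cong: continuous_on_cong)
qed

lemma qc_representative_exists:
  fixes w :: "real ^ 'n \<Rightarrow> real"
  assumes w: "sob w G"
  shows "\<exists>wt. qc_representative w wt"
proof -
  obtain \<theta> :: "nat \<Rightarrow> real ^ 'n \<Rightarrow> real" where \<theta>: "\<And>j. \<theta> j \<in> test_functions UNIV"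
      "\<And>j x. norm x \<le> real j \<Longrightarrow> \<theta> j x = 1"
    using cutoff_exists[of "real _", where 'n = 'n] by metis
  \<comment> \<open>With thresholds 2^(-j), the Chebyshev quotient of \<open>\<epsilon> j\<close> by
    the squared threshold is 4^(-j), which still beats the weights 2^i of the series
    estimate.\<close>
  define \<epsilon> :: "nat \<Rightarrow> real" where "\<epsilon> j = (1 / 16) ^ j" for j
  define good where "good j i \<rho> \<longleftrightarrow>
       integrable lborel (\<lambda>x. (\<theta> i x * (conv \<rho> w x - w x))\<^sup>2) \<and>
       (LBINT x. (\<theta> i x * (conv \<rho> w x - w x))\<^sup>2) \<le> \<epsilon> j \<and>
       integrable lborel (\<lambda>x. (norm (\<theta> i x *\<^sub>R (conv \<rho> G x - G x) + (conv \<rho> w x - w x) *\<^sub>R grad (\<theta> i) x))\<^sup>2) \<and>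
       (LBINT x. (norm (\<theta> i x *\<^sub>R (conv \<rho> G x - G x) + (conv \<rho> w x - w x) *\<^sub>R grad (\<theta> i) x))\<^sup>2) \<le> \<epsilon> j"
    for j i and \<rho> :: "real ^ 'n \<Rightarrow> real"
  \<comment> \<open>The function \<open>h j\<close> below compares mollifications j and j + 1 under
    the one cut-off \<open>\<theta> j\<close>, so mollifier j has to serve the cut-offs j and j - 1.
    At j = 0 the second is \<open>\<theta> 0\<close> again.\<close>
  have "\<exists>\<rho> r. is_mollifier r \<rho> \<and> good j j \<rho> \<and> good j (j - 1) \<rho>" for j
  proof -
    have \<epsilon>: "0 < \<epsilon> j" by (simp add: \<epsilon>_def)
    obtain d1 where d1: "0 < d1" "\<And>r \<rho>. r \<le> d1 \<Longrightarrow> is_mollifier r \<rho> \<Longrightarrow> good j j \<rho>"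
      using mollify_cutoff[OF w \<theta>(1) \<epsilon>, of j] unfolding good_def by blast
    obtain d2 where d2: "0 < d2" "\<And>r \<rho>. r \<le> d2 \<Longrightarrow> is_mollifier r \<rho> \<Longrightarrow> good j (j - 1) \<rho>"
      using mollify_cutoff[OF w \<theta>(1) \<epsilon>, of "j - 1"] unfolding good_def by blast
    obtain \<rho> :: "real ^ 'n \<Rightarrow> real" where "is_mollifier (min d1 d2) \<rho>"
      using mollifier_exists[of "min d1 d2"] d1(1) d2(1) by auto
    then show ?thesis using d1(2)[of "min d1 d2" \<rho>] d2(2)[of "min d1 d2" \<rho>] by auto
  qed
  then obtain \<rho> r where \<rho>: "\<And>j. is_mollifier (r j) (\<rho> j)" and good: "\<And>j. good j j (\<rho> j)" "\<And>j. good j (j - 1) (\<rho> j)"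
    by metis
  define v where "v j = conv (\<rho> j) w" for j
  note \<rho>t = is_mollifierD(1)[OF \<rho>]
  have vs: "smooth (v j)" for j unfolding v_def by (rule conv_smooth[OF sob_loc_sq[OF w] \<rho>t])
  have vg: "grad (v j) x = conv (\<rho> j) G x" for j x unfolding v_def by (rule conv_sob_grad[OF w \<rho>t])
  note [measurable] = sob_borel[OF w] test_functions_borel[OF \<theta>(1)] test_functions_borel(1)[OF \<rho>t]
  have [measurable]: "v j \<in> borel_measurable borel" for j unfolding v_def by measurable
  define h where "h j x = \<theta> j x * (v (Suc j) x - v j x)" for j x
  have ht: "h j \<in> test_functions UNIV" for j
    unfolding h_def[abs_def] by (intro test_functions_mult \<theta>(1) smooth_diff vs)
  have hg: "grad (h j) x = \<theta> j x *\<^sub>R (conv (\<rho> (Suc j)) G x - conv (\<rho> j) G x) + (v (Suc j) x - v j x) *\<^sub>R grad (\<theta> j) x" for j x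
  proof -
    have d: "\<theta> j differentiable (at x)" "v i differentiable (at x)" for i
      using test_functions_smooth[OF \<theta>(1)] vs smooth_iff by blast+
    show ?thesis
      unfolding h_def[abs_def] using d by (subst grad_mult) (auto simp: grad_diff vg intro: differentiable_diff)
  qed
  have \<epsilon>S: "\<epsilon> (Suc j) \<le> \<epsilon> j" for j by (simp add: \<epsilon>_def)
  have h2: "(LBINT x. (h j x)\<^sup>2) \<le> 4 * \<epsilon> j" for j
  proof -
    let ?a = "\<lambda>x. \<theta> j x * (v (Suc j) x - w x)" and ?b = "\<lambda>x. \<theta> j x * (v j x - w x)"
    have "(LBINT x. (norm (?a x - ?b x))\<^sup>2) \<le> 2 * (LBINT x. (norm (?a x))\<^sup>2) + 2 * (LBINT x. (norm (?b x))\<^sup>2)"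
      by (rule L2_diff(2)) (use good(1)[of j] good(2)[of "Suc j"] in \<open>auto simp: good_def v_def\<close>)
    also have "\<dots> \<le> 4 * \<epsilon> j"
      using good(1)[of j] good(2)[of "Suc j"] \<epsilon>S[of j] by (auto simp: good_def v_def)
    finally show ?thesis by (simp add: h_def algebra_simps)
  qed
  have g2: "(LBINT x. (norm (grad (h j) x))\<^sup>2) \<le> 4 * \<epsilon> j" for j
  proof -
    let ?a = "\<lambda>x. \<theta> j x *\<^sub>R (conv (\<rho> (Suc j)) G x - G x) + (v (Suc j) x - w x) *\<^sub>R grad (\<theta> j) x"
    let ?b = "\<lambda>x. \<theta> j x *\<^sub>R (conv (\<rho> j) G x - G x) + (v j x - w x) *\<^sub>R grad (\<theta> j) x"
    have "(LBINT x. (norm (?a x - ?b x))\<^sup>2) \<le> 2 * (LBINT x. (norm (?a x))\<^sup>2) + 2 * (LBINT x. (norm (?b x))\<^sup>2)"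
      by (rule L2_diff(2)) (use good(1)[of j] good(2)[of "Suc j"] in \<open>auto simp: good_def v_def\<close>)
    also have "\<dots> \<le> 4 * \<epsilon> j"
      using good(1)[of j] good(2)[of "Suc j"] \<epsilon>S[of j] by (auto simp: good_def v_def)
    also have "(\<lambda>x. ?a x - ?b x) = grad (h j)" by (auto simp: hg algebra_simps)
    finally show ?thesis .
  qed
  define s :: "nat \<Rightarrow> real" where "s j = (1 / 2) ^ j" for j
  have s: "0 < s j" for j by (simp add: s_def)
  \<comment> \<open>Outside \<open>V m\<close> the cut-off differences of consecutive mollifications
    are at most \<open>2 * s j\<close> for all j >= m, and these bounds are summable.\<close>
  define V where "V m = (\<Union>i. {x. 2 * s (m + i) < \<bar>h (m + i) x\<bar>})" for m
  have Vopen: "open (V m)" for m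
    unfolding V_def
    by (intro open_UN ballI open_Collect_less continuous_intros smooth_continuous test_functions_smooth[OF ht])
  have geo: "summable (\<lambda>i. c * (1 / 2 :: real) ^ i)" for c by (intro summable_mult summable_geometric) simp
  have geos: "(\<Sum>i. c * (1 / 2 :: real) ^ i) = 2 * c" for c
    by (subst suminf_mult) (auto simp: suminf_geometric)
  have weight: "2 ^ i * (4 * \<epsilon> (m + i) / (s (m + i))\<^sup>2) \<le> (4 * (1 / 4) ^ m) * (1 / 2) ^ i" for m i
  proof -
    have "(s k)\<^sup>2 = (1 / 4) ^ k" for k
      using power_mult[of "1 / 2 :: real" 2 k] power_mult[of "1 / 2 :: real" k 2]
      by (simp add: s_def mult.commute power2_eq_square)
    then have "\<epsilon> k / (s k)\<^sup>2 = (1 / 4) ^ k" for k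
      using power_divide[of "1 / 16 :: real" "1 / 4" k] by (simp add: \<epsilon>_def)
    then have "4 * \<epsilon> (m + i) / (s (m + i))\<^sup>2 = 4 * (1 / 4) ^ (m + i)"
      by (metis times_divide_eq_right)
    moreover have "2 ^ i * (1 / 4 :: real) ^ i = (1 / 2) ^ i" by (simp flip: power_mult_distrib)
    ultimately show ?thesis by (simp add: power_add)
  qed
  have capV: "cap (V m) \<le> ennreal (32 * (1 / 4) ^ m)" for m
  proof -
    have b1: "2 ^ i * ((LBINT x. (h (m + i) x)\<^sup>2) / (s (m + i))\<^sup>2) \<le> (4 * (1 / 4) ^ m) * (1 / 2) ^ i" for i
      by (rule order_trans[OF _ weight]) (intro mult_left_mono divide_right_mono h2; simp)
    have b2: "2 ^ i * ((LBINT x. (norm (grad (h (m + i)) x))\<^sup>2) / (s (m + i))\<^sup>2) \<le> (4 * (1 / 4) ^ m) * (1 / 2) ^ i" for i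
      by (rule order_trans[OF _ weight]) (intro mult_left_mono divide_right_mono g2; simp)
    have s1: "summable (\<lambda>i. 2 ^ i * ((LBINT x. (h (m + i) x)\<^sup>2) / (s (m + i))\<^sup>2))"
      by (rule summable_comparison_test'[OF geo[of "4 * (1 / 4) ^ m"], of 0]) (use b1 in simp)
    have s2: "summable (\<lambda>i. 2 ^ i * ((LBINT x. (norm (grad (h (m + i)) x))\<^sup>2) / (s (m + i))\<^sup>2))"
      by (rule summable_comparison_test'[OF geo[of "4 * (1 / 4) ^ m"], of 0]) (use b2 in simp)
    have "cap (V m) \<le> ennreal (2 * (\<Sum>i. 2 ^ i * ((LBINT x. (h (m + i) x)\<^sup>2) / (s (m + i))\<^sup>2))
      + 2 * (\<Sum>i. 2 ^ i * ((LBINT x. (norm (grad (h (m + i)) x))\<^sup>2) / (s (m + i))\<^sup>2)))"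
      unfolding V_def by (rule cap_Union_le[OF ht s s1 s2])
    \<comment> \<open>Each of the two series is at most 8 * 4^(-m), and both are doubled.\<close>
    also have "\<dots> \<le> ennreal (32 * (1 / 4) ^ m)"
      using suminf_le[OF b1 s1 geo] suminf_le[OF b2 s2 geo] unfolding geos by (intro ennreal_leI) simp
    finally show ?thesis .
  qed
  \<comment> \<open>\<open>lim\<close> is unspecified where the sequence diverges, but that can
    happen only at points lying in every \<open>V m\<close>.\<close>
  define wt where "wt x = lim (\<lambda>j. v j x)" for x
  have cont: "continuous_on (- V m) wt" for m
    unfolding continuous_on_eq_continuous_within
  proof
    fix x assume x: "x \<in> - V m"
    obtain N where N: "norm x < real N" using reals_Archimedean2 by blast
    \<comment> \<open>On a bounded piece \<open>\<theta> j\<close> is 1 from some index on, so the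
      bound on \<open>h j\<close> concerns the mollifications themselves. As continuity is local,
      bounded pieces suffice.\<close>
    let ?A = "- V m \<inter> ball 0 (real N)"
    have "continuous_on ?A wt"
      unfolding wt_def
    proof (rule continuous_on_uniform_sum[where M = "\<lambda>j. 2 * (1 / 2) ^ j" and N = "max m N"])
      show "continuous_on ?A (v j)" for j by (rule smooth_continuous[OF vs])
      show "summable (\<lambda>j. 2 * (1 / 2 :: real) ^ j)" by (rule geo)
      fix j y assume y: "y \<in> ?A" and j: "max m N \<le> j"
      have "\<not> 2 * s (m + (j - m)) < \<bar>h (m + (j - m)) y\<bar>" using y unfolding V_def by blast
      then have "\<bar>h j y\<bar> \<le> 2 * s j" using j by simp
      moreover have "\<theta> j y = 1" using y j by (intro \<theta>(2)) simp
      ultimately show "\<bar>v (Suc j) y - v j y\<bar> \<le> 2 * (1 / 2) ^ j" by (simp add: h_def s_def)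
    qed
    then have "continuous (at x within ?A) wt"
      using x N by (simp add: continuous_on_eq_continuous_within)
    moreover have "at x within - V m = at x within ?A"
      by (rule at_within_nhd[of x "ball 0 (real N)"]) (use N in auto)
    ultimately show "continuous (at x within - V m) wt" by simp
  qed
  have "quasi_continuous wt"
    unfolding quasi_continuous_def
  proof (intro allI impI)
    fix e :: real assume "0 < e"
    have "(\<lambda>m. 32 * (1 / 4 :: real) ^ m) \<longlonglongrightarrow> 32 * 0"
      by (intro tendsto_mult tendsto_const LIMSEQ_realpow_zero) auto
    then have "(\<lambda>m. 32 * (1 / 4 :: real) ^ m) \<longlonglongrightarrow> 0" by simp
    then have "\<forall>\<^sub>F m in sequentially. 32 * (1 / 4 :: real) ^ m < e"
      using \<open>0 < e\<close> by (rule order_tendstoD(2))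
    then obtain m where m: "32 * (1 / 4 :: real) ^ m < e" by (auto simp: eventually_sequentially)
    have "cap (V m) < ennreal e"
      by (rule le_less_trans[OF capV]) (use m in \<open>simp add: ennreal_less_iff\<close>)
    then show "\<exists>G. open G \<and> cap G < ennreal e \<and> continuous_on (- G) wt"
      using Vopen cont by blast
  qed
  moreover have "AE x in lborel. wt x = w x"
  proof -
    \<comment> \<open>The integrals of these squares are at most \<open>\<epsilon> j\<close>, which
      is summable. So the squares are summable almost everywhere and tend to 0.\<close>
    have "AE x in lborel. summable (\<lambda>j. (\<theta> j x * (v j x - w x))\<^sup>2)"
    proof (rule AE_summable)
      show "integrable lborel (\<lambda>x. (\<theta> j x * (v j x - w x))\<^sup>2)" for j
        using good(1)[of j] by (simp add: good_def v_def)
      have "summable \<epsilon>" unfolding \<epsilon>_def by (rule summable_geometric) simp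
      then show "summable (\<lambda>j. LBINT x. (\<theta> j x * (v j x - w x))\<^sup>2)"
        by (rule summable_comparison_test'[of _ 0]) (use good(1) in \<open>simp add: good_def v_def\<close>)
    qed simp
    then show ?thesis
    proof eventually_elim
      case (elim x)
      obtain N where N: "norm x < real N" using reals_Archimedean2 by blast
      have "(\<lambda>j. (\<theta> j x * (v j x - w x))\<^sup>2) \<longlonglongrightarrow> 0" by (rule summable_LIMSEQ_zero[OF elim])
      then have "(\<lambda>j. (v j x - w x)\<^sup>2) \<longlonglongrightarrow> 0"
      proof (rule Lim_transform_eventually)
        show "\<forall>\<^sub>F j in sequentially. (\<theta> j x * (v j x - w x))\<^sup>2 = (v j x - w x)\<^sup>2"
          unfolding eventually_sequentially
        proof (intro exI[of _ N] allI impI)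
          fix j assume "N \<le> j"
          then have "\<theta> j x = 1" using N by (intro \<theta>(2)) simp
          then show "(\<theta> j x * (v j x - w x))\<^sup>2 = (v j x - w x)\<^sup>2" by simp
        qed
      qed
      then have "(\<lambda>j. sqrt ((v j x - w x)\<^sup>2)) \<longlonglongrightarrow> sqrt 0" by (rule tendsto_real_sqrt)
      then have "(\<lambda>j. v j x - w x) \<longlonglongrightarrow> 0" by (simp add: tendsto_rabs_zero_iff)
      then have "(\<lambda>j. v j x) \<longlonglongrightarrow> w x" by (rule LIM_zero_cancel)
      then show ?case unfolding wt_def by (rule limI)
    qed
  qed
  ultimately show ?thesis unfolding qc_representative_def by blast
qed

section \<open>The inverse problem\<close>

text \<open>The extension agrees with u up to a locally constant function, which is constant on the
  connected U. Subtracting this constant gives agreement almost everywhere on U and leaves the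
  gradient unchanged.\<close>

lemma extension_domain_sob:
  assumes "extension_domain U" "u \<in> Hdot1 U"
  obtains w G where "sob w G" "AE x in lborel. x \<in> U \<longrightarrow> u x = w x"
proof -
  from assms obtain E where con: "connected U" "U \<noteq> {}" and E: "E u \<in> Hdot1 UNIV" "Hdot1_eq U (E u) u"
    unfolding extension_domain_def by blast
  from E(2) obtain c where c: "\<And>x. x \<in> U \<Longrightarrow> \<exists>V. open V \<and> x \<in> V \<and> c constant_on (V \<inter> U)"
      "AE x in lborel. x \<in> U \<longrightarrow> E u x = u x + c x"
    unfolding Hdot1_eq_def by blast
  have "c constant_on U"
  proof (rule locally_constant_imp_constant[OF con(1)])
    fix a assume a: "a \<in> U"
    then obtain V where V: "open V" "a \<in> V" "c constant_on (V \<inter> U)" using c(1) by blast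
    then have "\<forall>x\<in>V \<inter> U. c x = c a" using a unfolding constant_on_def by (metis IntI)
    moreover have "openin (top_of_set U) (V \<inter> U)" using V(1) by (metis Int_commute openin_open_Int)
    ultimately show "\<exists>T. openin (top_of_set U) T \<and> a \<in> T \<and> (\<forall>x\<in>T. c x = c a)"
      using V(2) a by blast
  qed
  then obtain l where l: "\<And>x. x \<in> U \<Longrightarrow> c x = l" unfolding constant_on_def by blast
  have "AE x in lborel. x \<in> U \<longrightarrow> u x = E u x - l"
    using c(2) by eventually_elim (simp add: l)
  then show ?thesis using that[OF sob_shift[OF Hdot1_UNIV_sob[OF E(1)]]] by blast
qed

section \<open>Representatives of traces\<close>

lemma cap_empty: "cap {} = 0"
proof -
  have "(\<lambda>x. 0) \<in> test_functions (UNIV :: (real ^ 'n) set)"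
    by (rule test_functionsI[OF smooth_const, of "{}"]) auto
  from cap_le[OF open_empty test_functions_sob[OF this]] show ?thesis by simp
qed

lemma Bdot_eq_refl: "Bdot_eq U f f"
  unfolding Bdot_eq_def qe_on_def using cap_empty by (intro exI[of _ 0] exI[of _ "{}"]) auto

lemma Hdot1_eqI:
  assumes "AE x in lborel. x \<in> U \<longrightarrow> u x = v x"
  shows "Hdot1_eq U u v"
  unfolding Hdot1_eq_def using assms by (intro exI[of _ "\<lambda>_. 0"]) (auto simp: constant_on_def)

lemma interior_trace_nonempty:
  assumes "extension_domain U" "u \<in> Hdot1 U"
  shows "interior_trace U u \<noteq> {}"
proof -
  obtain w G where w: "sob w G" "AE x in lborel. x \<in> U \<longrightarrow> u x = w x"
    using assms by (rule extension_domain_sob)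
  obtain wt where wt: "qc_representative w wt" using qc_representative_exists[OF w(1)] by blast
  have "Hdot1_eq U w u" by (rule Hdot1_eqI) (use w(2) in \<open>auto elim: eventually_mono\<close>)
  then have "wt \<in> interior_trace U u"
    unfolding interior_trace_def using sob_Hdot1_UNIV[OF w(1)] wt Bdot_eq_refl by blast
  then show ?thesis by blast
qed

text \<open>The global function behind a boundary class, restricted to U, has that class as its
  trace. This lets a functional that vanishes on all traces be recognised as zero.\<close>

lemma Bdot_interior_trace:
  assumes "f \<in> Bdot U" "open U"
  obtains v where "v \<in> Hdot1 U" "f \<in> interior_trace U v"
proof -
  from assms(1) obtain w wt where w: "w \<in> Hdot1 UNIV" "qc_representative w wt" "Bdot_eq U f wt"
    unfolding Bdot_def by blast
  have s: "sob w (weak_grad UNIV w)" by (rule Hdot1_UNIV_sob[OF w(1)])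
  have [measurable]: "w \<in> borel_measurable borel" "U \<in> sets borel" using sob_borel[OF s] assms(2) by auto
  have "w \<in> Hdot1 U"
    by (rule sob_restrict(2)[OF s assms(2)]) (auto simp: set_borel_measurable_def)
  moreover have "f \<in> interior_trace U w"
    unfolding interior_trace_def using w Hdot1_eqI[of U w w] by auto
  ultimately show ?thesis by (rule that)
qed

section \<open>Energies and the weak formulation\<close>

lemma Hdot1_measurable:
  assumes "u \<in> Hdot1 U"
  shows "set_borel_measurable lborel U u"
  using assms by (simp add: Hdot1_def L2_loc_def)

lemma weak_gradient_on_measurable:
  "weak_gradient_on U u G \<Longrightarrow> (\<lambda>x. indicator U x *\<^sub>R G x) \<in> borel_measurable borel"
  by (simp add: weak_gradient_on_def L2_field_def set_borel_measurable_def)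

text \<open>The gradients chosen in the definition may be replaced by explicit ones, such as those
  of extensions.\<close>

lemma Hdot1_inner_eq:
  assumes U: "open U" and G: "weak_gradient_on U u G" and H: "weak_gradient_on U v H"
  shows "Hdot1_inner U u v = (LBINT x. indicator U x * (G x \<bullet> H x))"
proof -
  have AE: "AE x in lborel. x \<in> U \<longrightarrow> weak_grad U u x = G x" "AE x in lborel. x \<in> U \<longrightarrow> weak_grad U v x = H x"
    by (rule weak_grad_AE_eq[OF U G], rule weak_grad_AE_eq[OF U H])
  have W: "weak_gradient_on U u (weak_grad U u)" "weak_gradient_on U v (weak_grad U v)"
    using someI[of "\<lambda>G. G \<in> L2_field U \<and> has_weak_gradient U u G" G] G
      someI[of "\<lambda>G. G \<in> L2_field U \<and> has_weak_gradient U v G" H] H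
    by (auto simp: weak_grad_def weak_gradient_on_def)
  note [measurable] = W[THEN weak_gradient_on_measurable] G[THEN weak_gradient_on_measurable]
    H[THEN weak_gradient_on_measurable]
  have eq: "indicator U x * (A \<bullet> B) = (indicator U x *\<^sub>R A) \<bullet> (indicator U x *\<^sub>R B)" for x :: "real ^ 'a" and A B :: "real ^ 'a"
    by (auto simp: indicator_def)
  show ?thesis
    unfolding Hdot1_inner_def set_lebesgue_integral_def real_scaleR_def eq
  proof (rule integral_cong_AE)
    show "AE x in lborel. indicator U x *\<^sub>R weak_grad U u x \<bullet> indicator U x *\<^sub>R weak_grad U v x =
        indicator U x *\<^sub>R G x \<bullet> indicator U x *\<^sub>R H x"
      using AE by eventually_elim (auto simp: indicator_def)
  qed measurable
qed

text \<open>The factor \<open>indicator U\<close> turns energies over U into integrals over the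
  whole space, where the gradients of extensions live.\<close>

definition conductivity :: "(real ^ 'n) set \<Rightarrow> (real ^ 'n) set \<Rightarrow> real \<Rightarrow> real ^ 'n \<Rightarrow> real" where
  "conductivity U D k x = indicator U x * (1 + (k - 1) * indicator D x)"

lemma conductivity_L2:
  fixes G :: "real ^ 'n \<Rightarrow> real ^ 'n"
  assumes [measurable]: "U \<in> sets borel" "D \<in> sets borel" "G \<in> borel_measurable borel"
    and G: "integrable lborel (\<lambda>x. (norm (G x))\<^sup>2)"
  shows "conductivity U D k \<in> borel_measurable borel"
    and "(\<lambda>x. conductivity U D k x *\<^sub>R G x) \<in> borel_measurable borel"
    and "integrable lborel (\<lambda>x. (norm (conductivity U D k x *\<^sub>R G x))\<^sup>2)"
proof -
  show m [measurable]: "conductivity U D k \<in> borel_measurable borel"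
    unfolding conductivity_def by measurable
  show "(\<lambda>x. conductivity U D k x *\<^sub>R G x) \<in> borel_measurable borel"
    by (intro borel_measurable_scaleR m assms)
  have I: "integrable lborel (\<lambda>x. (1 + k\<^sup>2) * (norm (G x))\<^sup>2)" using G by simp
  \<comment> \<open>The only possible values are 0, 1 and k.\<close>
  have "(conductivity U D k x)\<^sup>2 \<le> 1 + k\<^sup>2" for x by (auto simp: conductivity_def indicator_def)
  then have "(norm (conductivity U D k x *\<^sub>R G x))\<^sup>2 \<le> (1 + k\<^sup>2) * (norm (G x))\<^sup>2" for x
    by (simp add: power_mult_distrib mult_right_mono)
  then show "integrable lborel (\<lambda>x. (norm (conductivity U D k x *\<^sub>R G x))\<^sup>2)"
    by (intro Bochner_Integration.integrable_bound[OF I] AE_I2) auto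
qed

lemma weak_solution_test:
  assumes U: "open U" and D: "open D" and u: "weak_solution U D k g u"
    and w: "sob w G" "AE x in lborel. x \<in> U \<longrightarrow> u x = w x" and \<phi>: "\<phi> \<in> test_functions U"
  shows "(LBINT x. (conductivity U D k x *\<^sub>R G x) \<bullet> grad \<phi> x) = 0"
proof -
  have uH: "u \<in> Hdot1 U" using u by (simp add: weak_solution_def)
  have [measurable]: "U \<in> sets borel" "D \<in> sets borel" using U D by auto
  note [measurable] = sob_borel[OF w(1)] test_functions_borel[OF \<phi>] weak_gradient_on_measurable[OF weak_grad_spec[OF uH]]
  have [measurable]: "conductivity U D k \<in> borel_measurable borel" unfolding conductivity_def by measurable
  have "weak_gradient_on U u G" by (rule sob_restrict(1)[OF w(1) U Hdot1_measurable[OF uH] w(2)])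
  then have AE: "AE x in lborel. x \<in> U \<longrightarrow> weak_grad U u x = G x" by (rule weak_grad_AE_eq[OF U])
  have "(LINT x:U|lborel. (1 + (k - 1) * indicator D x) * (weak_grad U u x \<bullet> grad \<phi> x)) =
      (LBINT x. conductivity U D k x * ((indicator U x *\<^sub>R weak_grad U u x) \<bullet> grad \<phi> x))"
    unfolding set_lebesgue_integral_def
    by (intro Bochner_Integration.integral_cong refl) (auto simp: conductivity_def indicator_def)
  also have "\<dots> = (LBINT x. (conductivity U D k x *\<^sub>R G x) \<bullet> grad \<phi> x)"
  proof (rule integral_cong_AE)
    show "AE x in lborel. conductivity U D k x * ((indicator U x *\<^sub>R weak_grad U u x) \<bullet> grad \<phi> x) =
        (conductivity U D k x *\<^sub>R G x) \<bullet> grad \<phi> x"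
      using AE by eventually_elim (auto simp: conductivity_def indicator_def)
  qed measurable
  finally show ?thesis using u \<phi> by (simp add: weak_solution_def)
qed

text \<open>Split z into (1 - \<eta>) z and \<eta> z. The second part has compact support in U and
  is annihilated by the equation. The gradient of the first vanishes near \<open>closure D\<close>,
  so in its energy the conductivity may be replaced by 1, and the boundary condition gives
  \<open>g f\<close>. For the same reason only the values of G off \<open>closure D\<close>
  contribute to \<open>g f\<close>.\<close>

lemma weak_solution_pairing:
  assumes U: "open U" and D: "open D" and u: "weak_solution U D k g u"
    and w: "sob w G" "AE x in lborel. x \<in> U \<longrightarrow> u x = w x"
    and v: "v \<in> Hdot1 U" "f \<in> interior_trace U v"
    and z: "sob z H" "AE x in lborel. x \<in> U \<longrightarrow> v x = z x"
  shows "(LBINT x. (conductivity U D k x *\<^sub>R G x) \<bullet> H x) = g f"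
    and "AE x in lborel. x \<in> U - closure D \<longrightarrow> G x = 0 \<Longrightarrow> g f = 0"
proof -
  let ?F = "\<lambda>x. conductivity U D k x *\<^sub>R G x"
  from u obtain \<eta> where uH: "u \<in> Hdot1 U" and \<eta>: "cutoff U D \<eta>"
      and eq: "Hdot1_inner U u (\<lambda>x. (1 - \<eta> x) * v x) = g f"
    using v unfolding weak_solution_def by blast
  from \<eta> obtain W where \<eta>t: "\<eta> \<in> test_functions U" and W: "open W" "closure D \<subseteq> W" "\<And>x. x \<in> W \<Longrightarrow> \<eta> x = 1"
    unfolding cutoff_def by blast
  have [measurable]: "U \<in> sets borel" "D \<in> sets borel" using U D by auto
  note [measurable] = sob_borel[OF w(1)] sob_borel[OF z(1)] test_functions_borel[OF \<eta>t]
  define H1 where "H1 x = (1 - \<eta> x) *\<^sub>R H x - z x *\<^sub>R grad \<eta> x" for x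
  define H2 where "H2 x = \<eta> x *\<^sub>R H x + z x *\<^sub>R grad \<eta> x" for x
  obtain B where B: "0 \<le> B" "\<And>x. \<bar>\<eta> x\<bar> \<le> B" "\<And>x. norm (grad \<eta> x) \<le> B"
    using test_functions_bounded[OF \<eta>t] by metis
  obtain r where r: "0 < r" "\<And>x. r < norm x \<Longrightarrow> \<eta> x = 0 \<and> grad \<eta> x = 0"
    using test_functions_supp[OF \<eta>t] by metis
  have dif: "\<eta> differentiable (at x)" for x using test_functions_smooth[OF \<eta>t] smooth_iff by blast
  have g1: "grad (\<lambda>x. 1 - \<eta> x) x = - grad \<eta> x" for x by (simp add: grad_diff dif)
  have "sob (\<lambda>x. (1 - \<eta> x) * z x) (\<lambda>x. (1 - \<eta> x) *\<^sub>R H x + z x *\<^sub>R grad (\<lambda>x. 1 - \<eta> x) x)"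
  proof (rule sob_mult[OF z(1), of _ "1 + B" r])
    show "smooth (\<lambda>x. 1 - \<eta> x)" by (intro smooth_diff smooth_const test_functions_smooth[OF \<eta>t])
    show "\<bar>1 - \<eta> x\<bar> \<le> 1 + B" for x using B(2)[of x] by linarith
    show "norm (grad (\<lambda>x. 1 - \<eta> x) x) \<le> 1 + B" for x using B(3)[of x] by (simp add: g1)
    show "grad (\<lambda>x. 1 - \<eta> x) x = 0" if "r < norm x" for x using r(2)[OF that] by (simp add: g1)
  qed
  then have s1: "sob (\<lambda>x. (1 - \<eta> x) * z x) H1"
    by (simp add: g1 H1_def[abs_def])
  have s2: "sob (\<lambda>x. \<eta> x * z x) H2"
    unfolding H2_def by (rule sob_mult[OF z(1) test_functions_smooth[OF \<eta>t] B(2,3), of r]) (use r(2) in auto)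
  have vm [measurable]: "(\<lambda>x. indicator U x *\<^sub>R v x) \<in> borel_measurable borel"
    using Hdot1_measurable[OF v(1)] by (simp add: set_borel_measurable_def)
  have um: "(\<lambda>x. indicator U x *\<^sub>R ((1 - \<eta> x) * v x)) = (\<lambda>x. (1 - \<eta> x) * (indicator U x *\<^sub>R v x))"
    by (auto simp: indicator_def)
  have "set_borel_measurable lborel U (\<lambda>x. (1 - \<eta> x) * v x)"
    unfolding set_borel_measurable_def um by measurable
  then have wH1: "weak_gradient_on U (\<lambda>x. (1 - \<eta> x) * v x) H1"
    by (rule sob_restrict(1)[OF s1 U]) (use z(2) in \<open>auto elim: eventually_mono\<close>)
  have wG: "weak_gradient_on U u G" by (rule sob_restrict(1)[OF w(1) U Hdot1_measurable[OF uH] w(2)])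
  have H1W: "H1 x = 0" if "x \<in> W" for x
  proof -
    have "grad \<eta> x = grad (\<lambda>_. 1) x" by (rule grad_cong_open[OF W(1) that W(3)])
    then show ?thesis using W(3)[OF that] by (simp add: H1_def)
  qed
  have gf: "g f = (LBINT x. indicator U x * (G x \<bullet> H1 x))"
    using eq Hdot1_inner_eq[OF U wG wH1] by simp
  also have "\<dots> = (LBINT x. ?F x \<bullet> H1 x)"
  proof (intro Bochner_Integration.integral_cong refl)
    fix x
    show "indicator U x * (G x \<bullet> H1 x) = ?F x \<bullet> H1 x"
    proof (cases "x \<in> D")
      case True
      then have "x \<in> W" using W(2) closure_subset by blast
      then show ?thesis by (simp add: H1W)
    qed (simp add: conductivity_def)
  qed
  finally have gF: "g f = (LBINT x. ?F x \<bullet> H1 x)" .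
  note F = conductivity_L2[OF _ _ sob_borel(2)[OF w(1)] sob_L2[OF w(1)], of U D k]
  have Fm [measurable]: "?F \<in> borel_measurable borel" and FL: "integrable lborel (\<lambda>x. (norm (?F x))\<^sup>2)"
    using F(2,3) by auto
  have zero: "(LBINT x. ?F x \<bullet> H2 x) = 0"
    unfolding H2_def by (rule test_extension[OF z(1) \<eta>t Fm FL weak_solution_test[OF U D u w]])
  have "(LBINT x. ?F x \<bullet> H1 x + ?F x \<bullet> H2 x) = (LBINT x. ?F x \<bullet> H1 x) + (LBINT x. ?F x \<bullet> H2 x)"
    by (intro Bochner_Integration.integral_add L2_inner(1) Fm FL)
      (use sob_borel[OF s1] sob_L2[OF s1] sob_borel[OF s2] sob_L2[OF s2] in auto)
  moreover have "?F x \<bullet> H1 x + ?F x \<bullet> H2 x = ?F x \<bullet> H x" for x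
    by (simp add: H1_def H2_def algebra_simps flip: inner_add_right)
  ultimately show "(LBINT x. ?F x \<bullet> H x) = g f" using gF zero by simp
  assume van: "AE x in lborel. x \<in> U - closure D \<longrightarrow> G x = 0"
  have "AE x in lborel. indicator U x * (G x \<bullet> H1 x) = 0"
    using van by eventually_elim (use H1W W(2) in \<open>auto simp: indicator_def\<close>)
  then show "g f = 0" unfolding gf by (rule integral_eq_zero_AE)
qed

text \<open>The integrals of \<sigma> |A - B|^2 and (\<tau> - \<sigma>) |B|^2 are nonnegative and
  add up to m - 2 m + m = 0: the energy of B under \<sigma>, which is not known, cancels.\<close>

lemma energy_rigidity:
  fixes A B :: "'a \<Rightarrow> 'b::euclidean_space"
  assumes [measurable]: "A \<in> borel_measurable M" "B \<in> borel_measurable M" "\<sigma> \<in> borel_measurable M" "\<tau> \<in> borel_measurable M"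
    and A: "integrable M (\<lambda>x. (norm (A x))\<^sup>2)" "integrable M (\<lambda>x. (norm (\<sigma> x *\<^sub>R A x))\<^sup>2)"
    and B: "integrable M (\<lambda>x. (norm (B x))\<^sup>2)" "integrable M (\<lambda>x. (norm (\<sigma> x *\<^sub>R B x))\<^sup>2)"
      "integrable M (\<lambda>x. (norm (\<tau> x *\<^sub>R B x))\<^sup>2)"
    and \<sigma>: "\<And>x. 0 \<le> \<sigma> x" "\<And>x. \<sigma> x \<le> \<tau> x"
    and eq: "(LINT x|M. (\<sigma> x *\<^sub>R A x) \<bullet> A x) = m" "(LINT x|M. (\<sigma> x *\<^sub>R A x) \<bullet> B x) = m"
      "(LINT x|M. (\<tau> x *\<^sub>R B x) \<bullet> B x) = m"
  shows "AE x in M. 0 < \<sigma> x \<longrightarrow> A x = B x" and "AE x in M. \<sigma> x < \<tau> x \<longrightarrow> B x = 0"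
proof -
  let ?p = "\<lambda>x. \<sigma> x * (norm (A x - B x))\<^sup>2"
  let ?q = "\<lambda>x. (\<tau> x - \<sigma> x) * (norm (B x))\<^sup>2"
  have I: "integrable M (\<lambda>x. (\<sigma> x *\<^sub>R A x) \<bullet> A x)" "integrable M (\<lambda>x. (\<sigma> x *\<^sub>R A x) \<bullet> B x)"
    "integrable M (\<lambda>x. (\<sigma> x *\<^sub>R B x) \<bullet> B x)" "integrable M (\<lambda>x. (\<tau> x *\<^sub>R B x) \<bullet> B x)"
    by (rule L2_inner(1); use A B in simp)+
  have p: "?p x = (\<sigma> x *\<^sub>R A x) \<bullet> A x - 2 * ((\<sigma> x *\<^sub>R A x) \<bullet> B x) + (\<sigma> x *\<^sub>R B x) \<bullet> B x" for x
    by (simp add: power2_norm_eq_inner inner_diff_left inner_diff_right inner_commute[of "B x" "A x"] algebra_simps)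
  have q: "?q x = (\<tau> x *\<^sub>R B x) \<bullet> B x - (\<sigma> x *\<^sub>R B x) \<bullet> B x" for x
    by (simp add: power2_norm_eq_inner algebra_simps)
  have Ip: "integrable M ?p" and Iq: "integrable M ?q" unfolding p q using I by auto
  have "integral\<^sup>L M ?p = m - 2 * m + (LINT x|M. (\<sigma> x *\<^sub>R B x) \<bullet> B x)"
    unfolding p using I eq by simp
  moreover have "integral\<^sup>L M ?q = m - (LINT x|M. (\<sigma> x *\<^sub>R B x) \<bullet> B x)"
    unfolding q using I eq by simp
  moreover have "0 \<le> integral\<^sup>L M ?p" "0 \<le> integral\<^sup>L M ?q"
    using \<sigma> by (auto intro!: Bochner_Integration.integral_nonneg)
  ultimately have "integral\<^sup>L M ?p = 0" "integral\<^sup>L M ?q = 0" by auto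
  then have "AE x in M. ?p x = 0" "AE x in M. ?q x = 0"
    using Ip Iq \<sigma> by (simp_all add: integral_nonneg_eq_0_iff_AE)
  then show "AE x in M. 0 < \<sigma> x \<longrightarrow> A x = B x" "AE x in M. \<sigma> x < \<tau> x \<longrightarrow> B x = 0"
    by (eventually_elim, auto)+
qed

theorem theorem7p3:
  fixes \<Omega> D1 D2 :: "(real ^ 'n) set" and k :: real
    and g :: "(real ^ 'n \<Rightarrow> real) \<Rightarrow> real" and u1 u2 :: "real ^ 'n \<Rightarrow> real"
  assumes "admissible \<Omega>"
    and "two_sided_admissible D1" and "two_sided_admissible D2"
    and "D1 \<subseteq> D2" and "compactly_contained D2 \<Omega>"
    and "k \<in> {0<..<1} \<union> {1<..}"
    and "g \<in> Bdot_dual \<Omega>" and "\<exists>f\<in>Bdot \<Omega>. g f \<noteq> 0"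
    and "weak_solution \<Omega> D1 k g u1" and "weak_solution \<Omega> D2 k g u2"
    and "interior_trace \<Omega> u1 = interior_trace \<Omega> u2"
  shows "D1 = D2"
proof (rule ccontr)
  assume "D1 \<noteq> D2"
  have ext: "extension_domain \<Omega>" using assms(1) by (simp add: admissible_def)
  then have \<Omega>: "open \<Omega>" "connected \<Omega>" by (auto simp: extension_domain_def)
  have D: "open D1" "open D2" "connected (- closure D1)" "frontier D1 = frontier (- closure D1)"
    using assms(2,3) by (auto simp: two_sided_admissible_def extension_domain_def)
  have cl: "closure D1 \<subseteq> closure D2" "closure D2 \<subseteq> \<Omega>"
    using assms(4,5) by (auto simp: compactly_contained_def closure_mono)
  have k: "0 < k" "k \<noteq> 1" using assms(6) by auto
  have uH: "u1 \<in> Hdot1 \<Omega>" "u2 \<in> Hdot1 \<Omega>" using assms(9,10) by (auto simp: weak_solution_def)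
  obtain w1 G1 where w1: "sob w1 G1" "AE x in lborel. x \<in> \<Omega> \<longrightarrow> u1 x = w1 x"
    by (rule extension_domain_sob[OF ext uH(1)])
  obtain w2 G2 where w2: "sob w2 G2" "AE x in lborel. x \<in> \<Omega> \<longrightarrow> u2 x = w2 x"
    by (rule extension_domain_sob[OF ext uH(2)])
  have [measurable]: "\<Omega> \<in> sets borel" "D1 \<in> sets borel" "D2 \<in> sets borel" using \<Omega> D by auto
  note [measurable] = sob_borel[OF w1(1)] sob_borel[OF w2(1)]
  \<comment> \<open>One representative of the common trace serves in all four energies, which
    therefore have one common value.\<close>
  obtain f where f: "f \<in> interior_trace \<Omega> u1" "f \<in> interior_trace \<Omega> u2"
    using interior_trace_nonempty[OF ext uH(1)] assms(11) by auto
  let ?\<sigma> = "conductivity \<Omega> D1 k" and ?\<tau> = "conductivity \<Omega> D2 k"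
  note pair1 = weak_solution_pairing(1)[OF \<Omega>(1) D(1) assms(9) w1]
  note pair2 = weak_solution_pairing(1)[OF \<Omega>(1) D(2) assms(10) w2]
  have e: "(LINT x|lborel. (?\<sigma> x *\<^sub>R G1 x) \<bullet> G1 x) = g f" "(LINT x|lborel. (?\<sigma> x *\<^sub>R G1 x) \<bullet> G2 x) = g f"
    "(LINT x|lborel. (?\<tau> x *\<^sub>R G2 x) \<bullet> G1 x) = g f" "(LINT x|lborel. (?\<tau> x *\<^sub>R G2 x) \<bullet> G2 x) = g f"
    by (rule pair1[OF uH(1) f(1) w1], rule pair1[OF uH(2) f(2) w2],
        rule pair2[OF uH(1) f(1) w1], rule pair2[OF uH(2) f(2) w2])
  have L: "integrable lborel (\<lambda>x. (norm (G1 x))\<^sup>2)" "integrable lborel (\<lambda>x. (norm (G2 x))\<^sup>2)"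
    using w1(1) w2(1) by (auto intro: sob_L2)
  have cm: "?\<sigma> \<in> borel_measurable borel" "?\<tau> \<in> borel_measurable borel"
    by (rule conductivity_L2(1)[OF _ _ _ L(1)]; measurable)+
  have cL: "integrable lborel (\<lambda>x. (norm (conductivity \<Omega> D' k x *\<^sub>R G1 x))\<^sup>2)"
    "integrable lborel (\<lambda>x. (norm (conductivity \<Omega> D' k x *\<^sub>R G2 x))\<^sup>2)" if "D' \<in> {D1, D2}" for D'
  proof -
    have [measurable]: "D' \<in> sets borel" using that by auto
    show "integrable lborel (\<lambda>x. (norm (conductivity \<Omega> D' k x *\<^sub>R G1 x))\<^sup>2)"
      by (rule conductivity_L2(3)[OF _ _ _ L(1)]; measurable)
    show "integrable lborel (\<lambda>x. (norm (conductivity \<Omega> D' k x *\<^sub>R G2 x))\<^sup>2)"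
      by (rule conductivity_L2(3)[OF _ _ _ L(2)]; measurable)
  qed
  have pos: "0 \<le> ?\<sigma> x" "0 \<le> ?\<tau> x" "x \<in> \<Omega> \<Longrightarrow> 0 < ?\<sigma> x" "x \<in> \<Omega> \<Longrightarrow> 0 < ?\<tau> x" for x
    using k by (auto simp: conductivity_def indicator_def)
  have D2\<Omega>: "D2 \<subseteq> \<Omega>" using cl(2) closure_subset by blast
  have van: "AE x in lborel. x \<in> D2 - D1 \<longrightarrow> G1 x = 0"
  \<comment> \<open>The smaller conductivity takes the role of \<sigma> in
    \<open>energy_rigidity\<close>: that of \<open>D1\<close> for k > 1, that of \<open>D2\<close>
    for k < 1.\<close>
  proof (cases "1 < k")
    case True
    have le: "?\<sigma> x \<le> ?\<tau> x" for x using True assms(4) by (auto simp: conductivity_def indicator_def)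
    have "AE x in lborel. 0 < ?\<sigma> x \<longrightarrow> G1 x = G2 x" "AE x in lborel. ?\<sigma> x < ?\<tau> x \<longrightarrow> G2 x = 0"
      by (rule energy_rigidity[OF _ _ _ _ L(1) cL(1)[of D1] L(2) cL(2)[of D1] cL(2)[of D2] pos(1) le e(1,2,4)];
          use cm in simp)+
    then show ?thesis
    proof eventually_elim
      case (elim x)
      show ?case
      proof
        assume "x \<in> D2 - D1"
        then have "0 < ?\<sigma> x" "?\<sigma> x < ?\<tau> x" using True D2\<Omega> by (auto simp: conductivity_def)
        then show "G1 x = 0" using elim by simp
      qed
    qed
  next
    case False
    with k have k1: "k < 1" by simp
    have le: "?\<tau> x \<le> ?\<sigma> x" for x using k1 assms(4) by (auto simp: conductivity_def indicator_def)
    \<comment> \<open>With the roles exchanged, \<open>G1\<close> is the field paired with the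
      larger conductivity, so its vanishing comes directly from the second conclusion.\<close>
    have "AE x in lborel. ?\<tau> x < ?\<sigma> x \<longrightarrow> G1 x = 0"
      by (rule energy_rigidity(2)[OF _ _ _ _ L(2) cL(2)[of D2] L(1) cL(1)[of D2] cL(1)[of D1] pos(2) le e(4,3,1)];
          use cm in simp)
    then show ?thesis
    proof eventually_elim
      case (elim x)
      show ?case
      proof
        assume "x \<in> D2 - D1"
        then have "?\<tau> x < ?\<sigma> x" using k1 D2\<Omega> by (auto simp: conductivity_def)
        then show "G1 x = 0" using elim by simp
      qed
    qed
  qed
  \<comment> \<open>\<open>D1\<close> is regular open: an interior point of
    \<open>closure D1\<close> is not in the frontier of the exterior, which by two-sidedness is the
    frontier of \<open>D1\<close>. This is what makes distinct domains leave an open gap.\<close>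
  have D1int: "D1 = interior (closure D1)"
  proof
    show "D1 \<subseteq> interior (closure D1)" by (intro interior_maximal closure_subset D)
    show "interior (closure D1) \<subseteq> D1"
    proof
      fix x assume x: "x \<in> interior (closure D1)"
      then have "x \<notin> closure (- closure D1)" by (simp add: closure_complement)
      then have "x \<notin> frontier D1" unfolding D(4) by (auto simp: frontier_def)
      moreover have "x \<in> closure D1" using x interior_subset by blast
      ultimately show "x \<in> D1" using D(1) by (simp add: frontier_def interior_open)
    qed
  qed
  have "D2 - closure D1 \<noteq> {}"
  proof
    assume "D2 - closure D1 = {}"
    then have "D2 \<subseteq> interior (closure D1)" by (intro interior_maximal D) blast
    then show False using D1int assms(4) \<open>D1 \<noteq> D2\<close> by blast
  qed
  let ?V = "\<Omega> \<inter> - closure D1"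
  have opV: "open ?V" using \<Omega>(1) by (intro open_Int open_Compl closed_closure)
  have conV: "connected ?V"
    by (rule connected_Int_of_open_cover) (use \<Omega> D cl in auto)
  have "AE x in lborel. x \<in> ?V \<longrightarrow> G1 x = 0"
  proof (rule unique_continuation[OF w1(1) opV conV, of "D2 - closure D1"])
    \<comment> \<open>Off \<open>closure D1\<close> the first conductivity is 1, so there the
      equation is Laplace's.\<close>
    fix \<phi> assume \<phi>: "\<phi> \<in> test_functions ?V"
    have "(LINT x|lborel. G1 x \<bullet> grad \<phi> x) = (LINT x|lborel. (?\<sigma> x *\<^sub>R G1 x) \<bullet> grad \<phi> x)"
    proof (intro Bochner_Integration.integral_cong refl)
      fix x
      show "G1 x \<bullet> grad \<phi> x = (?\<sigma> x *\<^sub>R G1 x) \<bullet> grad \<phi> x"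
      proof (cases "x \<in> ?V")
        case True
        then have "x \<notin> D1" using closure_subset by blast
        then show ?thesis using True by (simp add: conductivity_def)
      qed (use test_functions_outside[OF \<phi>] in simp)
    qed
    also have "\<dots> = 0"
      by (rule weak_solution_test[OF \<Omega>(1) D(1) assms(9) w1 test_functions_mono[OF _ \<phi>]]) simp
    finally show "(LINT x|lborel. G1 x \<bullet> grad \<phi> x) = 0" .
  next
    show "AE x in lborel. x \<in> D2 - closure D1 \<longrightarrow> G1 x = 0"
      using van by eventually_elim (use closure_subset in blast)
  qed (use \<Omega> D D2\<Omega> \<open>D2 - closure D1 \<noteq> {}\<close> in auto)
  then have van\<Omega>: "AE x in lborel. x \<in> \<Omega> - closure D1 \<longrightarrow> G1 x = 0"
    by eventually_elim auto
  obtain f' where f': "f' \<in> Bdot \<Omega>" "g f' \<noteq> 0" using assms(8) by blast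
  obtain v where v: "v \<in> Hdot1 \<Omega>" "f' \<in> interior_trace \<Omega> v"
    by (rule Bdot_interior_trace[OF f'(1) \<Omega>(1)])
  obtain z H where z: "sob z H" "AE x in lborel. x \<in> \<Omega> \<longrightarrow> v x = z x"
    by (rule extension_domain_sob[OF ext v(1)])
  have "g f' = 0"
    by (rule weak_solution_pairing(2)[OF \<Omega>(1) D(1) assms(9) w1 v z van\<Omega>])
  with f' show False by simp
qed

end
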